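(* Consider, for $T>0$ and data $\Phi=\{\varphi,F,E\}$, the inverse problem of finding a pair $(a,u)$ such that $$u_t=a(t)u_{xx}+F(x,t),\quad 0<x<1,\ 0<t\le T,$$ $$u(x,0)=\varphi(x),\quad 0\le x\le 1,$$ $$u(0,t)=u(1,t),\quad u_x(1,t)=0,\quad 0\le t\le T,$$ $$\int_0^1 u(x,t)\,dx=E(t),\quad 0\le t\le T.$$ Under the assumptions $(A_1)$, $(A_2)$, $(A_3)$ listed in the context, the classical solution $(a,u)$ depends continuously upon the data for small $T$. Precisely: let $\Phi=\{\varphi,F,E\}$ be data satisfying $(A_1)$–$(A_3)$ on a time interval $[0,T_*]$, with finite norm $\|\Phi\|_{T_*}$. Then there is $T_1\in(0,T_*]$ such that for every $T\in(0,T_1]$ the following holds: for every $\varepsilon>0$ there is $\delta>0$ such that, whenever $\overline{\Phi}=\{\overline{\varphi},\overline{F},\overline{E}\}$ satisfies $(A_1)$–$(A_3)$ on $[0,T]$ with finite norm and $\|\Phi-\overline{\Phi}\|_T<\delta$, and $(a,u)$, $(\overline{a},\overline{u})$ are classical solutions on $Q_T$ of the inverse problem with data $\Phi$ (restricted to $[0,T]$) and $\overline{\Phi}$ respectively, one has $$\|a-\overline{a}\|_{C[0,T]}<\varepsilon\quad\text{and}\quad\|u-\overline{u}\|_{C(\overline{Q}_T)}<\varepsilon.$$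
   Context: Notation: $Q_T=\{(x,t):0<x<1,\ 0<t\le T\}$ and $\overline{Q}_T=[0,1]\times[0,T]$. $C^{2,1}(Q_T)$ denotes the functions $u$ with $u,u_x,u_{xx},u_t$ continuous on $Q_T$; $C^{1,0}(\overline{Q}_T)$ denotes the functions $u$ with $u,u_x$ continuous on $\overline{Q}_T$; $C^{4,0}(\overline{Q}_T)$ denotes the functions whose $x$-derivatives up to order $4$ are continuous on $\overline{Q}_T$, with the norm given by the sum of the suprema of these derivatives. The norm of the data is $$\|\Phi\|_T=\|\varphi\|_{C^4[0,1]}+\|F\|_{C^{4,0}(\overline{Q}_T)}+\|E\|_{C^1[0,T]};$$ "finite norm" means $\varphi\in C^4[0,1]$, $F\in C^{4,0}(\overline{Q}_T)$, $E\in C^1[0,T]$. Classical solution on $Q_T$: a pair $(a,u)$ in $C[0,T]\times\bigl(C^{2,1}(Q_T)\cap C^{1,0}(\overline{Q}_T)\bigr)$ satisfying all four conditions of the inverse problem (equation, initial condition, boundary conditions, integral condition) and $a(t)>0$ on $[0,T]$. Let $Y_0(x)=x$, $Y_{2k-1}(x)=x\cos 2\pi kx$, $Y_{2k}(x)=\sin 2\pi kx$ for $k=1,2,\dots$, and put $\varphi_k=\int_0^1\varphi(x)Y_k(x)\,dx$, $F_k(t)=\int_0^1F(x,t)Y_k(x)\,dx$ for $k=0,1,2,\dots$. Assumptions on data on the time interval $[0,T]$ (on $[0,T_*]$: the same with $T_*$ in place of $T$): $(A_1)$ $E\in C^1[0,T]$ and $E'(t)<0$ for all $t\in[0,T]$.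 $(A_2)$ $\varphi\in C^4[0,1]$; (1) $\varphi(0)=\varphi(1)$, $\varphi'(1)=0$, $\varphi''(0)=\varphi''(1)$, $\int_0^1\varphi(x)\,dx=E(0)$; (2) $\varphi_{2k}\ge 0$ for $k=1,2,\dots$. $(A_3)$ $F\in C(\overline{Q}_T)$, and $F(\cdot,t)\in C^4[0,1]$ for each fixed $t\in[0,T]$; (1) $F(0,t)=F(1,t)$, $F_x(1,t)=0$, $F_{xx}(0,t)=F_{xx}(1,t)$ for all $t\in[0,T]$; (2) $F_{2k}(t)\ge 0$ for all $t\in[0,T]$ and $k=0,1,2,\dots$, and $$\int_0^TE'(t)\,dt+\sum_{k=1}^\infty\frac{2}{\pi k}\varphi_{2k}-2\int_0^TF_0(t)\,dt>0.$$ *)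

theory Defs
  imports "HOL-Analysis.Analysis"
begin

section \<open>Derivatives and function spaces\<close>

text \<open>Derivatives are taken relative to the set on which the function is considered, hence they
  are one-sided at those end points of an interval that belong to it.\<close>

definition nth_deriv_on :: "real set \<Rightarrow> nat \<Rightarrow> (real \<Rightarrow> real) \<Rightarrow> real \<Rightarrow> real" where
  "nth_deriv_on S k = ((\<lambda>f x. vector_derivative f (at x within S)) ^^ k)"

definition times_differentiable_on :: "nat \<Rightarrow> real set \<Rightarrow> (real \<Rightarrow> real) \<Rightarrow> bool" where
  "times_differentiable_on k S f \<longleftrightarrow>
     (\<forall>j<k. \<forall>x\<in>S. nth_deriv_on S j f differentiable (at x within S))"

definition Ck_on :: "nat \<Rightarrow> real set \<Rightarrow> (real \<Rightarrow> real) \<Rightarrow> bool" where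
  "Ck_on k S f \<longleftrightarrow> times_differentiable_on k S f
     \<and> (\<forall>j\<le>k. continuous_on S (nth_deriv_on S j f))"

text \<open>Functions of space and time are curried, the space variable \<open>x\<close> coming first.\<close>

definition QT :: "real \<Rightarrow> (real \<times> real) set" where
  "QT T = {0<..<1} \<times> {0<..T}"

definition QT_closed :: "real \<Rightarrow> (real \<times> real) set" where
  "QT_closed T = {0..1} \<times> {0..T}"

definition x_deriv :: "real set \<Rightarrow> nat \<Rightarrow> (real \<Rightarrow> real \<Rightarrow> real) \<Rightarrow> real \<Rightarrow> real \<Rightarrow> real" where
  "x_deriv S k u x t = nth_deriv_on S k (\<lambda>y. u y t) x"

definition t_deriv :: "real set \<Rightarrow> (real \<Rightarrow> real \<Rightarrow> real) \<Rightarrow> real \<Rightarrow> real \<Rightarrow> real" where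
  "t_deriv S u x t = nth_deriv_on S 1 (u x) t"

definition C21 :: "real \<Rightarrow> (real \<Rightarrow> real \<Rightarrow> real) \<Rightarrow> bool" where
  "C21 T u \<longleftrightarrow>
     (\<forall>t\<in>{0<..T}. times_differentiable_on 2 {0<..<1} (\<lambda>x. u x t))
   \<and> (\<forall>x\<in>{0<..<1}. times_differentiable_on 1 {0<..T} (u x))
   \<and> (\<forall>j\<le>2. continuous_on (QT T) (\<lambda>(x, t). x_deriv {0<..<1} j u x t))
   \<and> continuous_on (QT T) (\<lambda>(x, t). t_deriv {0<..T} u x t)"

definition Ck0 :: "nat \<Rightarrow> real \<Rightarrow> (real \<Rightarrow> real \<Rightarrow> real) \<Rightarrow> bool" where
  "Ck0 k T u \<longleftrightarrow>
     (\<forall>t\<in>{0..T}. times_differentiable_on k {0..1} (\<lambda>x. u x t))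
   \<and> (\<forall>j\<le>k. continuous_on (QT_closed T) (\<lambda>(x, t). x_deriv {0..1} j u x t))"

section \<open>Norms\<close>

text \<open>The suprema are suprema of real numbers; they are meaningful because they are only used for
  continuous functions on nonempty compact sets.\<close>

definition sup_norm :: "'a set \<Rightarrow> ('a \<Rightarrow> real) \<Rightarrow> real" where
  "sup_norm S f = (SUP p\<in>S. \<bar>f p\<bar>)"

definition Ck_norm :: "nat \<Rightarrow> real set \<Rightarrow> (real \<Rightarrow> real) \<Rightarrow> real" where
  "Ck_norm k S f = (\<Sum>j\<le>k. sup_norm S (nth_deriv_on S j f))"

definition Ck0_norm :: "nat \<Rightarrow> real \<Rightarrow> (real \<Rightarrow> real \<Rightarrow> real) \<Rightarrow> real" where
  "Ck0_norm k T u = (\<Sum>j\<le>k. sup_norm (QT_closed T) (\<lambda>(x, t). x_deriv {0..1} j u x t))"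

definition data_norm ::
  "real \<Rightarrow> (real \<Rightarrow> real) \<Rightarrow> (real \<Rightarrow> real \<Rightarrow> real) \<Rightarrow> (real \<Rightarrow> real) \<Rightarrow> real" where
  "data_norm T \<phi> F E = Ck_norm 4 {0..1} \<phi> + Ck0_norm 4 T F + Ck_norm 1 {0..T} E"

definition finite_norm ::
  "real \<Rightarrow> (real \<Rightarrow> real) \<Rightarrow> (real \<Rightarrow> real \<Rightarrow> real) \<Rightarrow> (real \<Rightarrow> real) \<Rightarrow> bool" where
  "finite_norm T \<phi> F E \<longleftrightarrow> Ck_on 4 {0..1} \<phi> \<and> Ck0 4 T F \<and> Ck_on 1 {0..T} E"

section \<open>Assumptions on the data\<close>

definition Y :: "nat \<Rightarrow> real \<Rightarrow> real" where
  "Y n x = (if n = 0 then x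
            else if even n then sin (2 * pi * real (n div 2) * x)
            else x * cos (2 * pi * real ((n + 1) div 2) * x))"

lemma Y_0: "Y 0 x = x"
  by (simp add: Y_def)

lemma Y_odd: "k \<ge> 1 \<Longrightarrow> Y (2 * k - 1) x = x * cos (2 * pi * real k * x)"
  by (auto simp: Y_def)

lemma Y_even: "k \<ge> 1 \<Longrightarrow> Y (2 * k) x = sin (2 * pi * real k * x)"
  by (simp add: Y_def)

definition Y_coeff :: "(real \<Rightarrow> real) \<Rightarrow> nat \<Rightarrow> real" where
  "Y_coeff f k = integral {0..1} (\<lambda>x. f x * Y k x)"

definition assm_A1 :: "real \<Rightarrow> (real \<Rightarrow> real) \<Rightarrow> bool" where
  "assm_A1 T E \<longleftrightarrow> Ck_on 1 {0..T} E \<and> (\<forall>t\<in>{0..T}. nth_deriv_on {0..T} 1 E t < 0)"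

definition assm_A2 :: "(real \<Rightarrow> real) \<Rightarrow> (real \<Rightarrow> real) \<Rightarrow> bool" where
  "assm_A2 \<phi> E \<longleftrightarrow>
     Ck_on 4 {0..1} \<phi>
   \<and> \<phi> 0 = \<phi> 1
   \<and> nth_deriv_on {0..1} 1 \<phi> 1 = 0
   \<and> nth_deriv_on {0..1} 2 \<phi> 0 = nth_deriv_on {0..1} 2 \<phi> 1
   \<and> integral {0..1} \<phi> = E 0
   \<and> (\<forall>k\<ge>1. Y_coeff \<phi> (2 * k) \<ge> 0)"

text \<open>The series below is indexed from \<open>0\<close>, its \<open>k\<close>-th term being the one with number \<open>k + 1\<close>.
  It converges for every \<open>\<phi>\<close> that is continuously differentiable on \<open>[0, 1]\<close>, because then the sine
  coefficients are \<open>O(1/k)\<close>.\<close>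

definition assm_A3 ::
  "real \<Rightarrow> (real \<Rightarrow> real) \<Rightarrow> (real \<Rightarrow> real \<Rightarrow> real) \<Rightarrow> (real \<Rightarrow> real) \<Rightarrow> bool" where
  "assm_A3 T \<phi> F E \<longleftrightarrow>
     continuous_on (QT_closed T) (\<lambda>(x, t). F x t)
   \<and> (\<forall>t\<in>{0..T}. Ck_on 4 {0..1} (\<lambda>x. F x t))
   \<and> (\<forall>t\<in>{0..T}. F 0 t = F 1 t
        \<and> x_deriv {0..1} 1 F 1 t = 0
        \<and> x_deriv {0..1} 2 F 0 t = x_deriv {0..1} 2 F 1 t)
   \<and> (\<forall>t\<in>{0..T}. \<forall>k. Y_coeff (\<lambda>x. F x t) (2 * k) \<ge> 0)
   \<and> integral {0..T} (nth_deriv_on {0..T} 1 E)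
       + (\<Sum>k. 2 / (pi * real (k + 1)) * Y_coeff \<phi> (2 * (k + 1)))
       - 2 * integral {0..T} (\<lambda>t. Y_coeff (\<lambda>x. F x t) 0) > 0"

definition admissible_data ::
  "real \<Rightarrow> (real \<Rightarrow> real) \<Rightarrow> (real \<Rightarrow> real \<Rightarrow> real) \<Rightarrow> (real \<Rightarrow> real) \<Rightarrow> bool" where
  "admissible_data T \<phi> F E \<longleftrightarrow>
     assm_A1 T E \<and> assm_A2 \<phi> E \<and> assm_A3 T \<phi> F E \<and> finite_norm T \<phi> F E"

section \<open>Classical solutions of the inverse problem\<close>

definition classical_solution ::
  "real \<Rightarrow> (real \<Rightarrow> real) \<Rightarrow> (real \<Rightarrow> real \<Rightarrow> real) \<Rightarrow> (real \<Rightarrow> real)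
    \<Rightarrow> (real \<Rightarrow> real) \<Rightarrow> (real \<Rightarrow> real \<Rightarrow> real) \<Rightarrow> bool" where
  "classical_solution T \<phi> F E a u \<longleftrightarrow>
     continuous_on {0..T} a
   \<and> C21 T u \<and> Ck0 1 T u
   \<and> (\<forall>(x, t)\<in>QT T. t_deriv {0<..T} u x t = a t * x_deriv {0<..<1} 2 u x t + F x t)
   \<and> (\<forall>x\<in>{0..1}. u x 0 = \<phi> x)
   \<and> (\<forall>t\<in>{0..T}. u 0 t = u 1 t \<and> x_deriv {0..1} 1 u 1 t = 0)
   \<and> (\<forall>t\<in>{0..T}. integral {0..1} (\<lambda>x. u x t) = E t)
   \<and> (\<forall>t\<in>{0..T}. a t > 0)"

end

theory Submission
  imports Defs
begin

text \<open>
  Multiply the equation by \<open>sin (\<mu> x)\<close>, \<open>x cos (\<mu> x)\<close> or \<open>x\<close>, where \<open>\<mu> = 2 \<pi> n\<close> with \<open>n \<ge> 1\<close>, and integrate.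
  The boundary conditions \<open>u(0,t) = u(1,t)\<close>, \<open>u\<^sub>x(1,t) = 0\<close> remove every boundary term, so these three kinds
  of coefficients of \<open>u\<close> solve linear ordinary differential equations.  The sine coefficients \<open>s_n\<close> involve
  the unknown \<open>a\<close> only through the elapsed diffusivity \<open>A(t) = \<integral>\<^sub>0\<^sup>t a\<close>:
  \<open>s_n(t) = \<phi>_n exp (-\<mu>\<^sup>2 A(t)) + \<integral>\<^sub>0\<^sup>t F_n(\<tau>) exp (-\<mu>\<^sup>2 (A(t) - A(\<tau>))) d\<tau>\<close>.
  The functions are recovered from these coefficients by a series that is proved from the classical
  Fourier theorem for continuous periodic functions with summable coefficients (\<open>ionkin_series\<close>).
  Two consequences of the same theorem are what links \<open>a\<close> to the data: the identities
  \<open>E - 2 \<integral> x u = \<Sum> (4/\<mu>) s_n\<close> (\<open>mean_minus_moment_series\<close>) and \<open>u\<^sub>x(0,t) = \<Sum> 4 \<mu> s_n\<close>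
  (\<open>boundary_slope_series\<close>).

  Testing with \<open>1\<close> gives \<open>a(t) u\<^sub>x(0,t) = \<integral> F - E'(t)\<close>.  All \<open>s_n\<close> are nonnegative, so
  \<open>u\<^sub>x(0,t) \<ge> E - 2 \<integral> x u\<close>, and the right-hand side is bounded below by the positive quantity
  (\<open>margin\<close>) of the last assumption, which varies continuously with the data.  Hence \<open>a\<close> has an
  upper bound that is uniform near the given data (\<open>slope_lower_bound\<close>, \<open>a_le\<close>).

  The heart of the proof is \<open>path_gap_upper\<close>, an argument of maximum principle type.  Let \<open>A\<close> and
  \<open>A'\<close> belong to two solutions and let \<open>A - A'\<close> be maximal at \<open>t\<^sub>1\<close>, with value \<open>\<beta>\<close>.  Then
  \<open>A(t\<^sub>1) - A(\<tau>) \<ge> A'(t\<^sub>1) - A'(\<tau>)\<close> for all earlier \<open>\<tau>\<close>, so replacing \<open>A\<close> by \<open>A'\<close> does not decrease any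
  \<open>s_n(t\<^sub>1)\<close>, and it increases one with \<open>\<phi>_n > 0\<close> by at least a multiple of \<open>\<beta>\<close>.  But
  \<open>\<Sum> (4/\<mu>) s_n = E - 2 \<integral> x u\<close> is prescribed by the data, so \<open>\<beta>\<close> is at most a constant times the
  distance \<open>\<delta>\<close> of the data.

  Once \<open>A\<close> and \<open>A'\<close> are close, \<open>\<bar>exp (-p) - exp (-q)\<bar> \<le> sqrt \<bar>p - q\<bar>\<close> costs one power of \<open>\<mu>\<close> and
  leaves series that converge, because the boundary conditions and four derivatives give
  \<open>\<phi>_n = O(\<mu>\<^sup>-\<^sup>4)\<close>.  This yields in turn that \<open>u\<^sub>x(0,t)\<close>, the quotient
  \<open>a = (\<integral> F - E') / u\<^sub>x(0,t)\<close>, the remaining coefficients and \<open>u\<close> itself change by at most a constant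
  times \<open>sqrt \<delta>\<close> (\<open>stability_estimate\<close>).  Such constants exist for every \<open>T\<close> up to \<open>Tstar\<close>, so
  \<open>Tstar\<close> serves as \<open>T1\<close>.
\<close>

section \<open>Linear decay equations and Duhamel's formula\<close>

text \<open>The solution of \<open>y' = f - \<nu> A' y\<close>, \<open>y(0) = p\<close>.  It is expressed by the increments of \<open>A\<close> so that two
  different diffusivities can be compared through \<open>A\<close> alone.\<close>

definition duhamel :: "real \<Rightarrow> (real \<Rightarrow> real) \<Rightarrow> real \<Rightarrow> (real \<Rightarrow> real) \<Rightarrow> real \<Rightarrow> real" where
  "duhamel \<nu> A p f t = p * exp (- \<nu> * A t) + integral {0..t} (\<lambda>s. f s * exp (- \<nu> * (A t - A s)))"

lemma duhamel_integrable:
  fixes A f :: "real \<Rightarrow> real"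
  assumes "continuous_on {0..T} A" "continuous_on {0..T} f" "t \<in> {0..T}"
  shows "(\<lambda>s. f s * exp (- \<nu> * (A t - A s))) integrable_on {0..t}"
  by (rule integrable_continuous_interval)
     (use assms in \<open>auto intro!: continuous_intros intro: continuous_on_subset\<close>)

text \<open>The integrating factor \<open>exp (\<nu> \<integral> a)\<close> turns the equation into an exact derivative.\<close>

lemma duhamel_unique:
  fixes a f y :: "real \<Rightarrow> real"
  assumes a: "continuous_on {0..T} a" and f: "continuous_on {0..T} f"
    and y: "\<And>t. t \<in> {0..T} \<Longrightarrow>
      (y has_vector_derivative (f t - \<nu> * a t * y t)) (at t within {0..T})"
    and t: "t \<in> {0..T}"
  shows "y t = duhamel \<nu> (\<lambda>t. integral {0..t} a) (y 0) f t"
proof -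
  define A where "A = (\<lambda>t. integral {0..t} a)"
  have A: "(A has_vector_derivative a s) (at s within {0..T})" if "s \<in> {0..T}" for s
    unfolding A_def by (rule integral_has_vector_derivative[OF a that])
  have cA: "continuous_on {0..T} A"
    using A has_vector_derivative_continuous continuous_on_eq_continuous_within by blast
  let ?z = "\<lambda>s. y s * exp (\<nu> * A s)"
  have "((\<lambda>s. f s * exp (\<nu> * A s)) has_integral ?z t - ?z 0) {0..t}"
  proof (rule fundamental_theorem_of_calculus)
    fix s assume s: "s \<in> {0..t}"
    then have sT: "s \<in> {0..T}" using t by auto
    have "(?z has_vector_derivative f s * exp (\<nu> * A s)) (at s within {0..T})"
      using y[OF sT] A[OF sT]
      unfolding has_real_derivative_iff_has_vector_derivative[symmetric]
      by (auto intro!: derivative_eq_intros simp: algebra_simps)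
    then show "(?z has_vector_derivative f s * exp (\<nu> * A s)) (at s within {0..t})"
      by (rule has_vector_derivative_within_subset) (use t in auto)
  qed (use t in auto)
  then have "((\<lambda>s. exp (- \<nu> * A t) * (f s * exp (\<nu> * A s))) has_integral
      exp (- \<nu> * A t) * (?z t - ?z 0)) {0..t}"
    by (rule has_integral_mult_right)
  moreover have "(\<lambda>s. exp (- \<nu> * A t) * (f s * exp (\<nu> * A s)))
      = (\<lambda>s. f s * exp (- \<nu> * (A t - A s)))"
    by (simp add: fun_eq_iff exp_add[symmetric] exp_diff exp_minus field_simps right_diff_distrib)
  moreover have "exp (- \<nu> * A t) * (?z t - ?z 0) = y t - y 0 * exp (- \<nu> * A t)"
    by (simp add: A_def exp_minus field_simps)
  ultimately have "((\<lambda>s. f s * exp (- \<nu> * (A t - A s))) has_integral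
      y t - y 0 * exp (- \<nu> * A t)) {0..t}"
    by (simp only:)
  then show ?thesis
    unfolding duhamel_def A_def[symmetric] by (simp add: integral_unique)
qed

lemma integral_le_length_times_bound:
  fixes f :: "real \<Rightarrow> real"
  assumes "f integrable_on {0..t}" "\<And>s. s \<in> {0..t} \<Longrightarrow> \<bar>f s\<bar> \<le> G" "0 \<le> t" "t \<le> T"
  shows "\<bar>integral {0..t} f\<bar> \<le> T * G"
proof -
  have G: "0 \<le> G" using assms(2)[of 0] assms(3) by auto
  have "norm (integral {0..t} f) \<le> integral {0..t} (\<lambda>_. G)"
    by (rule integral_norm_bound_integral) (use assms in auto)
  also have "\<dots> = G * t" using assms(3) by simp
  also have "\<dots> \<le> T * G" using assms G by (simp add: mult.commute mult_left_mono)
  finally show ?thesis by simp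
qed

text \<open>For nondecreasing \<open>A\<close> all exponentials are at most \<open>1\<close>.\<close>

lemma duhamel_bound:
  assumes A: "continuous_on {0..T} A" and f: "continuous_on {0..T} f" and t: "t \<in> {0..T}"
    and mono: "\<And>s r. 0 \<le> s \<Longrightarrow> s \<le> r \<Longrightarrow> r \<le> T \<Longrightarrow> A s \<le> A r" and A0: "A 0 = 0" and "0 \<le> \<nu>"
    and p: "\<bar>p\<bar> \<le> P" and fG: "\<And>s. s \<in> {0..T} \<Longrightarrow> \<bar>f s\<bar> \<le> G"
  shows "\<bar>duhamel \<nu> A p f t\<bar> \<le> P + T * G"
proof -
  have *: "\<bar>q * exp (- \<nu> * r)\<bar> \<le> Q" if "\<bar>q\<bar> \<le> Q" "0 \<le> r" for q r Q
  proof -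
    have "\<bar>q\<bar> * exp (- \<nu> * r) \<le> Q * 1"
      using that \<open>0 \<le> \<nu>\<close> by (intro mult_mono) auto
    then show ?thesis by (simp add: abs_mult)
  qed
  have "\<bar>p * exp (- \<nu> * A t)\<bar> \<le> P" using *[OF p, of "A t"] mono[of 0 t] A0 t by auto
  moreover have "\<bar>integral {0..t} (\<lambda>s. f s * exp (- \<nu> * (A t - A s)))\<bar> \<le> T * G"
  proof (rule integral_le_length_times_bound)
    show "(\<lambda>s. f s * exp (- \<nu> * (A t - A s))) integrable_on {0..t}"
      by (rule duhamel_integrable[OF A f t])
    fix s assume s: "s \<in> {0..t}"
    show "\<bar>f s * exp (- \<nu> * (A t - A s))\<bar> \<le> G"
      by (rule *) (use s t fG mono[of s t] in auto)
  qed (use t in auto)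
  ultimately show ?thesis unfolding duhamel_def by linarith
qed

lemma duhamel_nonneg:
  assumes "0 \<le> p" "\<And>s. s \<in> {0..t} \<Longrightarrow> 0 \<le> f s"
    "continuous_on {0..T} A" "continuous_on {0..T} f" "t \<in> {0..T}"
  shows "0 \<le> duhamel \<nu> A p f t"
  unfolding duhamel_def
  by (intro add_nonneg_nonneg mult_nonneg_nonneg integral_nonneg duhamel_integrable[OF assms(3-5)])
     (use assms in auto)

lemma duhamel_diff_data:
  assumes A: "continuous_on {0..T} A" and f: "continuous_on {0..T} f" "continuous_on {0..T} f'"
    and t: "t \<in> {0..T}"
  shows "duhamel \<nu> A p f t - duhamel \<nu> A p' f' t = duhamel \<nu> A (p - p') (\<lambda>s. f s - f' s) t"
  unfolding duhamel_def
  using integral_diff[OF duhamel_integrable[OF A f(1) t] duhamel_integrable[OF A f(2) t], of \<nu> \<nu>]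
  by (simp add: left_diff_distrib)

text \<open>Interpolates between the bounds \<open>1\<close> and \<open>\<bar>x - y\<bar>\<close>.  The Lipschitz bound alone would cost a factor
  \<open>\<mu>\<^sup>2\<close> in the coefficient estimates, the square root costs only \<open>\<mu>\<close>.\<close>

lemma exp_minus_diff_le_sqrt:
  fixes x y :: real
  assumes "0 \<le> x" "0 \<le> y"
  shows "\<bar>exp (- x) - exp (- y)\<bar> \<le> sqrt \<bar>x - y\<bar>"
proof -
  have *: "exp (- a) - exp (- b) \<le> sqrt (b - a)" if "0 \<le> a" "a \<le> b" for a b :: real
  proof -
    have "exp (- a) - exp (- b) = exp (- a) * (1 - exp (- (b - a)))"
      by (simp add: algebra_simps exp_add[symmetric])
    also have "\<dots> \<le> 1 * (1 - exp (- (b - a)))"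
      using that by (intro mult_right_mono) auto
    finally have "exp (- a) - exp (- b) \<le> 1 - exp (- (b - a))" by simp
    moreover have "1 - exp (- (b - a)) \<le> 1" by simp
    moreover have "1 - exp (- (b - a)) \<le> b - a"
      using exp_ge_add_one_self[of "- (b - a)"] by linarith
    ultimately have 1: "exp (- a) - exp (- b) \<le> 1" "exp (- a) - exp (- b) \<le> b - a" by linarith+
    show ?thesis
    proof (cases "b - a \<le> 1")
      case True
      then have "(b - a)\<^sup>2 \<le> b - a" using that by (simp add: power2_eq_square mult_left_le)
      then have "b - a \<le> sqrt (b - a)" by (rule real_le_rsqrt)
      then show ?thesis using 1 by linarith
    next
      case False
      then have "1 \<le> sqrt (b - a)" by simp
      then show ?thesis using 1 by linarith
    qed
  qed
  show ?thesis
  proof (cases "x \<le> y")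
    case True
    then show ?thesis using *[of x y] assms by (simp add: abs_if)
  next
    case False
    then show ?thesis using *[of y x] assms by (simp add: abs_if)
  qed
qed

lemma duhamel_diff_path:
  assumes A: "continuous_on {0..T} A" "continuous_on {0..T} A'" and f: "continuous_on {0..T} f"
    and t: "t \<in> {0..T}"
    and mono: "\<And>s r. 0 \<le> s \<Longrightarrow> s \<le> r \<Longrightarrow> r \<le> T \<Longrightarrow> A s \<le> A r" and A0: "A 0 = 0"
    and mono': "\<And>s r. 0 \<le> s \<Longrightarrow> s \<le> r \<Longrightarrow> r \<le> T \<Longrightarrow> A' s \<le> A' r" and A0': "A' 0 = 0"
    and \<nu>: "0 \<le> \<nu>" and p: "\<bar>p\<bar> \<le> P" and fG: "\<And>s. s \<in> {0..T} \<Longrightarrow> \<bar>f s\<bar> \<le> G"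
    and close: "\<And>s. s \<in> {0..T} \<Longrightarrow> \<bar>A s - A' s\<bar> \<le> \<beta>"
  shows "\<bar>duhamel \<nu> A p f t - duhamel \<nu> A' p f t\<bar> \<le> (P + T * G) * sqrt (2 * \<nu> * \<beta>)"
proof -
  have \<beta>: "0 \<le> \<beta>" using close[of 0] t by auto
  have *: "\<bar>q * exp (- \<nu> * x) - q * exp (- \<nu> * y)\<bar> \<le> Q * sqrt (2 * \<nu> * \<beta>)"
    if "\<bar>q\<bar> \<le> Q" "0 \<le> x" "0 \<le> y" "\<bar>x - y\<bar> \<le> 2 * \<beta>" for q x y Q
  proof -
    have "\<bar>exp (- (\<nu> * x)) - exp (- (\<nu> * y))\<bar> \<le> sqrt \<bar>\<nu> * x - \<nu> * y\<bar>"
      by (rule exp_minus_diff_le_sqrt) (use that \<nu> in auto)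
    also have "\<bar>\<nu> * x - \<nu> * y\<bar> = \<nu> * \<bar>x - y\<bar>"
      using \<nu> by (simp add: abs_mult right_diff_distrib[symmetric])
    also have "sqrt (\<nu> * \<bar>x - y\<bar>) \<le> sqrt (2 * \<nu> * \<beta>)"
      using mult_left_mono[OF that(4) \<nu>] by simp
    finally have "\<bar>q\<bar> * \<bar>exp (- (\<nu> * x)) - exp (- (\<nu> * y))\<bar> \<le> Q * sqrt (2 * \<nu> * \<beta>)"
      using that(1) by (intro mult_mono) auto
    then show ?thesis by (simp add: abs_mult[symmetric] right_diff_distrib)
  qed
  have "\<bar>p * exp (- \<nu> * A t) - p * exp (- \<nu> * A' t)\<bar> \<le> P * sqrt (2 * \<nu> * \<beta>)"
    by (rule *[OF p]) (use mono[of 0 t] mono'[of 0 t] A0 A0' t close[of t] \<beta> in auto)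
  moreover have "\<bar>integral {0..t} (\<lambda>s. f s * exp (- \<nu> * (A t - A s)) - f s * exp (- \<nu> * (A' t - A' s)))\<bar>
      \<le> T * (G * sqrt (2 * \<nu> * \<beta>))"
  proof (rule integral_le_length_times_bound)
    show "(\<lambda>s. f s * exp (- \<nu> * (A t - A s)) - f s * exp (- \<nu> * (A' t - A' s))) integrable_on {0..t}"
      by (intro integrable_diff duhamel_integrable[OF A(1) f t] duhamel_integrable[OF A(2) f t])
    fix s assume s: "s \<in> {0..t}"
    show "\<bar>f s * exp (- \<nu> * (A t - A s)) - f s * exp (- \<nu> * (A' t - A' s))\<bar> \<le> G * sqrt (2 * \<nu> * \<beta>)"
      by (rule *) (use s t fG mono[of s t] mono'[of s t] close[of t] close[of s] in auto)
  qed (use t in auto)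
  moreover have "integral {0..t} (\<lambda>s. f s * exp (- \<nu> * (A t - A s)) - f s * exp (- \<nu> * (A' t - A' s)))
      = integral {0..t} (\<lambda>s. f s * exp (- \<nu> * (A t - A s))) - integral {0..t} (\<lambda>s. f s * exp (- \<nu> * (A' t - A' s)))"
    by (rule integral_diff[OF duhamel_integrable[OF A(1) f t] duhamel_integrable[OF A(2) f t]])
  ultimately show ?thesis unfolding duhamel_def by (simp add: algebra_simps)
qed

text \<open>If \<open>A - A'\<close> attains its maximum over the past at time \<open>t\<close>, every increment \<open>A t - A s\<close> dominates
  the corresponding increment of \<open>A'\<close>; the source term is then damped more strongly by \<open>A\<close> than by
  \<open>A'\<close>, and only the contribution of the initial value has to be compared.\<close>

lemma duhamel_antimono_path:
  assumes A: "continuous_on {0..T} A" "continuous_on {0..T} A'" and f: "continuous_on {0..T} f"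
    and t: "t \<in> {0..T}" and f0: "\<And>s. s \<in> {0..t} \<Longrightarrow> 0 \<le> f s" and \<nu>: "0 \<le> \<nu>"
    and max: "\<And>s. s \<in> {0..t} \<Longrightarrow> A s - A' s \<le> A t - A' t"
  shows "p * (exp (- \<nu> * A' t) - exp (- \<nu> * A t)) \<le> duhamel \<nu> A' p f t - duhamel \<nu> A p f t"
proof -
  have "integral {0..t} (\<lambda>s. f s * exp (- \<nu> * (A t - A s)))
      \<le> integral {0..t} (\<lambda>s. f s * exp (- \<nu> * (A' t - A' s)))"
  proof (rule integral_le[OF duhamel_integrable[OF A(1) f t] duhamel_integrable[OF A(2) f t]])
    fix s assume s: "s \<in> {0..t}"
    have "\<nu> * (A' t - A' s) \<le> \<nu> * (A t - A s)" using max[OF s] \<nu> by (intro mult_left_mono) auto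
    then show "f s * exp (- \<nu> * (A t - A s)) \<le> f s * exp (- \<nu> * (A' t - A' s))"
      using f0[OF s] by (intro mult_left_mono) auto
  qed
  then show ?thesis unfolding duhamel_def by (simp add: algebra_simps)
qed

section \<open>Uniqueness of Fourier coefficients\<close>

text \<open>Frequencies range over all integers, so that multiplication by \<open>cos\<close> or \<open>sin\<close> of the basic
  frequency, which shifts the frequency by one, stays inside the class.\<close>

definition trig_orthogonal :: "(real \<Rightarrow> real) \<Rightarrow> bool" where
  "trig_orthogonal h \<longleftrightarrow> continuous_on {0..1} h \<and>
     (\<forall>n::int. ((\<lambda>x. h x * cos (2 * pi * of_int n * x)) has_integral 0) {0..1} \<and>
               ((\<lambda>x. h x * sin (2 * pi * of_int n * x)) has_integral 0) {0..1})"

lemma trig_orthogonalD: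
  assumes "trig_orthogonal h"
  shows "((\<lambda>x. h x * cos (2 * pi * of_int n * x)) has_integral 0) {0..1}"
    "((\<lambda>x. h x * sin (2 * pi * of_int n * x)) has_integral 0) {0..1}"
  using assms unfolding trig_orthogonal_def by blast+

lemma trig_orthogonal_add:
  assumes "trig_orthogonal g" "trig_orthogonal h"
  shows "trig_orthogonal (\<lambda>x. g x + h x)"
  unfolding trig_orthogonal_def
proof (intro conjI allI)
  show "continuous_on {0..1} (\<lambda>x. g x + h x)"
    using assms unfolding trig_orthogonal_def by (auto intro: continuous_intros)
  fix n :: int
  show "((\<lambda>x. (g x + h x) * cos (2 * pi * of_int n * x)) has_integral 0) {0..1}"
    using has_integral_add[OF trig_orthogonalD(1)[OF assms(1)] trig_orthogonalD(1)[OF assms(2)]]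
    by (simp add: distrib_right)
  show "((\<lambda>x. (g x + h x) * sin (2 * pi * of_int n * x)) has_integral 0) {0..1}"
    using has_integral_add[OF trig_orthogonalD(2)[OF assms(1)] trig_orthogonalD(2)[OF assms(2)]]
    by (simp add: distrib_right)
qed

lemma trig_orthogonal_scale:
  assumes "trig_orthogonal h"
  shows "trig_orthogonal (\<lambda>x. h x * c)"
  unfolding trig_orthogonal_def
proof (intro conjI allI)
  show "continuous_on {0..1} (\<lambda>x. h x * c)"
    using assms unfolding trig_orthogonal_def by (auto intro: continuous_intros)
  fix n :: int
  show "((\<lambda>x. h x * c * cos (2 * pi * of_int n * x)) has_integral 0) {0..1}"
    using has_integral_mult_right[OF trig_orthogonalD(1)[OF assms], of c n]
    by (simp add: mult_ac)
  show "((\<lambda>x. h x * c * sin (2 * pi * of_int n * x)) has_integral 0) {0..1}"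
    using has_integral_mult_right[OF trig_orthogonalD(2)[OF assms], of c n]
    by (simp add: mult_ac)
qed

lemma has_integral_half_combination:
  fixes f g :: "real \<Rightarrow> real"
  assumes "(f has_integral 0) S" "(g has_integral 0) S" "\<And>x. h x = (f x + c * g x) / 2"
  shows "(h has_integral 0) S"
proof -
  have "((\<lambda>x. (f x + c * g x) * (1/2)) has_integral (0 + c * 0) * (1/2)) S"
    by (intro has_integral_mult_left has_integral_add assms(1) has_integral_mult_right assms(2))
  moreover have "h = (\<lambda>x. (f x + c * g x) * (1/2))" using assms(3) by (simp add: fun_eq_iff)
  ultimately show ?thesis by simp
qed

text \<open>The product formulas express the products by the neighbouring frequencies \<open>n + 1\<close> and \<open>n - 1\<close>.\<close>

lemma trig_orthogonal_cos_sin: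
  assumes h: "trig_orthogonal h"
  shows "trig_orthogonal (\<lambda>x. h x * cos (2 * pi * x))" "trig_orthogonal (\<lambda>x. h x * sin (2 * pi * x))"
proof -
  note D = trig_orthogonalD[OF h]
  have ang: "2 * pi * of_int (n + 1) * x = 2 * pi * of_int n * x + 2 * pi * x"
    "2 * pi * of_int (n - 1) * x = 2 * pi * of_int n * x - 2 * pi * x" for n :: int and x :: real
    by (simp_all add: algebra_simps)
  have c: "continuous_on {0..1} h" using h unfolding trig_orthogonal_def by blast
  show "trig_orthogonal (\<lambda>x. h x * cos (2 * pi * x))"
    unfolding trig_orthogonal_def
  proof (intro conjI allI)
    show "continuous_on {0..1} (\<lambda>x. h x * cos (2 * pi * x))" by (intro continuous_intros c)
    fix n :: int
    show "((\<lambda>x. h x * cos (2 * pi * x) * cos (2 * pi * of_int n * x)) has_integral 0) {0..1}"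
      by (rule has_integral_half_combination[OF D(1)[of "n + 1"] D(1)[of "n - 1"], where c = 1])
         (simp only: ang cos_add cos_diff, simp add: algebra_simps)
    show "((\<lambda>x. h x * cos (2 * pi * x) * sin (2 * pi * of_int n * x)) has_integral 0) {0..1}"
      by (rule has_integral_half_combination[OF D(2)[of "n + 1"] D(2)[of "n - 1"], where c = 1])
         (simp only: ang sin_add sin_diff, simp add: algebra_simps)
  qed
  show "trig_orthogonal (\<lambda>x. h x * sin (2 * pi * x))"
    unfolding trig_orthogonal_def
  proof (intro conjI allI)
    show "continuous_on {0..1} (\<lambda>x. h x * sin (2 * pi * x))" by (intro continuous_intros c)
    fix n :: int
    show "((\<lambda>x. h x * sin (2 * pi * x) * cos (2 * pi * of_int n * x)) has_integral 0) {0..1}"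
      by (rule has_integral_half_combination[OF D(2)[of "n + 1"] D(2)[of "n - 1"], where c = "-1"])
         (simp only: ang sin_add sin_diff, simp add: algebra_simps)
    show "((\<lambda>x. h x * sin (2 * pi * x) * sin (2 * pi * of_int n * x)) has_integral 0) {0..1}"
      by (rule has_integral_half_combination[OF D(1)[of "n - 1"] D(1)[of "n + 1"], where c = "-1"])
         (simp only: ang cos_add cos_diff, simp add: algebra_simps)
  qed
qed

text \<open>The multipliers that preserve the class form an algebra; it contains the constants and the two
  coordinates of the point \<open>cis (2 \<pi> x)\<close>, hence all polynomials in them.\<close>

lemma trig_orthogonal_polynomial:
  assumes "real_polynomial_function (p :: complex \<Rightarrow> real)" "trig_orthogonal h"
  shows "trig_orthogonal (\<lambda>x. h x * p (cis (2 * pi * x)))"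
  using assms
proof (induction p arbitrary: h rule: real_polynomial_function.induct)
  case (linear f)
  interpret bounded_linear f by fact
  have f: "f z = Re z * f 1 + Im z * f \<i>" for z
  proof -
    have "z = Re z *\<^sub>R 1 + Im z *\<^sub>R \<i>" by (simp add: complex_eq_iff)
    then have "f z = f (Re z *\<^sub>R 1 + Im z *\<^sub>R \<i>)" by (rule arg_cong)
    also have "\<dots> = Re z * f 1 + Im z * f \<i>" by (simp only: add scaleR real_scaleR_def)
    finally show ?thesis .
  qed
  have "h x * f (cis (2 * pi * x))
      = h x * cos (2 * pi * x) * f 1 + h x * sin (2 * pi * x) * f \<i>" for x
    by (subst f) (simp add: distrib_left)
  then show ?case
    using trig_orthogonal_add[OF trig_orthogonal_scale[OF trig_orthogonal_cos_sin(1)[OF linear.prems]]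
        trig_orthogonal_scale[OF trig_orthogonal_cos_sin(2)[OF linear.prems]]]
    by simp
next
  case (const c)
  then show ?case by (rule trig_orthogonal_scale)
next
  case (add f g)
  then show ?case using trig_orthogonal_add[OF add.IH(1)[OF add.prems] add.IH(2)[OF add.prems]]
    by (simp add: distrib_left)
next
  case (mult f g)
  then show ?case using mult.IH(2)[OF mult.IH(1)[OF mult.prems]] by (simp add: mult_ac)
qed

text \<open>The parametrisation of the circle is a continuous surjection from a compact set, so the graph of
  the induced function is the continuous image of \<open>[0, 1]\<close> and therefore closed.\<close>

lemma continuous_periodic_on_circle:
  fixes g :: "real \<Rightarrow> real"
  assumes g: "continuous_on {0..1} g" and per: "g 0 = g 1"
  obtains G :: "complex \<Rightarrow> real" where "continuous_on (sphere 0 1) G"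
    "\<And>x. x \<in> {0..1} \<Longrightarrow> G (cis (2 * pi * x)) = g x"
proof
  define G where "G = (\<lambda>z. g (Arg2pi z / (2 * pi)))"
  show G: "G (cis (2 * pi * x)) = g x" if x: "x \<in> {0..1}" for x
  proof (cases "x = 1")
    case True
    moreover have "Arg2pi 1 = 0" by (rule Arg2pi_unique[of 1]) auto
    ultimately show ?thesis using per by (simp add: G_def)
  next
    case False
    then have "Arg2pi (cis (2 * pi * x)) = 2 * pi * x"
      using x by (intro Arg2pi_unique[of 1]) (auto simp: cis_conv_exp mult.commute)
    then show ?thesis by (simp add: G_def)
  qed
  have sph: "sphere 0 1 = (\<lambda>x. cis (2 * pi * x)) ` {0..1}"
  proof (intro equalityI subsetI)
    fix z :: complex assume z: "z \<in> sphere 0 1"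
    have "z = cis (2 * pi * (Arg2pi z / (2 * pi)))"
      using z complex_norm_eq_1_exp[of z] by (simp add: cis_conv_exp mult.commute)
    moreover have "Arg2pi z / (2 * pi) \<in> {0..1}"
      using Arg2pi_ge_0[of z] Arg2pi_lt_2pi[of z] by auto
    ultimately show "z \<in> (\<lambda>x. cis (2 * pi * x)) ` {0..1}" by blast
  qed auto
  show "continuous_on (sphere 0 1) G"
  proof (rule continuous_from_closed_graph)
    show "compact (g ` {0..1})" by (rule compact_continuous_image[OF g]) simp
    show "G \<in> sphere 0 1 \<rightarrow> g ` {0..1}"
      unfolding sph using G by auto
    have "(\<lambda>z. (z, G z)) ` sphere 0 1 = (\<lambda>x. (cis (2 * pi * x), g x)) ` {0..1}"
      unfolding sph image_image using G by (intro image_cong) auto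
    moreover have "compact ((\<lambda>x. (cis (2 * pi * x), g x)) ` {0..1})"
      by (intro compact_continuous_image continuous_intros g) auto
    ultimately show "closed ((\<lambda>z. (z, G z)) ` sphere 0 1)"
      by (simp add: compact_imp_closed)
  qed
qed

text \<open>By the Stone-Weierstrass theorem on the circle \<open>g\<close> is uniformly close to a polynomial in
  \<open>cis (2 \<pi> x)\<close>, and \<open>g\<close> is orthogonal to every such polynomial; hence the integral of \<open>g\<^sup>2\<close> vanishes.\<close>

lemma trig_orthogonal_imp_zero:
  assumes orth: "trig_orthogonal g" and per: "g 0 = g 1" and x: "x \<in> {0..1}"
  shows "g x = 0"
proof -
  have g: "continuous_on {0..1} g" using orth unfolding trig_orthogonal_def by blast
  obtain G :: "complex \<Rightarrow> real" where G: "continuous_on (sphere 0 1) G"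
    "\<And>x. x \<in> {0..1} \<Longrightarrow> G (cis (2 * pi * x)) = g x"
    using continuous_periodic_on_circle[OF g per] by blast
  have ig: "(\<lambda>x. \<bar>g x\<bar>) integrable_on {0..1}" "(\<lambda>x. (g x)\<^sup>2) integrable_on {0..1}"
    by (intro integrable_continuous_interval continuous_intros g)+
  have small: "integral {0..1} (\<lambda>x. (g x)\<^sup>2) \<le> e * integral {0..1} (\<lambda>x. \<bar>g x\<bar>)" if e: "e > 0" for e
  proof -
    obtain p where p: "real_polynomial_function p" "\<And>z. z \<in> sphere 0 1 \<Longrightarrow> \<bar>G z - p z\<bar> < e"
      using Stone_Weierstrass_real_polynomial_function[OF compact_sphere G(1) e] by blast
    have o: "trig_orthogonal (\<lambda>x. g x * p (cis (2 * pi * x)))"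
      by (rule trig_orthogonal_polynomial[OF p(1) orth])
    from trig_orthogonalD(1)[OF o, of 0]
    have "((\<lambda>x. g x * p (cis (2 * pi * x))) has_integral 0) {0..1}" by simp
    then have "((\<lambda>x. (g x)\<^sup>2 - g x * p (cis (2 * pi * x))) has_integral
        integral {0..1} (\<lambda>x. (g x)\<^sup>2) - 0) {0..1}"
      by (intro has_integral_diff integrable_integral ig)
    moreover have "((\<lambda>x. e * \<bar>g x\<bar>) has_integral e * integral {0..1} (\<lambda>x. \<bar>g x\<bar>)) {0..1}"
      by (intro has_integral_mult_right integrable_integral ig)
    ultimately have "integral {0..1} (\<lambda>x. (g x)\<^sup>2) - 0 \<le> e * integral {0..1} (\<lambda>x. \<bar>g x\<bar>)"
    proof (rule has_integral_le)
      fix x :: real assume x: "x \<in> {0..1}"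
      have "\<bar>g x - p (cis (2 * pi * x))\<bar> \<le> e"
        using p(2)[of "cis (2 * pi * x)"] G(2)[OF x] by simp
      then have "g x * (g x - p (cis (2 * pi * x))) \<le> \<bar>g x\<bar> * e"
        by (metis abs_ge_self abs_ge_zero abs_mult mult_left_mono order_trans)
      then show "(g x)\<^sup>2 - g x * p (cis (2 * pi * x)) \<le> e * \<bar>g x\<bar>"
        by (simp add: power2_eq_square algebra_simps)
    qed
    then show ?thesis by simp
  qed
  have "integral {0..1} (\<lambda>x. (g x)\<^sup>2) \<le> 0"
  proof (rule field_le_epsilon)
    fix e :: real assume e: "0 < e"
    define I where "I = integral {0..1} (\<lambda>x. \<bar>g x\<bar>)"
    have I: "0 \<le> I" unfolding I_def by (intro integral_nonneg ig) auto
    have "e / (I + 1) * I \<le> e" using e I by (simp add: field_simps)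
    moreover have "integral {0..1} (\<lambda>x. (g x)\<^sup>2) \<le> e / (I + 1) * I"
      unfolding I_def[symmetric] using small[of "e / (I + 1)"] e I unfolding I_def by simp
    ultimately show "integral {0..1} (\<lambda>x. (g x)\<^sup>2) \<le> 0 + e" by linarith
  qed
  moreover have "0 \<le> integral {0..1} (\<lambda>x. (g x)\<^sup>2)" by (intro integral_nonneg ig) auto
  ultimately have "integral {0..1} (\<lambda>x. (g x)\<^sup>2) = 0" by linarith
  moreover have "continuous_on {0..1} (\<lambda>x. (g x)\<^sup>2)" by (intro continuous_intros g)
  ultimately have "(g x)\<^sup>2 = 0" using integral_eq_0_iff[of 0 1 "\<lambda>x. (g x)\<^sup>2"] x by simp
  then show ?thesis by simp
qed

section \<open>Fourier series with summable coefficients\<close>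

text \<open>Shifted by one, so that index \<open>n\<close> belongs to the frequency number \<open>n + 1\<close>.\<close>

definition freq :: "nat \<Rightarrow> real" where
  "freq n = 2 * pi * real (Suc n)"

lemma freq_ge_1: "1 \<le> freq n"
proof -
  have "1 * 1 \<le> (2 * pi) * real (Suc n)"
    by (intro mult_mono) (use pi_gt3 in auto)
  then show ?thesis by (simp add: freq_def)
qed

lemma freq_pos: "0 < freq n"
  using freq_ge_1[of n] by linarith

lemma cos_freq: "cos (freq n) = 1" and sin_freq: "sin (freq n) = 0"
proof -
  have "freq n = real (2 * Suc n) * pi" by (simp add: freq_def algebra_simps)
  then show "cos (freq n) = 1" "sin (freq n) = 0"
    by (simp_all only: cos_npi sin_npi, simp_all)
qed

lemma summable_inverse_freq_power:
  assumes "2 \<le> k"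
  shows "summable (\<lambda>n. c / freq n ^ k)"
proof -
  have "summable (\<lambda>n. inverse (real (Suc n) ^ 2))"
    using inverse_power_summable[of 2] by (subst summable_Suc_iff) auto
  then have s: "summable (\<lambda>n. \<bar>c\<bar> * inverse (real (Suc n) ^ 2))" by (rule summable_mult)
  show ?thesis
  proof (rule summable_comparison_test[OF _ s], intro exI allI impI)
    fix n :: nat
    have 1: "real (Suc n) \<le> freq n"
      using pi_gt3 unfolding freq_def by (simp add: mult_le_cancel_right1)
    have "real (Suc n) ^ 2 \<le> freq n ^ 2" using 1 by (intro power_mono) auto
    also have "\<dots> \<le> freq n ^ k" using assms freq_ge_1 by (rule power_increasing)
    finally have "inverse (freq n ^ k) \<le> inverse (real (Suc n) ^ 2)"
      by (intro le_imp_inverse_le) auto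
    then have "\<bar>c\<bar> * inverse (freq n ^ k) \<le> \<bar>c\<bar> * inverse (real (Suc n) ^ 2)"
      by (rule mult_left_mono) simp
    then show "norm (c / freq n ^ k) \<le> \<bar>c\<bar> * inverse (real (Suc n) ^ 2)"
      using freq_pos[of n] by (simp add: divide_inverse abs_mult)
  qed
qed

lemma dominated_series_on_unit_interval:
  fixes h :: "nat \<Rightarrow> real \<Rightarrow> real"
  assumes M: "summable M" and h: "\<And>n x. x \<in> {0..1} \<Longrightarrow> \<bar>h n x\<bar> \<le> M n"
    and c: "\<And>n. continuous_on {0..1} (h n)"
  shows "x \<in> {0..1} \<Longrightarrow> (\<lambda>n. h n x) sums (\<Sum>n. h n x)"
    and "continuous_on {0..1} (\<lambda>x. \<Sum>n. h n x)"
    and "(\<lambda>n. integral {0..1} (h n)) sums integral {0..1} (\<lambda>x. \<Sum>n. h n x)"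
proof -
  have u: "uniform_limit {0..1} (\<lambda>n x. \<Sum>i<n. h i x) (\<lambda>x. \<Sum>n. h n x) sequentially"
    by (rule Weierstrass_m_test[OF _ M]) (use h in auto)
  show "(\<lambda>n. h n x) sums (\<Sum>n. h n x)" if "x \<in> {0..1}"
    using tendsto_uniform_limitI[OF u that] unfolding sums_def .
  show "continuous_on {0..1} (\<lambda>x. \<Sum>n. h n x)"
    by (rule uniform_limit_theorem[OF _ u]) (auto intro!: always_eventually continuous_intros c)
  obtain I J where I: "\<And>n. ((\<lambda>x. \<Sum>i<n. h i x) has_integral I n) {0..1}"
    and J: "((\<lambda>x. \<Sum>n. h n x) has_integral J) {0..1}" and lim: "I \<longlonglongrightarrow> J"
    by (rule uniform_limit_integral[OF u]) (auto intro!: continuous_intros c)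
  have "I = (\<lambda>n. \<Sum>i<n. integral {0..1} (h i))"
  proof
    fix n
    show "I n = (\<Sum>i<n. integral {0..1} (h i))"
      by (rule has_integral_unique[OF I])
         (intro has_integral_sum integrable_integral integrable_continuous_interval c; simp)
  qed
  then show "(\<lambda>n. integral {0..1} (h n)) sums integral {0..1} (\<lambda>x. \<Sum>n. h n x)"
    using lim J by (simp add: sums_def integral_unique)
qed

lemma integral_trig_int:
  fixes j :: int
  shows "((\<lambda>x. cos (2 * pi * of_int j * x)) has_integral (if j = 0 then 1 else 0)) {0..1}"
    and "((\<lambda>x. sin (2 * pi * of_int j * x)) has_integral 0) {0..1}"
proof -
  let ?w = "2 * pi * of_int j :: real"
  have per: "sin ?w = 0" "cos ?w = 1"
    using sin_int_2pin[of j] cos_int_2pin[of j] by (simp_all add: mult_ac)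
  show "((\<lambda>x. cos (?w * x)) has_integral (if j = 0 then 1 else 0)) {0..1}"
  proof (cases "j = 0")
    case True
    then show ?thesis using has_integral_const_real[of "1::real" 0 1] by simp
  next
    case False
    have "((\<lambda>x. cos (?w * x)) has_integral (sin (?w * 1) / ?w - sin (?w * 0) / ?w)) {0..1}"
      by (rule fundamental_theorem_of_calculus)
         (use False in \<open>auto intro!: derivative_eq_intros simp flip: has_real_derivative_iff_has_vector_derivative\<close>)
    then show ?thesis using per False by simp
  qed
  show "((\<lambda>x. sin (?w * x)) has_integral 0) {0..1}"
  proof (cases "j = 0")
    case False
    have "((\<lambda>x. sin (?w * x)) has_integral (- cos (?w * 1) / ?w - - cos (?w * 0) / ?w)) {0..1}"
      by (rule fundamental_theorem_of_calculus)
         (use False in \<open>auto intro!: derivative_eq_intros simp flip: has_real_derivative_iff_has_vector_derivative\<close>)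
    then show ?thesis using per by simp
  qed simp
qed

lemma freq_of_int: "freq n = 2 * pi * of_int (int (Suc n))"
  by (simp add: freq_def)

lemma trig_orthonormality:
  "((\<lambda>x. cos (freq n * x)) has_integral 0) {0..1}"
  "((\<lambda>x. sin (freq n * x)) has_integral 0) {0..1}"
  "((\<lambda>x. cos (freq n * x) * cos (freq m * x)) has_integral (if n = m then 1/2 else 0)) {0..1}"
  "((\<lambda>x. sin (freq n * x) * sin (freq m * x)) has_integral (if n = m then 1/2 else 0)) {0..1}"
  "((\<lambda>x. sin (freq n * x) * cos (freq m * x)) has_integral 0) {0..1}"
proof -
  have ang: "2 * pi * of_int (int (Suc n) - int (Suc m)) * x = freq n * x - freq m * x"
    "2 * pi * of_int (int (Suc n) + int (Suc m)) * x = freq n * x + freq m * x" for x :: real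
    by (simp_all add: freq_def algebra_simps)
  have minus: "((\<lambda>x. cos (freq n * x - freq m * x)) has_integral (if n = m then 1 else 0)) {0..1}"
    "((\<lambda>x. sin (freq n * x - freq m * x)) has_integral 0) {0..1}"
    using integral_trig_int[of "int (Suc n) - int (Suc m)"] unfolding ang by auto
  have plus: "((\<lambda>x. cos (freq n * x + freq m * x)) has_integral 0) {0..1}"
    "((\<lambda>x. sin (freq n * x + freq m * x)) has_integral 0) {0..1}"
    using integral_trig_int[of "int (Suc n) + int (Suc m)"] unfolding ang by auto
  show "((\<lambda>x. cos (freq n * x)) has_integral 0) {0..1}" "((\<lambda>x. sin (freq n * x)) has_integral 0) {0..1}"
    using integral_trig_int[of "int (Suc n)"] unfolding freq_of_int by auto
  have prod: "cos (freq n * x) * cos (freq m * x)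
      = 1/2 * (cos (freq n * x - freq m * x) + cos (freq n * x + freq m * x))"
    "sin (freq n * x) * sin (freq m * x)
      = 1/2 * (cos (freq n * x - freq m * x) - cos (freq n * x + freq m * x))" for x
    by (simp_all add: cos_add cos_diff)
  show "((\<lambda>x. cos (freq n * x) * cos (freq m * x)) has_integral (if n = m then 1/2 else 0)) {0..1}"
    unfolding prod
    by (rule has_integral_eq_rhs[OF has_integral_mult_right[OF has_integral_add[OF minus(1) plus(1)]]]) simp
  show "((\<lambda>x. sin (freq n * x) * sin (freq m * x)) has_integral (if n = m then 1/2 else 0)) {0..1}"
    unfolding prod
    by (rule has_integral_eq_rhs[OF has_integral_mult_right[OF has_integral_diff[OF minus(1) plus(1)]]]) simp
  show "((\<lambda>x. sin (freq n * x) * cos (freq m * x)) has_integral 0) {0..1}"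
    using has_integral_mult_right[OF has_integral_add[OF minus(2) plus(2)], of "1/2"]
    by (simp add: sin_add sin_diff mult.commute)
qed

lemma trig_orthogonalI:
  assumes c: "continuous_on {0..1} h" and 0: "(h has_integral 0) {0..1}"
    and C: "\<And>n. ((\<lambda>x. h x * cos (freq n * x)) has_integral 0) {0..1}"
    and S: "\<And>n. ((\<lambda>x. h x * sin (freq n * x)) has_integral 0) {0..1}"
  shows "trig_orthogonal h"
  unfolding trig_orthogonal_def
proof (intro conjI allI c)
  fix n :: int
  consider "n = 0" | j where "n = int (Suc j)" | j where "n = - int (Suc j)"
    by (metis int_cases linorder_neqE_linordered_idom nat0_intermed_int_val neg_int_cases not_gr0 of_nat_0 zero_less_imp_eq_int Suc_pred)
  then have "((\<lambda>x. h x * cos (2 * pi * of_int n * x)) has_integral 0) {0..1} \<and>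
      ((\<lambda>x. h x * sin (2 * pi * of_int n * x)) has_integral 0) {0..1}"
  proof cases
    case 1
    then show ?thesis using 0 by simp
  next
    case (2 j)
    then show ?thesis using C[of j] S[of j] by (simp add: freq_def)
  next
    case (3 j)
    have "2 * pi * of_int n * x = - (freq j * x)" for x :: real
      unfolding 3 freq_def by (simp add: algebra_simps)
    then show ?thesis using C[of j] has_integral_neg[OF S[of j]] by simp
  qed
  then show "((\<lambda>x. h x * cos (2 * pi * of_int n * x)) has_integral 0) {0..1}"
    "((\<lambda>x. h x * sin (2 * pi * of_int n * x)) has_integral 0) {0..1}" by auto
qed

text \<open>The series converges uniformly to a continuous periodic function with the same coefficients, and
  a continuous periodic function is determined by its coefficients.\<close>

lemma fourier_series_sums:
  fixes f :: "real \<Rightarrow> real"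
  defines "\<alpha> \<equiv> \<lambda>n. integral {0..1} (\<lambda>x. f x * cos (freq n * x))"
    and "\<beta> \<equiv> \<lambda>n. integral {0..1} (\<lambda>x. f x * sin (freq n * x))"
  assumes f: "continuous_on {0..1} f" and per: "f 0 = f 1"
    and \<alpha>: "summable (\<lambda>n. \<bar>\<alpha> n\<bar>)" and \<beta>: "summable (\<lambda>n. \<bar>\<beta> n\<bar>)" and x: "x \<in> {0..1}"
  shows "(\<lambda>n. 2 * \<alpha> n * cos (freq n * x) + 2 * \<beta> n * sin (freq n * x)) sums (f x - integral {0..1} f)"
proof -
  define h where "h = (\<lambda>n x. 2 * \<alpha> n * cos (freq n * x) + 2 * \<beta> n * sin (freq n * x))"
  define M where "M = (\<lambda>n. 2 * \<bar>\<alpha> n\<bar> + 2 * \<bar>\<beta> n\<bar>)"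
  define S where "S = (\<lambda>x. \<Sum>n. h n x)"
  have M: "summable M" unfolding M_def by (intro summable_add summable_mult \<alpha> \<beta>)
  have hM: "\<bar>h n x\<bar> \<le> M n" for n x
  proof -
    have "\<bar>2 * \<alpha> n * cos (freq n * x)\<bar> \<le> 2 * \<bar>\<alpha> n\<bar>" "\<bar>2 * \<beta> n * sin (freq n * x)\<bar> \<le> 2 * \<bar>\<beta> n\<bar>"
      by (simp_all add: abs_mult mult_left_le)
    then show ?thesis unfolding h_def M_def by linarith
  qed
  have hc: "continuous_on {0..1} (h n)" for n unfolding h_def by (intro continuous_intros)
  note series = dominated_series_on_unit_interval[OF M hM hc, folded S_def]
  have test: "((\<lambda>x. S x * w x) has_integral q) {0..1}"
    if w: "continuous_on {0..1} w" "\<And>x. \<bar>w x\<bar> \<le> 1"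
      and q: "\<And>n. ((\<lambda>x. h n x * w x) has_integral (if n = m then q else 0)) {0..1}" for w q m
  proof -
    have b: "\<bar>h n x * w x\<bar> \<le> M n" for n x
      using mult_mono[OF hM[of n x] w(2)[of x]] hM[of n x] by (simp add: abs_mult)
    have c: "continuous_on {0..1} (\<lambda>x. h n x * w x)" for n by (intro continuous_intros hc w)
    have eq: "(\<Sum>n. h n x * w x) = S x * w x" if "x \<in> {0..1}" for x
      using sums_mult2[OF series(1)[OF that], of "w x"] unfolding S_def by (rule sums_unique[symmetric])
    have "(\<lambda>n. if n = m then q else 0) sums integral {0..1} (\<lambda>x. \<Sum>n. h n x * w x)"
      using dominated_series_on_unit_interval(3)[OF M b c] integral_unique[OF q] by simp
    then have "integral {0..1} (\<lambda>x. \<Sum>n. h n x * w x) = q"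
      using sums_unique2 sums_single[of m "\<lambda>_. q"] by fastforce
    moreover have "integral {0..1} (\<lambda>x. \<Sum>n. h n x * w x) = integral {0..1} (\<lambda>x. S x * w x)"
      by (rule integral_cong) (rule eq)
    moreover have "(\<lambda>x. S x * w x) integrable_on {0..1}"
      by (intro integrable_continuous_interval continuous_intros series(2) w)
    ultimately show ?thesis by (simp add: has_integral_iff)
  qed
  let ?r = "\<lambda>x. f x - integral {0..1} f - S x"
  have int: "((\<lambda>x. f x * w x) has_integral integral {0..1} (\<lambda>x. f x * w x)) {0..1}"
    if "continuous_on {0..1} w" for w
    by (intro integrable_integral integrable_continuous_interval continuous_intros f that)
  note [continuous_intros] = f series(2)
  have "trig_orthogonal ?r"
  proof (rule trig_orthogonalI)
    show "continuous_on {0..1} ?r" by (intro continuous_intros)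
    have "((\<lambda>x. h n x * 1) has_integral (if n = 0 then 0 else 0)) {0..1}" for n
      using has_integral_add[OF has_integral_mult_right[OF trig_orthonormality(1)[of n], of "2 * \<alpha> n"]
          has_integral_mult_right[OF trig_orthonormality(2)[of n], of "2 * \<beta> n"]]
      by (simp add: h_def)
    then have "((\<lambda>x. S x * 1) has_integral 0) {0..1}"
      by (rule test[rotated 2]) auto
    from has_integral_diff[OF has_integral_diff[OF int[of "\<lambda>_. 1"] has_integral_const_real[of "integral {0..1} f"]] this]
    show "(?r has_integral 0) {0..1}" by simp
    fix m
    have "((\<lambda>x. h n x * cos (freq m * x)) has_integral (if n = m then \<alpha> m else 0)) {0..1}" for n
      using has_integral_add[OF has_integral_mult_right[OF trig_orthonormality(3)[of n m], of "2 * \<alpha> n"]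
          has_integral_mult_right[OF trig_orthonormality(5)[of n m], of "2 * \<beta> n"]]
      by (cases "n = m") (simp_all add: h_def algebra_simps)
    then have "((\<lambda>x. S x * cos (freq m * x)) has_integral \<alpha> m) {0..1}"
      by (rule test[rotated 2]) (auto intro!: continuous_intros)
    from has_integral_diff[OF has_integral_diff[OF int[of "\<lambda>x. cos (freq m * x)"]
          has_integral_mult_right[OF trig_orthonormality(1)[of m], of "integral {0..1} f"]] this]
    show "((\<lambda>x. ?r x * cos (freq m * x)) has_integral 0) {0..1}"
      by (simp add: \<alpha>_def algebra_simps continuous_intros)
    have "((\<lambda>x. h n x * sin (freq m * x)) has_integral (if n = m then \<beta> m else 0)) {0..1}" for n
      using has_integral_add[OF has_integral_mult_right[OF trig_orthonormality(5)[of m n], of "2 * \<alpha> n"]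
          has_integral_mult_right[OF trig_orthonormality(4)[of n m], of "2 * \<beta> n"]]
      by (cases "n = m") (simp_all add: h_def algebra_simps)
    then have "((\<lambda>x. S x * sin (freq m * x)) has_integral \<beta> m) {0..1}"
      by (rule test[rotated 2]) (auto intro!: continuous_intros)
    from has_integral_diff[OF has_integral_diff[OF int[of "\<lambda>x. sin (freq m * x)"]
          has_integral_mult_right[OF trig_orthonormality(2)[of m], of "integral {0..1} f"]] this]
    show "((\<lambda>x. ?r x * sin (freq m * x)) has_integral 0) {0..1}"
      by (simp add: \<beta>_def algebra_simps continuous_intros)
  qed
  moreover have "?r 0 = ?r 1"
    using per by (simp add: S_def h_def cos_freq sin_freq)
  ultimately have "?r x = 0" using x by (rule trig_orthogonal_imp_zero)
  then have "S x = f x - integral {0..1} f" by simp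
  moreover have "(\<lambda>n. h n x) sums S x" using series(1)[OF x] unfolding S_def .
  ultimately show ?thesis by (simp add: h_def)
qed

section \<open>Expansion in the biorthogonal system of the nonlocal problem\<close>

definition sine_coeff :: "(real \<Rightarrow> real) \<Rightarrow> nat \<Rightarrow> real" where
  "sine_coeff f n = integral {0..1} (\<lambda>x. f x * sin (freq n * x))"

definition xcos_coeff :: "(real \<Rightarrow> real) \<Rightarrow> nat \<Rightarrow> real" where
  "xcos_coeff f n = integral {0..1} (\<lambda>x. f x * (x * cos (freq n * x)))"

definition x_moment :: "(real \<Rightarrow> real) \<Rightarrow> real" where
  "x_moment f = integral {0..1} (\<lambda>x. f x * x)"

lemma reflect_freq: "cos (freq n * (1 - x)) = cos (freq n * x)" "sin (freq n * (1 - x)) = - sin (freq n * x)"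
  by (simp_all add: right_diff_distrib cos_diff sin_diff cos_freq sin_freq)

lemma continuous_on_reflect_unit:
  fixes f :: "real \<Rightarrow> real"
  assumes "continuous_on {0..1} f"
  shows "continuous_on {0..1} (\<lambda>x. f (1 - x))"
  by (rule continuous_on_compose2[OF assms]) (auto intro: continuous_intros)

lemma has_integral_reflect_unit:
  fixes f :: "real \<Rightarrow> real"
  assumes "(f has_integral I) {0..1}"
  shows "((\<lambda>x. f (1 - x)) has_integral I) {0..1}"
proof -
  have "(\<lambda>x::real. 1 - x) ` {0..1} = {0..1}"
    by (auto simp: image_iff intro: bexI[of _ "1 - _"])
  then show ?thesis
    using has_integral_affinity01[of f I "-1" 1] assms by simp
qed

text \<open>Transfers the coefficients of the even (\<open>c = 1\<close>) or odd (\<open>c = -1\<close>) symmetrisation of \<open>k\<close> about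
  \<open>1/2\<close> to the test function.\<close>

lemma integral_symmetrised:
  fixes k w :: "real \<Rightarrow> real"
  assumes k: "continuous_on {0..1} k" and w: "continuous_on {0..1} w"
  shows "integral {0..1} (\<lambda>x. (k x + c * k (1 - x)) * w x) = integral {0..1} (\<lambda>x. k x * (w x + c * w (1 - x)))"
proof -
  note [continuous_intros] = k w continuous_on_reflect_unit[OF k] continuous_on_reflect_unit[OF w]
  have "(\<lambda>x. k x * w (1 - x)) integrable_on {0..1}"
    by (intro integrable_continuous_interval continuous_intros)
  from has_integral_reflect_unit[OF integrable_integral[OF this]]
  have r: "((\<lambda>x. k (1 - x) * w x) has_integral integral {0..1} (\<lambda>x. k x * w (1 - x))) {0..1}"
    by simp
  have i: "((\<lambda>x. k x * w x) has_integral integral {0..1} (\<lambda>x. k x * w x)) {0..1}"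
    "((\<lambda>x. k x * w (1 - x)) has_integral integral {0..1} (\<lambda>x. k x * w (1 - x))) {0..1}"
    by (intro integrable_integral integrable_continuous_interval continuous_intros)+
  have "((\<lambda>x. (k x + c * k (1 - x)) * w x) has_integral integral {0..1} (\<lambda>x. k x * w x) + c * integral {0..1} (\<lambda>x. k x * w (1 - x))) {0..1}"
    using has_integral_add[OF i(1) has_integral_mult_right[OF r, of c]] by (simp add: algebra_simps)
  moreover have "((\<lambda>x. k x * (w x + c * w (1 - x))) has_integral integral {0..1} (\<lambda>x. k x * w x) + c * integral {0..1} (\<lambda>x. k x * w (1 - x))) {0..1}"
    using has_integral_add[OF i(1) has_integral_mult_right[OF i(2), of c]] by (simp add: algebra_simps)
  ultimately show ?thesis by (simp add: integral_unique)
qed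

text \<open>The difference \<open>f(x) - f(1 - x)\<close> has vanishing cosine coefficients and twice the sine
  coefficients of \<open>f\<close>; the hypothesis \<open>f 0 = f 1\<close> makes it vanish at both end points.\<close>

lemma odd_part_series:
  assumes f: "continuous_on {0..1} f" and per: "f 0 = f 1"
    and s: "summable (\<lambda>n. \<bar>sine_coeff f n\<bar>)" and x: "x \<in> {0..1}"
  shows "(\<lambda>n. 4 * sine_coeff f n * sin (freq n * x)) sums (f x - f (1 - x))"
proof -
  let ?d = "\<lambda>x. f x + (-1) * f (1 - x)"
  have c: "continuous_on {0..1} ?d" by (intro continuous_intros f continuous_on_reflect_unit)
  have cs: "integral {0..1} (\<lambda>x. ?d x * cos (freq n * x)) = 0"
    "integral {0..1} (\<lambda>x. ?d x * sin (freq n * x)) = 2 * sine_coeff f n" for n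
    using integral_symmetrised[OF f, of "\<lambda>x. cos (freq n * x)" "-1"]
      integral_symmetrised[OF f, of "\<lambda>x. sin (freq n * x)" "-1"]
    by (simp_all add: continuous_intros reflect_freq sine_coeff_def mult.left_commute[of _ 2])
  have m: "integral {0..1} ?d = 0"
    using integral_symmetrised[OF f, of "\<lambda>x. 1" "-1"] by simp
  have sm: "summable (\<lambda>n. \<bar>integral {0..1} (\<lambda>x. ?d x * sin (freq n * x))\<bar>)"
    "summable (\<lambda>n. \<bar>integral {0..1} (\<lambda>x. ?d x * cos (freq n * x))\<bar>)"
    unfolding cs using summable_mult[OF s, of 2] by (simp_all add: abs_mult)
  from fourier_series_sums[OF c _ sm(2,1) x] show ?thesis
    unfolding cs m using per by simp
qed

text \<open>Write \<open>f = g + (1 - x) d\<close> with \<open>d(x) = f(x) - f(1 - x)\<close>.  Then \<open>g(x) = x f(x) + (1 - x) f(1 - x)\<close>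
  is even about \<open>1/2\<close>, and its cosine coefficients are twice the integrals of \<open>f\<close> against
  \<open>x cos (\<mu> x)\<close>.  So the ordinary Fourier series of \<open>g\<close> and \<open>d\<close> combine to the expansion.\<close>

lemma ionkin_series:
  assumes f: "continuous_on {0..1} f" and per: "f 0 = f 1"
    and s: "summable (\<lambda>n. \<bar>sine_coeff f n\<bar>)" and c: "summable (\<lambda>n. \<bar>xcos_coeff f n\<bar>)"
    and x: "x \<in> {0..1}"
  shows "(\<lambda>n. 4 * xcos_coeff f n * cos (freq n * x) + 4 * (1 - x) * sine_coeff f n * sin (freq n * x))
    sums (f x - 2 * x_moment f)"
proof -
  let ?k = "\<lambda>x. x * f x" and ?g = "\<lambda>x. x * f x + 1 * ((1 - x) * f (1 - x))"
  have k: "continuous_on {0..1} ?k" by (intro continuous_intros f)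
  have g: "continuous_on {0..1} ?g" by (intro continuous_intros f continuous_on_reflect_unit)
  have cs: "integral {0..1} (\<lambda>x. ?g x * cos (freq n * x)) = 2 * xcos_coeff f n"
    "integral {0..1} (\<lambda>x. ?g x * sin (freq n * x)) = 0" for n
    using integral_symmetrised[OF k, of "\<lambda>x. cos (freq n * x)" 1]
      integral_symmetrised[OF k, of "\<lambda>x. sin (freq n * x)" 1]
    by (simp_all add: continuous_intros reflect_freq xcos_coeff_def mult_ac flip: integral_mult_right)
  have m: "integral {0..1} ?g = 2 * x_moment f"
    using integral_symmetrised[OF k, of "\<lambda>x. 1" 1]
    by (simp add: x_moment_def mult_ac flip: integral_mult_right)
  have sm: "summable (\<lambda>n. \<bar>integral {0..1} (\<lambda>x. ?g x * cos (freq n * x))\<bar>)"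
    "summable (\<lambda>n. \<bar>integral {0..1} (\<lambda>x. ?g x * sin (freq n * x))\<bar>)"
    unfolding cs using summable_mult[OF c, of 2] by (simp_all add: abs_mult)
  have "(\<lambda>n. 4 * xcos_coeff f n * cos (freq n * x)) sums (?g x - 2 * x_moment f)"
    using fourier_series_sums[OF g _ sm x] per unfolding cs m by simp
  from sums_add[OF this sums_mult[OF odd_part_series[OF f per s x], of "1 - x"]]
  show ?thesis by (simp add: algebra_simps)
qed

text \<open>The sine series of \<open>f(x) - f(1 - x)\<close> is integrated termwise against \<open>1 - x\<close>, whose integral against
  \<open>sin (\<mu> x)\<close> is \<open>1/\<mu>\<close>.\<close>

lemma mean_minus_moment_series:
  assumes f: "continuous_on {0..1} f" and per: "f 0 = f 1"
    and s: "summable (\<lambda>n. \<bar>sine_coeff f n\<bar>)"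
  shows "(\<lambda>n. 4 / freq n * sine_coeff f n) sums (integral {0..1} f - 2 * x_moment f)"
proof -
  let ?h = "\<lambda>n x. 4 * sine_coeff f n * ((1 - x) * sin (freq n * x))"
  have M: "summable (\<lambda>n. 4 * \<bar>sine_coeff f n\<bar>)" by (intro summable_mult s)
  have b: "\<bar>?h n x\<bar> \<le> 4 * \<bar>sine_coeff f n\<bar>" if "x \<in> {0..1}" for n x
  proof -
    have "\<bar>1 - x\<bar> * \<bar>sin (freq n * x)\<bar> \<le> 1 * 1" using that by (intro mult_mono) auto
    then show ?thesis by (simp add: abs_mult mult_left_le)
  qed
  have c: "continuous_on {0..1} (?h n)" for n by (intro continuous_intros)
  have w: "((\<lambda>x. (1 - x) * sin (freq n * x)) has_integral 1 / freq n) {0..1}" for n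
  proof -
    let ?F = "\<lambda>x. - (1 - x) * cos (freq n * x) / freq n - sin (freq n * x) / (freq n)\<^sup>2"
    have "((\<lambda>x. (1 - x) * sin (freq n * x)) has_integral ?F 1 - ?F 0) {0..1}"
    proof (rule fundamental_theorem_of_calculus)
      fix x :: real
      show "(?F has_vector_derivative (1 - x) * sin (freq n * x)) (at x within {0..1})"
        unfolding has_real_derivative_iff_has_vector_derivative[symmetric]
        by (rule derivative_eq_intros refl | use freq_pos[of n] in \<open>simp add: field_simps power2_eq_square\<close>)+
    qed simp
    then show ?thesis by (simp add: sin_freq)
  qed
  have i: "integral {0..1} (?h n) = 4 / freq n * sine_coeff f n" for n
    using integral_unique[OF has_integral_mult_right[OF w[of n], of "4 * sine_coeff f n"]] by simp
  have "(\<Sum>n. ?h n x) = (f x + (-1) * f (1 - x)) * (1 - x)" if "x \<in> {0..1}" for x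
    using sums_mult[OF odd_part_series[OF f per s that], of "1 - x"]
    by (intro sums_unique[symmetric]) (simp add: algebra_simps)
  then have "integral {0..1} (\<lambda>x. \<Sum>n. ?h n x) = integral {0..1} (\<lambda>x. (f x + (-1) * f (1 - x)) * (1 - x))"
    by (rule integral_cong)
  also have "\<dots> = integral {0..1} (\<lambda>x. f x * ((1 - x) + (-1) * (1 - (1 - x))))"
    by (rule integral_symmetrised[OF f]) (intro continuous_intros)
  also have "\<dots> = integral {0..1} (\<lambda>x. f x - 2 * (f x * x))"
    by (rule integral_cong) (simp add: algebra_simps)
  also have "\<dots> = integral {0..1} f - 2 * x_moment f"
    unfolding x_moment_def
    by (subst integral_diff) (auto intro!: integrable_continuous_interval continuous_intros f)
  finally show ?thesis
    using dominated_series_on_unit_interval(3)[OF M b c] unfolding i by simp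
qed

text \<open>The sine series of \<open>f(x) - f(1 - x)\<close> is differentiated termwise at \<open>0\<close>.\<close>

lemma boundary_slope_series:
  assumes f: "\<And>x. x \<in> {0..1} \<Longrightarrow> (f has_vector_derivative f' x) (at x within {0..1})"
    and per: "f 0 = f 1" and s: "summable (\<lambda>n. freq n * \<bar>sine_coeff f n\<bar>)"
  shows "(\<lambda>n. 4 * freq n * sine_coeff f n) sums (f' 0 + f' 1)"
proof -
  have fc: "continuous_on {0..1} f"
    using f has_vector_derivative_continuous continuous_on_eq_continuous_within by blast
  have s0: "summable (\<lambda>n. \<bar>sine_coeff f n\<bar>)"
    by (rule summable_comparison_test[OF _ s])
       (use freq_ge_1 in \<open>auto simp: mult_le_cancel_right1 intro!: exI[of _ 0]\<close>)
  let ?D = "\<lambda>n x. 4 * freq n * sine_coeff f n * cos (freq n * x)"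
  have M: "summable (\<lambda>n. 4 * (freq n * \<bar>sine_coeff f n\<bar>))" by (intro summable_mult s)
  have b: "norm (?D n x) \<le> 4 * (freq n * \<bar>sine_coeff f n\<bar>)" for n x
    using freq_pos[of n] by (simp add: abs_mult mult_left_le)
  have u: "uniform_limit {0..1} (\<lambda>n x. \<Sum>i<n. ?D i x) (\<lambda>x. \<Sum>n. ?D n x) sequentially"
    by (rule Weierstrass_m_test[OF b M])
  have "\<exists>g. \<forall>x\<in>{0..1}. (\<lambda>n. 4 * sine_coeff f n * sin (freq n * x)) sums g x \<and>
      (g has_field_derivative (\<Sum>n. ?D n x)) (at x within {0..1})"
    by (rule has_field_derivative_series[where ?x0.0 = 0, OF _ _ u])
       (auto intro!: derivative_eq_intros)
  then obtain g where G: "\<forall>x\<in>{0..1}. (\<lambda>n. 4 * sine_coeff f n * sin (freq n * x)) sums g x \<and>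
      (g has_field_derivative (\<Sum>n. ?D n x)) (at x within {0..1})"
    by blast
  then have g: "(\<lambda>n. 4 * sine_coeff f n * sin (freq n * x)) sums g x" if "x \<in> {0..1}" for x
    using that by blast
  have g': "(g has_field_derivative (\<Sum>n. ?D n 0)) (at 0 within {0..1})"
    using bspec[OF G, of 0] by simp
  have geq: "g x = f x - f (1 - x)" if "x \<in> {0..1}" for x
    using sums_unique2[OF g[OF that] odd_part_series[OF fc per s0 that]] .
  have img: "(\<lambda>x::real. 1 - x) ` {0..1} = {0..1}"
    by (auto simp: image_iff intro: bexI[of _ "1 - _"])
  have "((\<lambda>x. f x - f (1 - x)) has_field_derivative f' 0 - f' 1 * (-1)) (at 0 within {0..1})"
  proof (rule DERIV_diff)
    show "(f has_field_derivative f' 0) (at 0 within {0..1})"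
      using f[of 0] by (simp add: has_real_derivative_iff_has_vector_derivative)
    have "(f has_field_derivative f' 1) (at (1 - 0) within (\<lambda>x. 1 - x) ` {0..1})"
      using f[of 1] by (simp add: has_real_derivative_iff_has_vector_derivative img)
    then have "(f \<circ> (\<lambda>x. 1 - x) has_field_derivative f' 1 * (-1)) (at 0 within {0..1})"
      by (rule DERIV_image_chain) (auto intro!: derivative_eq_intros)
    then show "((\<lambda>x. f (1 - x)) has_field_derivative f' 1 * (-1)) (at 0 within {0..1})"
      by (simp add: o_def)
  qed
  then have "(g has_field_derivative f' 0 - f' 1 * (-1)) (at 0 within {0..1})"
    by (rule has_field_derivative_transform_within[where d = 1]) (auto simp: geq)
  then have "(\<Sum>n. ?D n 0) = f' 0 - f' 1 * (-1)"
    using g' unfolding has_real_derivative_iff_has_vector_derivative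
    by (intro vector_derivative_unique_within[of 0 "{0..1}" g])
       (auto simp: at_within_Icc_at_right)
  moreover have "summable (\<lambda>n. ?D n 0)"
    by (rule summable_comparison_test[OF _ M]) (use b in blast)
  ultimately show ?thesis by (simp add: sums_iff)
qed

lemma trig_integral_by_parts:
  assumes f: "\<And>x. x \<in> {0..1} \<Longrightarrow> (f has_vector_derivative f' x) (at x within {0..1})"
    and f': "continuous_on {0..1} f'"
  shows "integral {0..1} (\<lambda>x. f x * sin (freq n * x))
    = (f 0 - f 1) / freq n + integral {0..1} (\<lambda>x. f' x * cos (freq n * x)) / freq n"
    and "integral {0..1} (\<lambda>x. f x * cos (freq n * x))
    = - integral {0..1} (\<lambda>x. f' x * sin (freq n * x)) / freq n"
proof -
  have fc: "continuous_on {0..1} f"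
    using f has_vector_derivative_continuous continuous_on_eq_continuous_within by blast
  note [continuous_intros] = f' fc
  have int: "(\<lambda>x. f x * sin (freq n * x)) integrable_on {0..1}" "(\<lambda>x. f' x * cos (freq n * x)) integrable_on {0..1}"
    "(\<lambda>x. f x * cos (freq n * x)) integrable_on {0..1}" "(\<lambda>x. f' x * sin (freq n * x)) integrable_on {0..1}"
    by (intro integrable_continuous_interval continuous_intros)+
  have "((\<lambda>x. f' x * cos (freq n * x) - freq n * (f x * sin (freq n * x))) has_integral
      f 1 * cos (freq n * 1) - f 0 * cos (freq n * 0)) {0..1}"
  proof (rule fundamental_theorem_of_calculus)
    fix x :: real assume "x \<in> {0..1}"
    from f[OF this] show "((\<lambda>x. f x * cos (freq n * x)) has_vector_derivative
        f' x * cos (freq n * x) - freq n * (f x * sin (freq n * x))) (at x within {0..1})"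
      unfolding has_real_derivative_iff_has_vector_derivative[symmetric]
      by (auto intro!: derivative_eq_intros)
  qed simp
  from has_integral_unique[OF this has_integral_diff[OF integrable_integral[OF int(2)] has_integral_mult_right[OF integrable_integral[OF int(1)]]]]
  show "integral {0..1} (\<lambda>x. f x * sin (freq n * x))
    = (f 0 - f 1) / freq n + integral {0..1} (\<lambda>x. f' x * cos (freq n * x)) / freq n"
    using freq_pos[of n] unfolding add_divide_distrib[symmetric]
    by (simp add: cos_freq eq_divide_eq algebra_simps)
  have "((\<lambda>x. f' x * sin (freq n * x) + freq n * (f x * cos (freq n * x))) has_integral
      f 1 * sin (freq n * 1) - f 0 * sin (freq n * 0)) {0..1}"
  proof (rule fundamental_theorem_of_calculus)
    fix x :: real assume "x \<in> {0..1}"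
    from f[OF this] show "((\<lambda>x. f x * sin (freq n * x)) has_vector_derivative
        f' x * sin (freq n * x) + freq n * (f x * cos (freq n * x))) (at x within {0..1})"
      unfolding has_real_derivative_iff_has_vector_derivative[symmetric]
      by (auto intro!: derivative_eq_intros)
  qed simp
  from has_integral_unique[OF this has_integral_add[OF integrable_integral[OF int(4)] has_integral_mult_right[OF integrable_integral[OF int(3)]]]]
  show "integral {0..1} (\<lambda>x. f x * cos (freq n * x))
    = - integral {0..1} (\<lambda>x. f' x * sin (freq n * x)) / freq n"
    using freq_pos[of n] by (simp add: sin_freq field_simps)
qed

lemma abs_integral_trig_le:
  fixes f w :: "real \<Rightarrow> real"
  assumes f: "continuous_on {0..1} f" and K: "\<And>x. x \<in> {0..1} \<Longrightarrow> \<bar>f x\<bar> \<le> K"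
    and w: "continuous_on {0..1} w" "\<And>x. x \<in> {0..1} \<Longrightarrow> \<bar>w x\<bar> \<le> 1"
  shows "\<bar>integral {0..1} (\<lambda>x. f x * w x)\<bar> \<le> (K::real)"
proof -
  have "\<bar>integral {0..1} (\<lambda>x. f x * w x)\<bar> \<le> 1 * K"
  proof (rule integral_le_length_times_bound)
    show "(\<lambda>x. f x * w x) integrable_on {0..1}"
      by (intro integrable_continuous_interval continuous_intros f w)
    fix x :: real assume x: "x \<in> {0..1}"
    have "\<bar>f x\<bar> * \<bar>w x\<bar> \<le> K * 1" using K[OF x] w(2)[OF x] by (intro mult_mono) auto
    then show "\<bar>f x * w x\<bar> \<le> K" by (simp add: abs_mult)
  qed auto
  then show ?thesis by simp
qed

text \<open>Four integrations by parts; the periodicity of \<open>f\<close> and \<open>f''\<close> cancels the boundary terms.\<close>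

lemma sine_coeff_decay:
  assumes d: "\<And>j x. j < 4 \<Longrightarrow> x \<in> {0..1} \<Longrightarrow> (D j has_vector_derivative D (Suc j) x) (at x within {0..1})"
    and c: "\<And>j. j \<le> 4 \<Longrightarrow> continuous_on {0..1} (D j)"
    and per: "D 0 0 = D 0 1" "D 2 0 = D 2 1" and K: "\<And>x. x \<in> {0..1} \<Longrightarrow> \<bar>D 4 x\<bar> \<le> K"
  shows "\<bar>sine_coeff (D 0) n\<bar> \<le> K / freq n ^ 4"
proof -
  have D: "integral {0..1} (\<lambda>x. D j x * sin (freq n * x))
    = (D j 0 - D j 1) / freq n + integral {0..1} (\<lambda>x. D (Suc j) x * cos (freq n * x)) / freq n"
    "integral {0..1} (\<lambda>x. D j x * cos (freq n * x))
    = - integral {0..1} (\<lambda>x. D (Suc j) x * sin (freq n * x)) / freq n" if "j < 4" for j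
    using trig_integral_by_parts[of "D j" "D (Suc j)" n] d c that by auto
  have "sine_coeff (D 0) n = integral {0..1} (\<lambda>x. D 4 x * sin (freq n * x)) / freq n ^ 4"
    using D(1)[of 0] D(2)[of 1] D(1)[of 2] D(2)[of 3] per freq_pos[of n]
    by (simp add: sine_coeff_def numeral_eq_Suc field_simps)
  moreover have "\<bar>integral {0..1} (\<lambda>x. D 4 x * sin (freq n * x))\<bar> \<le> K"
    by (rule abs_integral_trig_le) (use c[of 4] K in \<open>auto intro!: continuous_intros\<close>)
  ultimately show ?thesis using freq_pos[of n] by (simp add: divide_right_mono)
qed

text \<open>Three integrations by parts, applied to \<open>x f\<close>, whose derivative of order \<open>j\<close> is \<open>j D (j - 1) + x D j\<close>.  The only
  boundary term compares the values of \<open>f + x f'\<close> at \<open>0\<close> and \<open>1\<close>, which the boundary conditions make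
  equal.\<close>

lemma xcos_coeff_decay:
  assumes d: "\<And>j x. j < 3 \<Longrightarrow> x \<in> {0..1} \<Longrightarrow> (D j has_vector_derivative D (Suc j) x) (at x within {0..1})"
    and c: "\<And>j. j \<le> 3 \<Longrightarrow> continuous_on {0..1} (D j)"
    and per: "D 0 0 = D 0 1" "D 1 1 = 0"
    and K: "\<And>x. x \<in> {0..1} \<Longrightarrow> \<bar>D 2 x\<bar> \<le> K" "\<And>x. x \<in> {0..1} \<Longrightarrow> \<bar>D 3 x\<bar> \<le> K"
  shows "\<bar>xcos_coeff (D 0) n\<bar> \<le> 4 * K / freq n ^ 3"
proof -
  \<comment> \<open>For \<open>j = 0\<close> the index \<open>j - 1\<close> is truncated to \<open>0\<close>, but the factor \<open>real j\<close> vanishes.\<close>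
  define G where "G = (\<lambda>j x. real j * D (j - 1) x + x * D j x)"
  have G: "(G j has_vector_derivative G (Suc j) x) (at x within {0..1})" if "j < 3" "x \<in> {0..1}" for j x
  proof (cases j)
    case 0
    then show ?thesis unfolding G_def using d[OF that]
      unfolding has_real_derivative_iff_has_vector_derivative[symmetric]
      by (auto intro!: derivative_eq_intros)
  next
    case (Suc i)
    then show ?thesis unfolding G_def using d[OF that] d[of i x] that
      unfolding has_real_derivative_iff_has_vector_derivative[symmetric]
      by (auto intro!: derivative_eq_intros simp: algebra_simps)
  qed
  have Gc: "continuous_on {0..1} (G j)" if "j \<le> 3" for j
    unfolding G_def using that by (intro continuous_intros c) auto
  have D: "integral {0..1} (\<lambda>x. G j x * sin (freq n * x))
    = (G j 0 - G j 1) / freq n + integral {0..1} (\<lambda>x. G (Suc j) x * cos (freq n * x)) / freq n"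
    "integral {0..1} (\<lambda>x. G j x * cos (freq n * x))
    = - integral {0..1} (\<lambda>x. G (Suc j) x * sin (freq n * x)) / freq n" if "j < 3" for j
    using trig_integral_by_parts[of "G j" "G (Suc j)" n] G Gc that by auto
  have G1: "G 1 0 = G 1 1" using per by (simp add: G_def)
  have "xcos_coeff (D 0) n = integral {0..1} (\<lambda>x. G 0 x * cos (freq n * x))"
    by (simp add: xcos_coeff_def G_def mult_ac)
  then have "xcos_coeff (D 0) n = integral {0..1} (\<lambda>x. G 3 x * sin (freq n * x)) / freq n ^ 3"
    using D(2)[of 0] D(1)[of 1] D(2)[of 2] G1 freq_pos[of n]
    by (simp add: numeral_eq_Suc field_simps)
  moreover have "\<bar>integral {0..1} (\<lambda>x. G 3 x * sin (freq n * x))\<bar> \<le> 4 * K"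
  proof (rule abs_integral_trig_le)
    fix x :: real assume x: "x \<in> {0..1}"
    have "\<bar>x\<bar> * \<bar>D 3 x\<bar> \<le> 1 * K" using x K(2)[OF x] by (intro mult_mono) auto
    then have "\<bar>x * D 3 x\<bar> \<le> K" by (simp add: abs_mult)
    then show "\<bar>G 3 x\<bar> \<le> 4 * K" using K(1)[OF x] unfolding G_def by (simp add: numeral_eq_Suc)
  qed (use Gc[of 3] in \<open>auto intro!: continuous_intros\<close>)
  ultimately show ?thesis using freq_pos[of n] by (simp add: divide_right_mono)
qed

section \<open>Smooth functions, norms and decay of coefficients\<close>

lemma nth_deriv_on_0 [simp]: "nth_deriv_on S 0 f = f"
  by (simp add: nth_deriv_on_def)

lemma nth_deriv_on_Suc: "nth_deriv_on S (Suc j) f x = vector_derivative (nth_deriv_on S j f) (at x within S)"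
  by (simp add: nth_deriv_on_def)

lemma nth_deriv_on_has_derivative:
  assumes "times_differentiable_on k S f" "j < k" "x \<in> S"
  shows "(nth_deriv_on S j f has_vector_derivative nth_deriv_on S (Suc j) f x) (at x within S)"
  using assms unfolding times_differentiable_on_def nth_deriv_on_Suc
  by (auto simp flip: vector_derivative_works)

text \<open>Derivatives relative to an interval are unique because no point of the interval is isolated.\<close>

lemma nth_deriv_on_diff:
  fixes a b :: real
  assumes ab: "a < b" and f: "times_differentiable_on k {a..b} f" and g: "times_differentiable_on k {a..b} g"
  shows "j \<le> k \<Longrightarrow> x \<in> {a..b} \<Longrightarrow>
    nth_deriv_on {a..b} j (\<lambda>x. f x - g x) x = nth_deriv_on {a..b} j f x - nth_deriv_on {a..b} j g x"
    and "times_differentiable_on k {a..b} (\<lambda>x. f x - g x)"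
proof -
  let ?S = "{a..b}"
  let ?h = "\<lambda>x. f x - g x"
  have step: "(nth_deriv_on ?S j ?h has_vector_derivative
      nth_deriv_on ?S (Suc j) f x - nth_deriv_on ?S (Suc j) g x) (at x within ?S)"
    if eq: "\<And>x. x \<in> ?S \<Longrightarrow> nth_deriv_on ?S j ?h x = nth_deriv_on ?S j f x - nth_deriv_on ?S j g x"
      and j: "j < k" and x: "x \<in> ?S" for j x
    by (rule has_vector_derivative_transform[OF x eq])
       (auto intro!: has_vector_derivative_diff nth_deriv_on_has_derivative[OF f j x]
          nth_deriv_on_has_derivative[OF g j x])
  have eq: "\<forall>x\<in>?S. nth_deriv_on ?S j ?h x = nth_deriv_on ?S j f x - nth_deriv_on ?S j g x" if "j \<le> k" for j
    using that
  proof (induction j)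
    case (Suc j)
    then have IH: "nth_deriv_on ?S j ?h x = nth_deriv_on ?S j f x - nth_deriv_on ?S j g x" if "x \<in> ?S" for x
      using that by auto
    show ?case
    proof
      fix x assume x: "x \<in> ?S"
      show "nth_deriv_on ?S (Suc j) ?h x = nth_deriv_on ?S (Suc j) f x - nth_deriv_on ?S (Suc j) g x"
        unfolding nth_deriv_on_Suc[of _ _ ?h]
        by (rule vector_derivative_within_closed_interval[OF ab x step[OF IH _ x]]) (use Suc.prems in auto)
    qed
  qed simp
  then show "j \<le> k \<Longrightarrow> x \<in> ?S \<Longrightarrow>
    nth_deriv_on ?S j ?h x = nth_deriv_on ?S j f x - nth_deriv_on ?S j g x" by blast
  show "times_differentiable_on k ?S ?h"
    unfolding times_differentiable_on_def
    using step eq by (meson differentiableI_vector less_imp_le_nat)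
qed

lemma Ck_on_diff:
  fixes a b :: real
  assumes ab: "a < b" and f: "Ck_on k {a..b} f" and g: "Ck_on k {a..b} g"
  shows "Ck_on k {a..b} (\<lambda>x. f x - g x)"
  unfolding Ck_on_def
proof (intro conjI allI impI)
  have td: "times_differentiable_on k {a..b} f" "times_differentiable_on k {a..b} g"
    using f g unfolding Ck_on_def by auto
  show "times_differentiable_on k {a..b} (\<lambda>x. f x - g x)" by (rule nth_deriv_on_diff[OF ab td])
  fix j assume j: "j \<le> k"
  have "continuous_on {a..b} (\<lambda>x. nth_deriv_on {a..b} j f x - nth_deriv_on {a..b} j g x)"
    using f g j unfolding Ck_on_def by (intro continuous_intros) auto
  then show "continuous_on {a..b} (nth_deriv_on {a..b} j (\<lambda>x. f x - g x))"
    using nth_deriv_on_diff(1)[OF ab td j] by (simp cong: continuous_on_cong_simp)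
qed

lemma Ck0_diff:
  assumes F: "Ck0 k T F" and G: "Ck0 k T G"
  shows "Ck0 k T (\<lambda>x t. F x t - G x t)"
  unfolding Ck0_def
proof (intro conjI ballI allI impI)
  have td: "times_differentiable_on k {0..1} (\<lambda>x. F x t)" "times_differentiable_on k {0..1} (\<lambda>x. G x t)"
    if "t \<in> {0..T}" for t using F G that unfolding Ck0_def by auto
  show "times_differentiable_on k {0..1} (\<lambda>x. F x t - G x t)" if "t \<in> {0..T}" for t
    by (rule nth_deriv_on_diff(2)[OF zero_less_one td[OF that]])
  fix j assume j: "j \<le> k"
  have "continuous_on (QT_closed T) (\<lambda>p. (\<lambda>(x, t). x_deriv {0..1} j F x t) p - (\<lambda>(x, t). x_deriv {0..1} j G x t) p)"
    using F G j unfolding Ck0_def by (intro continuous_intros) auto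
  moreover have "(\<lambda>(x, t). x_deriv {0..1} j F x t) p - (\<lambda>(x, t). x_deriv {0..1} j G x t) p
      = (\<lambda>(x, t). x_deriv {0..1} j (\<lambda>x t. F x t - G x t) x t) p" if "p \<in> QT_closed T" for p
    using nth_deriv_on_diff(1)[OF zero_less_one td j] that
    by (auto simp: QT_closed_def x_deriv_def split: prod.splits)
  ultimately show "continuous_on (QT_closed T) (\<lambda>(x, t). x_deriv {0..1} j (\<lambda>x t. F x t - G x t) x t)"
    by (simp cong: continuous_on_cong_simp)
qed

lemma finite_norm_diff:
  assumes "0 < T" "finite_norm T \<phi> F E" "finite_norm T \<phi>' F' E'"
  shows "finite_norm T (\<lambda>x. \<phi> x - \<phi>' x) (\<lambda>x t. F x t - F' x t) (\<lambda>t. E t - E' t)"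
  using assms unfolding finite_norm_def by (auto intro!: Ck_on_diff Ck0_diff)

lemma abs_le_sup_norm:
  assumes "compact S" "continuous_on S f" "p \<in> S"
  shows "\<bar>f p\<bar> \<le> sup_norm S f"
proof -
  have "compact ((\<lambda>p. \<bar>f p\<bar>) ` S)"
    by (intro compact_continuous_image continuous_intros assms)
  then show ?thesis
    unfolding sup_norm_def by (intro cSUP_upper assms bounded_imp_bdd_above compact_imp_bounded)
qed

lemma sup_norm_le:
  assumes "S \<noteq> {}" "\<And>p. p \<in> S \<Longrightarrow> \<bar>f p\<bar> \<le> c"
  shows "sup_norm S f \<le> c"
  unfolding sup_norm_def by (rule cSUP_least) (use assms in auto)

lemma abs_le_sum_sup_norms:
  assumes S: "compact S" "p \<in> S" and c: "\<And>j. j \<le> k \<Longrightarrow> continuous_on S (f j)" and j: "j \<le> (k::nat)"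
  shows "\<bar>f j p\<bar> \<le> (\<Sum>i\<le>k. sup_norm S (f i))"
proof -
  have "\<bar>f j p\<bar> \<le> sup_norm S (f j)" by (rule abs_le_sup_norm[OF S(1) c[OF j] S(2)])
  also have "\<dots> \<le> (\<Sum>i\<le>k. sup_norm S (f i))"
  proof (rule member_le_sum)
    fix i assume "i \<in> {..k} - {j}"
    then show "0 \<le> sup_norm S (f i)"
      using abs_le_sup_norm[OF S(1) c S(2), of i] by auto
  qed (use j in auto)
  finally show ?thesis .
qed

lemma data_norm_bounds:
  assumes T: "0 < T" and fin: "finite_norm T \<phi> F E"
  shows "j \<le> 4 \<Longrightarrow> x \<in> {0..1} \<Longrightarrow> \<bar>nth_deriv_on {0..1} j \<phi> x\<bar> \<le> data_norm T \<phi> F E"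
    and "j \<le> 4 \<Longrightarrow> x \<in> {0..1} \<Longrightarrow> t \<in> {0..T} \<Longrightarrow> \<bar>nth_deriv_on {0..1} j (\<lambda>x. F x t) x\<bar> \<le> data_norm T \<phi> F E"
    and "j \<le> 1 \<Longrightarrow> t \<in> {0..T} \<Longrightarrow> \<bar>nth_deriv_on {0..T} j E t\<bar> \<le> data_norm T \<phi> F E"
proof -
  have c: "compact (QT_closed T)" unfolding QT_closed_def by (intro compact_Times) auto
  have 1: "\<bar>nth_deriv_on {0..1} j \<phi> x\<bar> \<le> Ck_norm 4 {0..1} \<phi>" if "j \<le> 4" "x \<in> {0..1}" for j x
    unfolding Ck_norm_def
    by (rule abs_le_sum_sup_norms) (use fin that in \<open>auto simp: finite_norm_def Ck_on_def\<close>)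
  have 2: "\<bar>nth_deriv_on {0..1} j (\<lambda>x. F x t) x\<bar> \<le> Ck0_norm 4 T F" if "j \<le> 4" "x \<in> {0..1}" "t \<in> {0..T}" for j x t
    using abs_le_sum_sup_norms[OF c, of "(x, t)" 4 "\<lambda>j (x, t). x_deriv {0..1} j F x t" j] fin that
    by (auto simp: finite_norm_def Ck0_def QT_closed_def x_deriv_def Ck0_norm_def)
  have 3: "\<bar>nth_deriv_on {0..T} j E t\<bar> \<le> Ck_norm 1 {0..T} E" if "j \<le> 1" "t \<in> {0..T}" for j t
    unfolding Ck_norm_def
    by (rule abs_le_sum_sup_norms) (use fin that in \<open>auto simp: finite_norm_def Ck_on_def\<close>)
  have "0 \<le> Ck_norm 4 {0..1} \<phi>" "0 \<le> Ck0_norm 4 T F" "0 \<le> Ck_norm 1 {0..T} E"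
    using 1[of 0 0] 2[of 0 0 0] 3[of 0 0] T by auto
  then show "j \<le> 4 \<Longrightarrow> x \<in> {0..1} \<Longrightarrow> \<bar>nth_deriv_on {0..1} j \<phi> x\<bar> \<le> data_norm T \<phi> F E"
    "j \<le> 4 \<Longrightarrow> x \<in> {0..1} \<Longrightarrow> t \<in> {0..T} \<Longrightarrow> \<bar>nth_deriv_on {0..1} j (\<lambda>x. F x t) x\<bar> \<le> data_norm T \<phi> F E"
    "j \<le> 1 \<Longrightarrow> t \<in> {0..T} \<Longrightarrow> \<bar>nth_deriv_on {0..T} j E t\<bar> \<le> data_norm T \<phi> F E"
    unfolding data_norm_def using 1[of j x] 2[of j x t] 3[of j t] by linarith+
qed

text \<open>The regularity and boundary conditions shared by the initial value and by every time slice of the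
  source.  They are linear, hence inherited by differences.\<close>

definition compatible_profile :: "(real \<Rightarrow> real) \<Rightarrow> bool" where
  "compatible_profile f \<longleftrightarrow> Ck_on 4 {0..1} f \<and> f 0 = f 1 \<and> nth_deriv_on {0..1} 1 f 1 = 0
     \<and> nth_deriv_on {0..1} 2 f 0 = nth_deriv_on {0..1} 2 f 1"

lemma compatible_profile_continuous:
  assumes "compatible_profile f"
  shows "continuous_on {0..1} f"
proof -
  have "continuous_on {0..1} (nth_deriv_on {0..1} 0 f)"
    using assms unfolding compatible_profile_def Ck_on_def by blast
  then show ?thesis by simp
qed

lemma compatible_profile_diff:
  assumes "compatible_profile f" "compatible_profile g"
  shows "compatible_profile (\<lambda>x. f x - g x)"
proof -
  have td: "times_differentiable_on 4 {0..1} f" "times_differentiable_on 4 {0..1} g"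
    using assms unfolding compatible_profile_def Ck_on_def by auto
  show ?thesis
    using assms nth_deriv_on_diff(1)[OF zero_less_one td]
    by (auto simp: compatible_profile_def intro!: Ck_on_diff)
qed

lemma profile_coeff_bounds:
  assumes f: "compatible_profile f"
    and K: "\<And>j x. j \<le> 4 \<Longrightarrow> x \<in> {0..1} \<Longrightarrow> \<bar>nth_deriv_on {0..1} j f x\<bar> \<le> K"
  shows "\<bar>sine_coeff f n\<bar> \<le> K / freq n ^ 4" "\<bar>xcos_coeff f n\<bar> \<le> 4 * K / freq n ^ 3"
    "\<bar>x_moment f\<bar> \<le> K" "\<bar>integral {0..1} f\<bar> \<le> K"
proof -
  let ?D = "\<lambda>j. nth_deriv_on {0..1} j f"
  have d: "(?D j has_vector_derivative ?D (Suc j) x) (at x within {0..1})" if "j < 4" "x \<in> {0..1}" for j x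
    using f that nth_deriv_on_has_derivative unfolding compatible_profile_def Ck_on_def by blast
  have c: "continuous_on {0..1} (?D j)" if "j \<le> 4" for j
    using f that unfolding compatible_profile_def Ck_on_def by blast
  have per: "?D 0 0 = ?D 0 1" "?D 1 1 = 0" "?D 2 0 = ?D 2 1"
    using f unfolding compatible_profile_def by auto
  show "\<bar>sine_coeff f n\<bar> \<le> K / freq n ^ 4"
    using sine_coeff_decay[of ?D K n, OF d c per(1,3) K] by simp
  show "\<bar>xcos_coeff f n\<bar> \<le> 4 * K / freq n ^ 3"
    using xcos_coeff_decay[of ?D K n, OF d c per(1,2) K K] by simp
  have cf: "continuous_on {0..1} f" by (rule compatible_profile_continuous[OF f])
  have Kf: "\<bar>f x\<bar> \<le> K" if "x \<in> {0..1}" for x using K[of 0 x] that by simp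
  show "\<bar>x_moment f\<bar> \<le> K" unfolding x_moment_def
    by (rule abs_integral_trig_le[OF cf Kf]) auto
  show "\<bar>integral {0..1} f\<bar> \<le> K"
    using abs_integral_trig_le[OF cf Kf, of "\<lambda>_. 1"] by simp
qed

lemma coeff_diff:
  assumes f: "continuous_on {0..1} f" and g: "continuous_on {0..1} g"
  shows "sine_coeff (\<lambda>x. f x - g x) n = sine_coeff f n - sine_coeff g n"
    "xcos_coeff (\<lambda>x. f x - g x) n = xcos_coeff f n - xcos_coeff g n"
    "x_moment (\<lambda>x. f x - g x) = x_moment f - x_moment g"
    "integral {0..1} (\<lambda>x. f x - g x) = integral {0..1} f - integral {0..1} g"
  unfolding sine_coeff_def xcos_coeff_def x_moment_def left_diff_distrib
  by (intro integral_diff integrable_continuous_interval continuous_intros f g)+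

lemma continuous_on_weighted_mean:
  fixes F :: "real \<Rightarrow> real \<Rightarrow> real"
  assumes F: "continuous_on ({0..1} \<times> U) (\<lambda>(x, t). F x t)" and w: "continuous_on {0..1} w"
  shows "continuous_on U (\<lambda>t. integral {0..1} (\<lambda>x. F x t * w x))"
proof -
  have "continuous_on (U \<times> cbox 0 1) (\<lambda>p. (\<lambda>(x, t). F x t) (snd p, fst p) * w (snd p))"
    by (intro continuous_intros continuous_on_compose2[OF F] continuous_on_compose2[OF w]) auto
  then have "continuous_on (U \<times> cbox 0 1) (\<lambda>(t, x). F x t * w x)"
    by (simp add: case_prod_unfold)
  then show ?thesis using integral_continuous_on_param by fastforce
qed

lemma Y_coeff_even: "Y_coeff f (2 * (k + 1)) = sine_coeff f k"
  unfolding Y_coeff_def sine_coeff_def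
  by (rule integral_cong) (simp add: Y_def freq_def)

lemma Y_coeff_zero: "Y_coeff f 0 = x_moment f"
  by (simp add: Y_coeff_def x_moment_def Y_0)

section \<open>Consequences of the assumptions on the data\<close>

lemma admissible_profiles:
  assumes "admissible_data T \<phi> F E"
  shows "compatible_profile \<phi>" "t \<in> {0..T} \<Longrightarrow> compatible_profile (\<lambda>x. F x t)"
  using assms unfolding admissible_data_def assm_A2_def assm_A3_def compatible_profile_def x_deriv_def
  by auto

lemma admissible_source_continuous:
  assumes "admissible_data T \<phi> F E"
  shows "continuous_on ({0..1} \<times> {0..T}) (\<lambda>(x, t). F x t)"
  using assms unfolding admissible_data_def assm_A3_def QT_closed_def by blast

lemma admissible_nonneg:
  assumes "admissible_data T \<phi> F E"
  shows "0 \<le> sine_coeff \<phi> n" "t \<in> {0..T} \<Longrightarrow> 0 \<le> sine_coeff (\<lambda>x. F x t) n"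
    "t \<in> {0..T} \<Longrightarrow> 0 \<le> x_moment (\<lambda>x. F x t)"
proof -
  have "0 \<le> Y_coeff \<phi> (2 * (n + 1))"
    using assms unfolding admissible_data_def assm_A2_def by auto
  then show "0 \<le> sine_coeff \<phi> n" by (simp only: Y_coeff_even)
  have *: "0 \<le> Y_coeff (\<lambda>x. F x t) (2 * k)" if "t \<in> {0..T}" for k
    using assms that unfolding admissible_data_def assm_A3_def by auto
  show "0 \<le> sine_coeff (\<lambda>x. F x t) n" if "t \<in> {0..T}"
    using *[OF that, of "n + 1"] by (simp only: Y_coeff_even)
  show "0 \<le> x_moment (\<lambda>x. F x t)" if "t \<in> {0..T}"
    using *[OF that, of 0] by (simp add: Y_coeff_zero)
qed

lemma admissible_coeffs_continuous:
  assumes "admissible_data T \<phi> F E"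
  shows "continuous_on {0..T} (\<lambda>t. sine_coeff (\<lambda>x. F x t) n)"
    "continuous_on {0..T} (\<lambda>t. xcos_coeff (\<lambda>x. F x t) n)"
    "continuous_on {0..T} (\<lambda>t. x_moment (\<lambda>x. F x t))"
    "continuous_on {0..T} (\<lambda>t. integral {0..1} (\<lambda>x. F x t))"
  using continuous_on_weighted_mean[OF admissible_source_continuous[OF assms], of "\<lambda>x. 1"]
  unfolding sine_coeff_def xcos_coeff_def x_moment_def
  by (auto intro!: continuous_on_weighted_mean[OF admissible_source_continuous[OF assms]] continuous_intros)

lemma admissible_mass:
  assumes "admissible_data T \<phi> F E"
  shows "t \<in> {0..T} \<Longrightarrow> (E has_vector_derivative nth_deriv_on {0..T} 1 E t) (at t within {0..T})"
    "t \<in> {0..T} \<Longrightarrow> nth_deriv_on {0..T} 1 E t < 0"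
    "continuous_on {0..T} (nth_deriv_on {0..T} 1 E)"
proof -
  have E: "Ck_on 1 {0..T} E" and neg: "\<forall>t\<in>{0..T}. nth_deriv_on {0..T} 1 E t < 0"
    using assms unfolding admissible_data_def assm_A1_def by auto
  show "t \<in> {0..T} \<Longrightarrow> (E has_vector_derivative nth_deriv_on {0..T} 1 E t) (at t within {0..T})"
    using nth_deriv_on_has_derivative[of 1 "{0..T}" E 0 t] E unfolding Ck_on_def by simp
  show "t \<in> {0..T} \<Longrightarrow> nth_deriv_on {0..T} 1 E t < 0" using neg by blast
  show "continuous_on {0..T} (nth_deriv_on {0..T} 1 E)" using E unfolding Ck_on_def by blast
qed

lemma admissible_mass_increment:
  assumes adm: "admissible_data T \<phi> F E" and "0 \<le> r" "r \<le> s" "s \<le> T"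
  shows "(nth_deriv_on {0..T} 1 E has_integral E s - E r) {r..s}"
proof (rule fundamental_theorem_of_calculus)
  fix t assume t: "t \<in> {r..s}"
  show "(E has_vector_derivative nth_deriv_on {0..T} 1 E t) (at t within {r..s})"
    by (rule has_vector_derivative_within_subset[OF admissible_mass(1)[OF adm]])
       (use assms t in auto)
qed (use assms in auto)

lemma admissible_mass_antimono:
  assumes adm: "admissible_data T \<phi> F E" and "0 \<le> r" "r \<le> s" "s \<le> T"
  shows "E s \<le> E r"
proof -
  have "E s - E r \<le> 0"
    by (rule has_integral_le[OF admissible_mass_increment[OF assms] has_integral_0])
       (use admissible_mass(2)[OF adm] assms in \<open>force intro: less_imp_le\<close>)
  then show ?thesis by simp
qed

text \<open>The left-hand side of the last assumption on the data, after the sum of the series has been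
  evaluated (see \<open>assm_A3_margin\<close>); for a solution \<open>u\<close> it is a lower bound of \<open>E - 2 \<integral> x u\<close> on the
  whole time interval.\<close>

definition margin :: "real \<Rightarrow> (real \<Rightarrow> real) \<Rightarrow> (real \<Rightarrow> real \<Rightarrow> real) \<Rightarrow> (real \<Rightarrow> real) \<Rightarrow> real" where
  "margin T \<phi> F E = E T - 2 * x_moment \<phi> - 2 * integral {0..T} (\<lambda>t. x_moment (\<lambda>x. F x t))"

lemma compatible_profile_bounded:
  assumes "compatible_profile f"
  obtains K where "\<And>j x. j \<le> 4 \<Longrightarrow> x \<in> {0..1} \<Longrightarrow> \<bar>nth_deriv_on {0..1} j f x\<bar> \<le> K"
proof -
  have "\<bar>nth_deriv_on {0..1} j f x\<bar> \<le> (\<Sum>i\<le>4. sup_norm {0..1} (nth_deriv_on {0..1} i f))"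
    if "j \<le> 4" "x \<in> {0..1}" for j x
    by (rule abs_le_sum_sup_norms) (use assms that in \<open>auto simp: compatible_profile_def Ck_on_def\<close>)
  then show thesis using that by blast
qed

lemma compatible_profile_summable_sine:
  assumes "compatible_profile f"
  shows "summable (\<lambda>n. \<bar>sine_coeff f n\<bar>)"
proof -
  obtain K where K: "\<And>j x. j \<le> 4 \<Longrightarrow> x \<in> {0..1} \<Longrightarrow> \<bar>nth_deriv_on {0..1} j f x\<bar> \<le> K"
    using compatible_profile_bounded[OF assms] by blast
  show ?thesis
    by (rule summable_comparison_test[OF _ summable_inverse_freq_power[of 4 K]])
       (use profile_coeff_bounds(1)[OF assms K] in auto)
qed

text \<open>By \<open>mean_minus_moment_series\<close> the series in the assumption is \<open>E 0 - 2 \<integral> x \<phi>\<close>, and \<open>E 0\<close> cancels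
  against the integral of \<open>E'\<close>.\<close>

lemma assm_A3_margin:
  assumes T: "0 < T" and adm: "Ck_on 1 {0..T} E" "compatible_profile \<phi>" and "integral {0..1} \<phi> = E 0"
  shows "integral {0..T} (nth_deriv_on {0..T} 1 E)
       + (\<Sum>k. 2 / (pi * real (k + 1)) * Y_coeff \<phi> (2 * (k + 1)))
       - 2 * integral {0..T} (\<lambda>t. Y_coeff (\<lambda>x. F x t) 0) = margin T \<phi> F E"
proof -
  have "((nth_deriv_on {0..T} 1 E) has_integral E T - E 0) {0..T}"
  proof (rule fundamental_theorem_of_calculus)
    fix t assume "t \<in> {0..T}"
    then show "(E has_vector_derivative nth_deriv_on {0..T} 1 E t) (at t within {0..T})"
      using nth_deriv_on_has_derivative[of 1 "{0..T}" E 0 t] adm unfolding Ck_on_def by simp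
  qed (use T in auto)
  then have 1: "integral {0..T} (nth_deriv_on {0..T} 1 E) = E T - E 0" by (rule integral_unique)
  have "(\<lambda>k. 4 / freq k * sine_coeff \<phi> k) sums (integral {0..1} \<phi> - 2 * x_moment \<phi>)"
    by (rule mean_minus_moment_series)
       (use adm in \<open>auto simp: compatible_profile_def intro: compatible_profile_continuous compatible_profile_summable_sine\<close>)
  moreover have "2 / (pi * real (k + 1)) * Y_coeff \<phi> (2 * (k + 1)) = 4 / freq k * sine_coeff \<phi> k" for k
    unfolding Y_coeff_even
  proof -
    have "2 / (pi * real (k + 1)) = 4 / freq k" unfolding freq_def by simp
    then show "2 / (pi * real (k + 1)) * sine_coeff \<phi> k = 4 / freq k * sine_coeff \<phi> k" by simp
  qed
  ultimately have 2: "(\<Sum>k. 2 / (pi * real (k + 1)) * Y_coeff \<phi> (2 * (k + 1)))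
      = integral {0..1} \<phi> - 2 * x_moment \<phi>"
    by (simp only: sums_iff)
  show ?thesis unfolding 1 2 Y_coeff_zero margin_def assms(4) by simp
qed

lemma admissible_margin_pos:
  assumes "0 < T" "admissible_data T \<phi> F E"
  shows "0 < margin T \<phi> F E"
  using assms assm_A3_margin[of T E \<phi> F] admissible_profiles(1)[OF assms(2)]
  unfolding admissible_data_def assm_A1_def assm_A2_def assm_A3_def by auto

text \<open>Otherwise \<open>E 0 = 2 \<integral> x \<phi>\<close>, and the margin would be at most \<open>E T - E 0 \<le> 0\<close>.\<close>

lemma admissible_sine_coeff_pos:
  assumes T: "0 < T" and adm: "admissible_data T \<phi> F E"
  shows "\<exists>k. 0 < sine_coeff \<phi> k"
proof (rule ccontr)
  assume "\<not> ?thesis"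
  then have "sine_coeff \<phi> k = 0" for k
    using admissible_nonneg(1)[OF adm, of k] by (metis less_eq_real_def)
  moreover have "(\<lambda>k. 4 / freq k * sine_coeff \<phi> k) sums (integral {0..1} \<phi> - 2 * x_moment \<phi>)"
    by (rule mean_minus_moment_series)
       (use admissible_profiles(1)[OF adm] in \<open>auto simp: compatible_profile_def intro: compatible_profile_continuous compatible_profile_summable_sine\<close>)
  ultimately have "integral {0..1} \<phi> - 2 * x_moment \<phi> = 0" by (simp add: sums_iff)
  moreover have "integral {0..1} \<phi> = E 0" using adm unfolding admissible_data_def assm_A2_def by blast
  moreover have "E T \<le> E 0" by (rule admissible_mass_antimono[OF adm]) (use T in auto)
  moreover have "0 \<le> integral {0..T} (\<lambda>t. x_moment (\<lambda>x. F x t))"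
    by (intro integral_nonneg integrable_continuous_interval admissible_coeffs_continuous[OF adm])
       (use admissible_nonneg(3)[OF adm] in auto)
  ultimately show False using admissible_margin_pos[OF T adm] unfolding margin_def by linarith
qed

text \<open>The margin can only grow when the time interval shrinks, since \<open>E\<close> decreases and the moments of the
  source are nonnegative.\<close>

lemma admissible_data_restrict:
  assumes adm: "admissible_data S \<phi> F E" and T: "0 < T" "T \<le> S"
  shows "admissible_data T \<phi> F E"
proof -
  have E1: "nth_deriv_on {0..T} 1 E t = nth_deriv_on {0..S} 1 E t" if t: "t \<in> {0..T}" for t
  proof -
    have "(E has_vector_derivative nth_deriv_on {0..S} 1 E t) (at t within {0..T})"
      by (rule has_vector_derivative_within_subset[OF admissible_mass(1)[OF adm]]) (use t T in auto)
    then show ?thesis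
      using vector_derivative_within_closed_interval[OF T(1) t] by (simp add: nth_deriv_on_Suc)
  qed
  have E: "Ck_on 1 {0..T} E"
    unfolding Ck_on_def
  proof (intro conjI allI impI)
    show "times_differentiable_on 1 {0..T} E"
      unfolding times_differentiable_on_def
    proof (intro allI impI ballI)
      fix j :: nat and t assume j: "j < 1" and t: "t \<in> {0..T}"
      have "(E has_vector_derivative nth_deriv_on {0..S} 1 E t) (at t within {0..T})"
        by (rule has_vector_derivative_within_subset[OF admissible_mass(1)[OF adm]]) (use t T in auto)
      then show "nth_deriv_on {0..T} j E differentiable at t within {0..T}"
        using j by (auto intro: differentiableI_vector)
    qed
    fix j :: nat assume "j \<le> 1"
    then consider "j = 0" | "j = 1" by linarith
    then show "continuous_on {0..T} (nth_deriv_on {0..T} j E)"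
    proof cases
      case 1
      have "continuous_on {0..S} (nth_deriv_on {0..S} 0 E)"
        using adm unfolding admissible_data_def assm_A1_def Ck_on_def by blast
      then show ?thesis using 1 T by (auto intro: continuous_on_subset)
    next
      case 2
      have "continuous_on {0..T} (nth_deriv_on {0..S} 1 E)"
        by (rule continuous_on_subset[OF admissible_mass(3)[OF adm]]) (use T in auto)
      then show ?thesis using 2 E1 by (simp cong: continuous_on_cong_simp)
    qed
  qed
  have sub: "QT_closed T \<subseteq> QT_closed S" using T unfolding QT_closed_def by auto
  have F: "Ck0 4 T F"
    using adm T continuous_on_subset[OF _ sub]
    unfolding admissible_data_def finite_norm_def Ck0_def by auto
  have mono: "integral {0..T} (\<lambda>t. x_moment (\<lambda>x. F x t)) \<le> integral {0..S} (\<lambda>t. x_moment (\<lambda>x. F x t))"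
    using T admissible_nonneg(3)[OF adm]
    by (intro integral_subset_le integrable_continuous_interval
        continuous_on_subset[OF admissible_coeffs_continuous(3)[OF adm]]) auto
  have "E S \<le> E T" by (rule admissible_mass_antimono[OF adm]) (use T in auto)
  then have "0 < margin T \<phi> F E"
    using admissible_margin_pos[OF _ adm] T mono unfolding margin_def by simp
  then have "0 < integral {0..T} (nth_deriv_on {0..T} 1 E)
       + (\<Sum>k. 2 / (pi * real (k + 1)) * Y_coeff \<phi> (2 * (k + 1)))
       - 2 * integral {0..T} (\<lambda>t. Y_coeff (\<lambda>x. F x t) 0)"
    using assm_A3_margin[OF T(1) E admissible_profiles(1)[OF adm]] adm
    unfolding admissible_data_def assm_A2_def by simp
  then show ?thesis
    using adm E E1 F T continuous_on_subset[OF _ sub]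
    unfolding admissible_data_def assm_A1_def assm_A3_def finite_norm_def by auto
qed

section \<open>The equation tested against smooth functions of space\<close>

text \<open>The substitution \<open>x = (1 - 2 r) \<xi> + r\<close> moves the parameter from the limits of integration into the
  integrand.\<close>

lemma continuous_on_shrinking_integral:
  fixes K :: "real \<Rightarrow> real \<Rightarrow> real"
  assumes K: "continuous_on ({0..1} \<times> U) (\<lambda>(x, t). K x t)"
  shows "continuous_on ({0..1/4} \<times> U) (\<lambda>(r, t). integral {r..1 - r} (\<lambda>x. K x t))"
proof -
  let ?m = "\<lambda>r::real. 1 - 2 * r"
  have in01: "?m r * \<xi> + r \<in> {0..1}" if r: "r \<in> {0..1/4}" and \<xi>: "\<xi> \<in> {0..1}" for r \<xi> :: real
  proof -
    have "?m r * \<xi> \<le> ?m r" using r \<xi> by (intro mult_left_le) auto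
    then have "?m r * \<xi> + r \<le> ?m r + r" by (rule add_right_mono)
    also have "\<dots> \<le> 1" using r by simp
    finally have "?m r * \<xi> + r \<le> 1" .
    moreover have "0 \<le> ?m r * \<xi>" using r \<xi> by (intro mult_nonneg_nonneg) auto
    ultimately show ?thesis using r by simp
  qed
  have eq: "integral {r..1 - r} (\<lambda>x. K x t) = ?m r * integral {0..1} (\<lambda>\<xi>. K (?m r * \<xi> + r) t)"
    if r: "r \<in> {0..1/4}" and t: "t \<in> U" for r t
  proof -
    have m: "0 < ?m r" using r by auto
    have "continuous_on {r..1 - r} (\<lambda>x. (\<lambda>(x, t). K x t) (x, t))"
      by (rule continuous_on_compose2[OF K]) (use r t in \<open>auto intro!: continuous_intros\<close>)
    then have "((\<lambda>x. K x t) has_integral integral {r..1 - r} (\<lambda>x. K x t)) (cbox r (1 - r))"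
      by (simp add: integrable_continuous_interval integrable_integral)
    from has_integral_affinity'[OF this m, of r]
    have "((\<lambda>\<xi>. K (?m r * \<xi> + r) t) has_integral integral {r..1 - r} (\<lambda>x. K x t) / ?m r) {0..1}"
      using m by (simp add: divide_inverse mult.commute)
    then show ?thesis using m by (simp add: integral_unique)
  qed
  have "continuous_on (({0..1/4} \<times> U) \<times> cbox 0 1) (\<lambda>q. (\<lambda>(x, t). K x t) (?m (fst (fst q)) * snd q + fst (fst q), snd (fst q)))"
    by (rule continuous_on_compose2[OF K])
       (use in01 in \<open>auto intro!: continuous_intros simp del: atLeastAtMost_iff\<close>)
  then have "continuous_on (({0..1/4} \<times> U) \<times> cbox 0 1) (\<lambda>(p, \<xi>). K (?m (fst p) * \<xi> + fst p) (snd p))"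
    by (simp add: case_prod_unfold)
  from integral_continuous_on_param[OF this]
  have "continuous_on ({0..1/4} \<times> U) (\<lambda>p. ?m (fst p) * integral {0..1} (\<lambda>\<xi>. K (?m (fst p) * \<xi> + fst p) (snd p)))"
    by (intro continuous_intros) simp
  moreover have "?m (fst p) * integral {0..1} (\<lambda>\<xi>. K (?m (fst p) * \<xi> + fst p) (snd p))
      = (\<lambda>(r, t). integral {r..1 - r} (\<lambda>x. K x t)) p" if "p \<in> {0..1/4} \<times> U" for p
    using eq[of "fst p" "snd p"] that by auto
  ultimately show ?thesis by (simp cong: continuous_on_cong_simp)
qed

lemma continuous_zero_at_left_end:
  fixes f :: "real \<Rightarrow> real"
  assumes "continuous_on {0..b} f" "0 < b" "\<And>x. 0 < x \<Longrightarrow> x \<le> b \<Longrightarrow> f x = 0"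
  shows "f 0 = 0"
  by (rule continuous_constant_on_closure[of "{0<..b}" f]) (use assms in auto)

text \<open>The first space derivative is taken relative to \<open>[0, 1]\<close> in one part of the definition of a solution
  and relative to the open interval in another; both agree inside.  Here the first
  derivative is always the one relative to \<open>[0, 1]\<close>, which is continuous up to the boundary.\<close>

lemma classical_solution_regularity:
  assumes T: "0 < T" and sol: "classical_solution T \<phi> F E a u"
  shows "continuous_on ({0..1} \<times> {0..T}) (\<lambda>(x, t). u x t)"
    and "continuous_on ({0..1} \<times> {0..T}) (\<lambda>(x, t). x_deriv {0..1} 1 u x t)"
    and "t \<in> {0..T} \<Longrightarrow> x \<in> {0..1} \<Longrightarrow>
      ((\<lambda>x. u x t) has_vector_derivative x_deriv {0..1} 1 u x t) (at x within {0..1})"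
    and "continuous_on ({0<..<1} \<times> {0<..T}) (\<lambda>(x, t). x_deriv {0<..<1} 2 u x t)"
    and "t \<in> {0<..T} \<Longrightarrow> x \<in> {0<..<1} \<Longrightarrow>
      ((\<lambda>x. x_deriv {0..1} 1 u x t) has_vector_derivative x_deriv {0<..<1} 2 u x t) (at x)"
    and "t \<in> {0<..T} \<Longrightarrow> x \<in> {0<..<1} \<Longrightarrow>
      (u x has_vector_derivative a t * x_deriv {0<..<1} 2 u x t + F x t) (at t within {0<..T})"
proof -
  have C21: "C21 T u" and C10: "Ck0 1 T u"
    and pde: "\<And>x t. (x, t) \<in> QT T \<Longrightarrow> t_deriv {0<..T} u x t = a t * x_deriv {0<..<1} 2 u x t + F x t"
    using sol unfolding classical_solution_def by auto
  have "continuous_on (QT_closed T) (\<lambda>(x, t). x_deriv {0..1} 0 u x t)"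
    "continuous_on (QT_closed T) (\<lambda>(x, t). x_deriv {0..1} 1 u x t)"
    using C10 unfolding Ck0_def by auto
  then show "continuous_on ({0..1} \<times> {0..T}) (\<lambda>(x, t). u x t)"
    "continuous_on ({0..1} \<times> {0..T}) (\<lambda>(x, t). x_deriv {0..1} 1 u x t)"
    by (simp_all add: x_deriv_def QT_closed_def)
  show ux: "((\<lambda>x. u x t) has_vector_derivative x_deriv {0..1} 1 u x t) (at x within {0..1})"
    if "t \<in> {0..T}" "x \<in> {0..1}" for x t
    using nth_deriv_on_has_derivative[of 1 "{0..1}" "\<lambda>x. u x t" 0 x] C10 that
    unfolding Ck0_def x_deriv_def by simp
  show "continuous_on ({0<..<1} \<times> {0<..T}) (\<lambda>(x, t). x_deriv {0<..<1} 2 u x t)"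
    using C21 unfolding C21_def QT_def by auto
  have ux_eq: "x_deriv {0<..<1} 1 u x t = x_deriv {0..1} 1 u x t" if "x \<in> {0<..<1}" for x t
  proof -
    have "at x within {0<..<1} = at x" using that by (intro at_within_open) auto
    moreover have "at x within {0..1} = at x" using that by (intro at_within_interior) auto
    ultimately show ?thesis by (simp add: x_deriv_def nth_deriv_on_Suc)
  qed
  show "((\<lambda>x. x_deriv {0..1} 1 u x t) has_vector_derivative x_deriv {0<..<1} 2 u x t) (at x)"
    if t: "t \<in> {0<..T}" and x: "x \<in> {0<..<1}" for x t
  proof -
    have "times_differentiable_on 2 {0<..<1} (\<lambda>x. u x t)" using C21 t unfolding C21_def by blast
    from nth_deriv_on_has_derivative[OF this _ x, of 1]
    have "((\<lambda>x. x_deriv {0<..<1} 1 u x t) has_vector_derivative x_deriv {0<..<1} 2 u x t) (at x within {0<..<1})"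
      by (simp add: x_deriv_def numeral_2_eq_2)
    then have "((\<lambda>x. x_deriv {0..1} 1 u x t) has_vector_derivative x_deriv {0<..<1} 2 u x t) (at x within {0<..<1})"
      using has_vector_derivative_transform[OF x, of "\<lambda>x. x_deriv {0..1} 1 u x t" "\<lambda>x. x_deriv {0<..<1} 1 u x t"]
        ux_eq[of _ t] by metis
    moreover have "at x within {0<..<1} = at x" using x by (intro at_within_open) auto
    ultimately show ?thesis by simp
  qed
  show "(u x has_vector_derivative a t * x_deriv {0<..<1} 2 u x t + F x t) (at t within {0<..T})"
    if t: "t \<in> {0<..T}" and x: "x \<in> {0<..<1}" for x t
    using nth_deriv_on_has_derivative[of 1 "{0<..T}" "u x" 0 t] C21 t x pde[of x t]
    unfolding C21_def QT_def t_deriv_def by simp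
qed

text \<open>The time derivative of the integral of \<open>u w\<close> over \<open>[r, 1 - r]\<close>, after two integrations by parts that
  move the space derivatives to the test function \<open>w\<close> (with derivatives \<open>w1\<close>, \<open>w2\<close>).  A strip of width \<open>r\<close> is
  cut off because \<open>u\<^sub>x\<^sub>x\<close> and \<open>u\<^sub>t\<close> may be unbounded near the boundary.\<close>

definition weak_flux :: "(real \<Rightarrow> real) \<Rightarrow> (real \<Rightarrow> real \<Rightarrow> real) \<Rightarrow> (real \<Rightarrow> real \<Rightarrow> real)
    \<Rightarrow> (real \<Rightarrow> real) \<Rightarrow> (real \<Rightarrow> real) \<Rightarrow> (real \<Rightarrow> real) \<Rightarrow> real \<Rightarrow> real \<Rightarrow> real" where
  "weak_flux a u F w w1 w2 r t =
     a t * ((x_deriv {0..1} 1 u (1 - r) t * w (1 - r) - u (1 - r) t * w1 (1 - r))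
            - (x_deriv {0..1} 1 u r t * w r - u r t * w1 r)
            + integral {r..1 - r} (\<lambda>x. u x t * w2 x))
     + integral {r..1 - r} (\<lambda>x. F x t * w x)"

context
  fixes T :: real and \<phi> E a :: "real \<Rightarrow> real" and F u :: "real \<Rightarrow> real \<Rightarrow> real" and w w1 w2 :: "real \<Rightarrow> real"
  assumes T: "0 < T" and sol: "classical_solution T \<phi> F E a u"
    and F: "continuous_on ({0..1} \<times> {0..T}) (\<lambda>(x, t). F x t)"
    and w: "\<And>x. x \<in> {0..1} \<Longrightarrow> (w has_vector_derivative w1 x) (at x within {0..1})"
    and w1: "\<And>x. x \<in> {0..1} \<Longrightarrow> (w1 has_vector_derivative w2 x) (at x within {0..1})"
    and w2: "continuous_on {0..1} w2"
begin

lemmas regularity = classical_solution_regularity[OF T sol]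

lemma w_continuous: "continuous_on {0..1} w" "continuous_on {0..1} w1"
  using w w1 has_vector_derivative_continuous continuous_on_eq_continuous_within by blast+

lemma a_continuous: "continuous_on {0..T} a"
  using sol unfolding classical_solution_def by blast

text \<open>On a rectangle inside the domain all derivatives are continuous, so the order of integration can be
  exchanged.\<close>

lemma weak_form_interior:
  assumes r: "0 < r" "r \<le> 1/4" and s: "0 < s" "s \<le> t" "t \<le> T"
  shows "integral {r..1 - r} (\<lambda>x. u x t * w x) - integral {r..1 - r} (\<lambda>x. u x s * w x)
    = integral {s..t} (weak_flux a u F w w1 w2 r)"
proof -
  let ?ut = "\<lambda>x \<tau>. a \<tau> * x_deriv {0<..<1} 2 u x \<tau> + F x \<tau>"
  have sub: "{r..1 - r} \<times> {s..t} \<subseteq> {0<..<1} \<times> {0<..T}" "{r..1 - r} \<times> {s..t} \<subseteq> {0..1} \<times> {0..T}"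
    "{r..1 - r} \<subseteq> {0..1}" "{s..t} \<subseteq> {0..T}"
    using r s by auto
  have slice: "continuous_on {r..1 - r} (\<lambda>x. h x \<tau>)"
    if "continuous_on (A \<times> B) (\<lambda>(x, t). h x t)" "{r..1 - r} \<subseteq> A" "\<tau> \<in> B" for h A B \<tau>
  proof -
    have "continuous_on {r..1 - r} (\<lambda>x. (\<lambda>(x, t). h x t) (x, \<tau>))"
      by (rule continuous_on_compose2[OF that(1)]) (use that in \<open>auto intro!: continuous_intros\<close>)
    then show ?thesis by simp
  qed
  have uc: "continuous_on {r..1 - r} (\<lambda>x. u x \<tau>)" "continuous_on {r..1 - r} (\<lambda>x. F x \<tau>)"
    "continuous_on {r..1 - r} (\<lambda>x. x_deriv {0<..<1} 2 u x \<tau>)"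
    if "\<tau> \<in> {s..t}" for \<tau>
    using slice[OF regularity(1), of \<tau>] slice[OF F, of \<tau>] slice[OF regularity(4), of \<tau>] r s that
    by (simp_all add: subset_iff)
  have wc: "continuous_on {r..1 - r} w" "continuous_on {r..1 - r} w1" "continuous_on {r..1 - r} w2"
    using w_continuous w2 sub(3) by (auto intro: continuous_on_subset)
  have "integral {r..1 - r} (\<lambda>x. u x t * w x) - integral {r..1 - r} (\<lambda>x. u x s * w x)
      = integral {r..1 - r} (\<lambda>x. u x t * w x - u x s * w x)"
    using s by (intro integral_diff[symmetric] integrable_continuous_interval continuous_intros uc wc) auto
  also have "\<dots> = integral {r..1 - r} (\<lambda>x. integral {s..t} (\<lambda>\<tau>. ?ut x \<tau> * w x))"
  proof (rule integral_cong)
    fix x assume x: "x \<in> {r..1 - r}"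
    have "(?ut x has_integral u x t - u x s) {s..t}"
    proof (rule fundamental_theorem_of_calculus)
      fix \<tau> assume \<tau>: "\<tau> \<in> {s..t}"
      show "(u x has_vector_derivative ?ut x \<tau>) (at \<tau> within {s..t})"
        by (rule has_vector_derivative_within_subset[OF regularity(6)]) (use x r s \<tau> in auto)
    qed (use s in auto)
    from integral_unique[OF has_integral_mult_left[OF this, of "w x"]]
    show "u x t * w x - u x s * w x = integral {s..t} (\<lambda>\<tau>. ?ut x \<tau> * w x)"
      by (simp add: left_diff_distrib)
  qed
  also have "\<dots> = integral {s..t} (\<lambda>\<tau>. integral {r..1 - r} (\<lambda>x. ?ut x \<tau> * w x))"
  proof -
    have "continuous_on ({r..1 - r} \<times> {s..t})
        (\<lambda>p. (a (snd p) * (\<lambda>(x, t). x_deriv {0<..<1} 2 u x t) p + (\<lambda>(x, t). F x t) p) * w (fst p))"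
      by (intro continuous_intros continuous_on_subset[OF regularity(4) sub(1)] continuous_on_subset[OF F sub(2)]
          continuous_on_compose2[OF a_continuous] continuous_on_compose2[OF w_continuous(1)])
         (use sub in auto)
    moreover have "cbox (r, s) (1 - r, t) = {r..1 - r} \<times> {s..t}"
      unfolding cbox_Pair_eq by simp
    ultimately have "continuous_on (cbox (r, s) (1 - r, t)) (\<lambda>(x, \<tau>). ?ut x \<tau> * w x)"
      unfolding case_prod_unfold
      by (simp only:)
    from integral_swap_continuous[OF this] show ?thesis unfolding cbox_interval .
  qed
  also have "\<dots> = integral {s..t} (weak_flux a u F w w1 w2 r)"
  proof (rule integral_cong)
    fix \<tau> assume \<tau>: "\<tau> \<in> {s..t}"
    let ?P = "\<lambda>x. x_deriv {0..1} 1 u x \<tau> * w x - u x \<tau> * w1 x"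
    have P: "((\<lambda>x. x_deriv {0<..<1} 2 u x \<tau> * w x - u x \<tau> * w2 x) has_integral ?P (1 - r) - ?P r) {r..1 - r}"
    proof (rule fundamental_theorem_of_calculus)
      fix x assume x: "x \<in> {r..1 - r}"
      have x': "x \<in> {0..1}" "x \<in> {0<..<1}" and \<tau>': "\<tau> \<in> {0<..T}" "\<tau> \<in> {0..T}" using x r s \<tau> by auto
      have i: "at x within {0..1} = at x" using x'(2) by (intro at_within_interior) auto
      have "(?P has_vector_derivative x_deriv {0<..<1} 2 u x \<tau> * w x - u x \<tau> * w2 x) (at x)"
        using regularity(3)[OF \<tau>'(2) x'(1)] regularity(5)[OF \<tau>'(1) x'(2)] w[OF x'(1)] w1[OF x'(1)] unfolding i
        unfolding has_real_derivative_iff_has_vector_derivative[symmetric]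
        by (auto intro!: derivative_eq_intros)
      then show "(?P has_vector_derivative x_deriv {0<..<1} 2 u x \<tau> * w x - u x \<tau> * w2 x) (at x within {r..1 - r})"
        by (rule has_vector_derivative_at_within)
    qed (use r in auto)
    have "((\<lambda>x. u x \<tau> * w2 x) has_integral integral {r..1 - r} (\<lambda>x. u x \<tau> * w2 x)) {r..1 - r}"
      by (intro integrable_integral integrable_continuous_interval continuous_intros uc wc \<tau>)
    from has_integral_add[OF P this]
    have 1: "((\<lambda>x. x_deriv {0<..<1} 2 u x \<tau> * w x) has_integral
        ?P (1 - r) - ?P r + integral {r..1 - r} (\<lambda>x. u x \<tau> * w2 x)) {r..1 - r}"
      by simp
    have "((\<lambda>x. F x \<tau> * w x) has_integral integral {r..1 - r} (\<lambda>x. F x \<tau> * w x)) {r..1 - r}"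
      by (intro integrable_integral integrable_continuous_interval continuous_intros uc wc \<tau>)
    from has_integral_add[OF has_integral_mult_right[OF 1, of "a \<tau>"] this]
    show "integral {r..1 - r} (\<lambda>x. ?ut x \<tau> * w x) = weak_flux a u F w w1 w2 r \<tau>"
      unfolding weak_flux_def by (intro integral_unique) (simp add: algebra_simps)
  qed
  finally show ?thesis .
qed

lemma weak_flux_continuous: "continuous_on ({0..1/4} \<times> {0..T}) (\<lambda>(r, t). weak_flux a u F w w1 w2 r t)"
proof -
  let ?R = "{0..1/4} \<times> {0..T}"
  have edge: "continuous_on ?R (\<lambda>p. h (fst p) (snd p))" "continuous_on ?R (\<lambda>p. h (1 - fst p) (snd p))"
    if h: "continuous_on ({0..1} \<times> {0..T}) (\<lambda>(x, t). h x t)" for h :: "real \<Rightarrow> real \<Rightarrow> real"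
  proof -
    have "continuous_on ?R (\<lambda>p. (\<lambda>(x, t). h x t) (fst p, snd p))"
      by (rule continuous_on_compose2[OF h]) (auto intro!: continuous_intros)
    then show "continuous_on ?R (\<lambda>p. h (fst p) (snd p))" by (simp add: case_prod_unfold)
    have "continuous_on ?R (\<lambda>p. (\<lambda>(x, t). h x t) (1 - fst p, snd p))"
      by (rule continuous_on_compose2[OF h]) (auto intro!: continuous_intros)
    then show "continuous_on ?R (\<lambda>p. h (1 - fst p) (snd p))" by simp
  qed
  have edge1: "continuous_on ?R (\<lambda>p. h (fst p))" "continuous_on ?R (\<lambda>p. h (1 - fst p))"
    if h: "continuous_on {0..1} h" for h :: "real \<Rightarrow> real"
    by (rule continuous_on_compose2[OF h]; auto intro!: continuous_intros)+
  have int: "continuous_on ?R (\<lambda>p. integral {fst p..1 - fst p} (\<lambda>x. h x (snd p) * v x))"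
    if h: "continuous_on ({0..1} \<times> {0..T}) (\<lambda>(x, t). h x t)" and v: "continuous_on {0..1} v"
    for h :: "real \<Rightarrow> real \<Rightarrow> real" and v
  proof -
    have "continuous_on ({0..1} \<times> {0..T}) (\<lambda>p. (\<lambda>(x, t). h x t) p * v (fst p))"
      by (intro continuous_intros h continuous_on_compose2[OF v]) auto
    then have "continuous_on ({0..1} \<times> {0..T}) (\<lambda>(x, t). h x t * v x)"
      by (simp add: case_prod_unfold)
    from continuous_on_shrinking_integral[OF this] show ?thesis by (simp add: case_prod_unfold)
  qed
  have "continuous_on ?R (\<lambda>p. weak_flux a u F w w1 w2 (fst p) (snd p))"
    unfolding weak_flux_def
    by (intro continuous_on_add continuous_on_diff continuous_on_mult edge[OF regularity(1)] edge[OF regularity(2)]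
        edge1[OF w_continuous(1)] edge1[OF w_continuous(2)] int[OF regularity(1) w2] int[OF F w_continuous(1)]
        continuous_on_compose2[OF a_continuous] continuous_on_snd continuous_on_id) auto
  then show ?thesis by (simp add: case_prod_unfold)
qed

lemma weak_flux_continuous_time: "continuous_on {0..T} (weak_flux a u F w w1 w2 r)" if "r \<in> {0..1/4}"
proof -
  have "continuous_on {0..T} (\<lambda>t. (\<lambda>(r, t). weak_flux a u F w w1 w2 r t) (r, t))"
    by (rule continuous_on_compose2[OF weak_flux_continuous]) (use that in \<open>auto intro!: continuous_intros\<close>)
  then show ?thesis by simp
qed

lemma mean_continuous: "continuous_on ({0..1/4} \<times> {0..T}) (\<lambda>(r, t). integral {r..1 - r} (\<lambda>x. u x t * w x))"
proof -
  have "continuous_on ({0..1} \<times> {0..T}) (\<lambda>p. (\<lambda>(x, t). u x t) p * w (fst p))"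
    by (intro continuous_intros regularity(1) continuous_on_compose2[OF w_continuous(1)]) auto
  then have "continuous_on ({0..1} \<times> {0..T}) (\<lambda>(x, t). u x t * w x)"
    by (simp add: case_prod_unfold)
  from continuous_on_shrinking_integral[OF this] show ?thesis .
qed

text \<open>The second derivatives have disappeared from both sides, which are therefore continuous up to the
  initial time; afterwards the same argument is used for \<open>r\<close> tending to \<open>0\<close>.\<close>

lemma weak_form_shrunk:
  assumes r: "0 < r" "r \<le> 1/4" and t: "0 < t" "t \<le> T"
  shows "integral {r..1 - r} (\<lambda>x. u x t * w x) - integral {r..1 - r} (\<lambda>x. u x 0 * w x)
    = integral {0..t} (weak_flux a u F w w1 w2 r)"
proof -
  let ?H = "\<lambda>t. integral {r..1 - r} (\<lambda>x. u x t * w x)" and ?G = "weak_flux a u F w w1 w2 r"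
  have H: "continuous_on {0..t} (\<lambda>s. (\<lambda>(r, t). integral {r..1 - r} (\<lambda>x. u x t * w x)) (r, s))"
    by (rule continuous_on_compose2[OF mean_continuous]) (use r t in \<open>auto intro!: continuous_intros\<close>)
  have G: "continuous_on {0..t} ?G"
    by (rule continuous_on_subset[OF weak_flux_continuous_time]) (use r t in auto)
  have "?H t - ?H 0 - integral {0..t} ?G = 0"
  proof (rule continuous_zero_at_left_end[of t "\<lambda>s. ?H t - ?H s - integral {s..t} ?G"])
    show "continuous_on {0..t} (\<lambda>s. ?H t - ?H s - integral {s..t} ?G)"
      using H by (intro continuous_intros indefinite_integral_continuous_1' integrable_continuous_interval G) simp
    show "?H t - ?H s - integral {s..t} ?G = 0" if "0 < s" "s \<le> t" for s
      using weak_form_interior[OF r that t(2)] by simp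
  qed (use t in auto)
  then show ?thesis by simp
qed

lemma weak_form:
  assumes t: "t \<in> {0..T}"
  shows "integral {0..1} (\<lambda>x. u x t * w x) - integral {0..1} (\<lambda>x. u x 0 * w x)
    = integral {0..t} (weak_flux a u F w w1 w2 0)"
proof (cases "t = 0")
  case False
  then have t0: "0 < t" using t by auto
  let ?H = "\<lambda>t r. integral {r..1 - r} (\<lambda>x. u x t * w x)" and ?G = "weak_flux a u F w w1 w2"
  have H: "continuous_on {0..1/4} (?H s)" if "s \<in> {0..T}" for s
  proof -
    have "continuous_on {0..1/4} (\<lambda>r. (\<lambda>(r, t). integral {r..1 - r} (\<lambda>x. u x t * w x)) (r, s))"
      by (rule continuous_on_compose2[OF mean_continuous]) (use that in \<open>auto intro!: continuous_intros\<close>)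
    then show ?thesis by simp
  qed
  have "continuous_on ({0..1/4} \<times> cbox 0 t) (\<lambda>(r, t). ?G r t)"
    by (rule continuous_on_subset[OF weak_flux_continuous]) (use t in auto)
  from integral_continuous_on_param[OF this]
  have G: "continuous_on {0..1/4} (\<lambda>r. integral {0..t} (?G r))" by simp
  have "?H t 0 - ?H 0 0 - integral {0..t} (?G 0) = 0"
  proof (rule continuous_zero_at_left_end[of "1/4" "\<lambda>r. ?H t r - ?H 0 r - integral {0..t} (?G r)"])
    show "continuous_on {0..1/4} (\<lambda>r. ?H t r - ?H 0 r - integral {0..t} (?G r))"
      using t T by (intro continuous_intros H G) auto
    show "?H t r - ?H 0 r - integral {0..t} (?G r) = 0" if "0 < r" "r \<le> 1/4" for r
      using weak_form_shrunk[OF that t0] t by simp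
  qed simp
  then show ?thesis by simp
qed simp

lemma weak_form_derivative:
  assumes t: "t \<in> {0..T}"
  shows "((\<lambda>t. integral {0..1} (\<lambda>x. u x t * w x)) has_vector_derivative weak_flux a u F w w1 w2 0 t)
    (at t within {0..T})"
proof (rule has_vector_derivative_transform[OF t])
  show "integral {0..1} (\<lambda>x. u x s * w x)
      = integral {0..1} (\<lambda>x. u x 0 * w x) + integral {0..s} (weak_flux a u F w w1 w2 0)"
    if "s \<in> {0..T}" for s using weak_form[OF that] by simp
  have "((\<lambda>t. integral {0..t} (weak_flux a u F w w1 w2 0)) has_vector_derivative weak_flux a u F w w1 w2 0 t)
      (at t within {0..T})"
    by (rule integral_has_vector_derivative[OF weak_flux_continuous_time t]) simp
  from has_vector_derivative_add[OF has_vector_derivative_const this]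
  show "((\<lambda>t. integral {0..1} (\<lambda>x. u x 0 * w x) + integral {0..t} (weak_flux a u F w w1 w2 0))
      has_vector_derivative weak_flux a u F w w1 w2 0 t) (at t within {0..T})" by simp
qed

end

section \<open>One solution: coefficients and positivity of the boundary slope\<close>

lemma weak_flux_at_0:
  "weak_flux a u F w w1 w2 0 t =
     a t * ((x_deriv {0..1} 1 u 1 t * w 1 - u 1 t * w1 1) - (x_deriv {0..1} 1 u 0 t * w 0 - u 0 t * w1 0))
     + a t * integral {0..1} (\<lambda>x. u x t * w2 x) + integral {0..1} (\<lambda>x. F x t * w x)"
  by (simp add: weak_flux_def distrib_left)

text \<open>Fixes the parameters on which all constants below depend: the final time, an upper bound for the
  data, and a lower bound for the margin and for one distinguished sine coefficient of the initial
  value.  Data close to given admissible data belong to the same class.\<close>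

locale data_class =
  fixes T K \<kappa> :: real and k :: nat
  assumes T_pos: "0 < T" and K_nonneg: "0 \<le> K" and kappa_pos: "0 < \<kappa>"

locale bounded_solution = data_class +
  fixes \<phi> :: "real \<Rightarrow> real" and F :: "real \<Rightarrow> real \<Rightarrow> real" and E :: "real \<Rightarrow> real"
    and a :: "real \<Rightarrow> real" and u :: "real \<Rightarrow> real \<Rightarrow> real"
  assumes admissible: "admissible_data T \<phi> F E"
    and solution: "classical_solution T \<phi> F E a u"
    and phi_bounds: "\<And>n. \<bar>sine_coeff \<phi> n\<bar> \<le> K / freq n ^ 4" "\<And>n. \<bar>xcos_coeff \<phi> n\<bar> \<le> 4 * K / freq n ^ 3"
    and F_bounds: "\<And>n t. t \<in> {0..T} \<Longrightarrow> \<bar>sine_coeff (\<lambda>x. F x t) n\<bar> \<le> K / freq n ^ 4"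
      "\<And>n t. t \<in> {0..T} \<Longrightarrow> \<bar>xcos_coeff (\<lambda>x. F x t) n\<bar> \<le> 4 * K / freq n ^ 3"
      "\<And>t. t \<in> {0..T} \<Longrightarrow> \<bar>integral {0..1} (\<lambda>x. F x t)\<bar> \<le> K"
    and E_bound: "\<And>t. t \<in> {0..T} \<Longrightarrow> \<bar>nth_deriv_on {0..T} 1 E t\<bar> \<le> K"
    and margin_bound: "\<kappa> \<le> margin T \<phi> F E" and phi_coeff_bound: "\<kappa> \<le> sine_coeff \<phi> k"
begin

definition A :: "real \<Rightarrow> real" where "A t = integral {0..t} a"

definition slope :: "real \<Rightarrow> real" where "slope t = x_deriv {0..1} 1 u 0 t"

lemma a_continuous: "continuous_on {0..T} a"
  using solution unfolding classical_solution_def by blast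

lemma a_pos: "t \<in> {0..T} \<Longrightarrow> 0 < a t"
  using solution unfolding classical_solution_def by blast

lemma A_0: "A 0 = 0"
  by (simp add: A_def)

lemma A_continuous: "continuous_on {0..T} A"
  unfolding A_def by (intro indefinite_integral_continuous_1 integrable_continuous_interval a_continuous)

lemma A_increment:
  assumes "0 \<le> s" "s \<le> r" "r \<le> T"
  shows "(a has_integral A r - A s) {s..r}"
proof -
  have i: "a integrable_on {0..r}" "a integrable_on {s..r}"
    using assms by (auto intro!: integrable_continuous_interval continuous_on_subset[OF a_continuous])
  have "A s + integral {s..r} a = A r"
    unfolding A_def by (rule Henstock_Kurzweil_Integration.integral_combine) (use assms i in auto)
  then have "A r - A s = integral {s..r} a" by simp
  then show ?thesis using i(2) by (simp add: integrable_integral)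
qed

lemma A_mono: "0 \<le> s \<Longrightarrow> s \<le> r \<Longrightarrow> r \<le> T \<Longrightarrow> A s \<le> A r"
  using has_integral_nonneg[OF A_increment[of s r]] a_pos less_imp_le[of 0 "a _"] by auto

lemma u_continuous: "continuous_on ({0..1} \<times> {0..T}) (\<lambda>(x, t). u x t)"
  by (rule classical_solution_regularity(1)[OF T_pos solution])

lemma u_slice_continuous:
  assumes "t \<in> {0..T}"
  shows "continuous_on {0..1} (\<lambda>x. u x t)"
proof -
  have "continuous_on {0..1} (\<lambda>x. (\<lambda>(x, t). u x t) (x, t))"
    by (rule continuous_on_compose2[OF u_continuous]) (use assms in \<open>auto intro!: continuous_intros\<close>)
  then show ?thesis by simp
qed

lemma u_boundary: "t \<in> {0..T} \<Longrightarrow> u 0 t = u 1 t" "t \<in> {0..T} \<Longrightarrow> x_deriv {0..1} 1 u 1 t = 0"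
  using solution unfolding classical_solution_def by auto

lemma u_initial: "integral {0..1} (\<lambda>x. u x 0 * w x) = integral {0..1} (\<lambda>x. \<phi> x * w x)"
  by (rule integral_cong) (use solution in \<open>auto simp: classical_solution_def\<close>)

lemma u_mean: "t \<in> {0..T} \<Longrightarrow> integral {0..1} (\<lambda>x. u x t) = E t"
  using solution unfolding classical_solution_def by blast

lemmas weak = weak_form_derivative[OF T_pos solution admissible_source_continuous[OF admissible]]

lemma coeff_continuous: "continuous_on {0..T} (\<lambda>t. sine_coeff (\<lambda>x. u x t) n)"
  unfolding sine_coeff_def
  by (intro continuous_on_weighted_mean[OF u_continuous] continuous_intros)

text \<open>The test function vanishes at both end points and its derivative takes equal values there, so
  \<open>u(0,t) = u(1,t)\<close> removes the boundary terms.\<close>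

lemma sine_coeff_formula:
  assumes t: "t \<in> {0..T}"
  shows "sine_coeff (\<lambda>x. u x t) n
    = duhamel ((freq n)\<^sup>2) A (sine_coeff \<phi> n) (\<lambda>s. sine_coeff (\<lambda>x. F x s) n) t"
proof -
  have "((\<lambda>t. sine_coeff (\<lambda>x. u x t) n) has_vector_derivative
      sine_coeff (\<lambda>x. F x t) n - (freq n)\<^sup>2 * a t * sine_coeff (\<lambda>x. u x t) n) (at t within {0..T})"
    if t: "t \<in> {0..T}" for t
  proof -
    have "((\<lambda>t. integral {0..1} (\<lambda>x. u x t * sin (freq n * x))) has_vector_derivative
        weak_flux a u F (\<lambda>x. sin (freq n * x)) (\<lambda>x. freq n * cos (freq n * x))
          (\<lambda>x. - (freq n)\<^sup>2 * sin (freq n * x)) 0 t) (at t within {0..T})"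
    proof (rule weak[OF _ _ _ t])
      show "continuous_on {0..1} (\<lambda>x. - (freq n)\<^sup>2 * sin (freq n * x))" by (intro continuous_intros)
    qed (auto intro!: derivative_eq_intros
        simp: power2_eq_square simp flip: has_real_derivative_iff_has_vector_derivative)
    moreover have "weak_flux a u F (\<lambda>x. sin (freq n * x)) (\<lambda>x. freq n * cos (freq n * x))
          (\<lambda>x. - (freq n)\<^sup>2 * sin (freq n * x)) 0 t
        = sine_coeff (\<lambda>x. F x t) n - (freq n)\<^sup>2 * a t * sine_coeff (\<lambda>x. u x t) n"
    proof -
      have "integral {0..1} (\<lambda>x. u x t * (- (freq n)\<^sup>2 * sin (freq n * x)))
          = - (freq n)\<^sup>2 * sine_coeff (\<lambda>x. u x t) n"
        unfolding sine_coeff_def integral_mult_right[symmetric] by (simp only: mult_ac)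
      then show ?thesis
        using u_boundary[OF t] unfolding weak_flux_def
        by (simp add: sin_freq cos_freq sine_coeff_def[of "\<lambda>x. F x t"])
    qed
    ultimately show ?thesis by (simp add: sine_coeff_def)
  qed
  from duhamel_unique[OF a_continuous admissible_coeffs_continuous(1)[OF admissible] this t]
  show ?thesis unfolding A_def[abs_def] using u_initial by (simp add: sine_coeff_def)
qed

lemma xcos_source_continuous:
  "continuous_on {0..T} (\<lambda>s. xcos_coeff (\<lambda>x. F x s) n - 2 * freq n * a s * sine_coeff (\<lambda>x. u x s) n)"
  by (intro continuous_intros admissible_coeffs_continuous[OF admissible] a_continuous coeff_continuous)

text \<open>The second derivative of \<open>x cos (\<mu> x)\<close> contains \<open>-2 \<mu> sin (\<mu> x)\<close>, which couples this coefficient to the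
  sine coefficient: the latter acts as an additional source.\<close>

lemma xcos_coeff_formula:
  assumes t: "t \<in> {0..T}"
  shows "xcos_coeff (\<lambda>x. u x t) n = duhamel ((freq n)\<^sup>2) A (xcos_coeff \<phi> n)
      (\<lambda>s. xcos_coeff (\<lambda>x. F x s) n - 2 * freq n * a s * sine_coeff (\<lambda>x. u x s) n) t"
proof -
  let ?w1 = "\<lambda>x. cos (freq n * x) - freq n * x * sin (freq n * x)"
  let ?w2 = "\<lambda>x. - 2 * freq n * sin (freq n * x) - (freq n)\<^sup>2 * (x * cos (freq n * x))"
  have "((\<lambda>t. xcos_coeff (\<lambda>x. u x t) n) has_vector_derivative
      xcos_coeff (\<lambda>x. F x t) n - 2 * freq n * a t * sine_coeff (\<lambda>x. u x t) n
        - (freq n)\<^sup>2 * a t * xcos_coeff (\<lambda>x. u x t) n) (at t within {0..T})"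
    if t: "t \<in> {0..T}" for t
  proof -
    have "((\<lambda>t. integral {0..1} (\<lambda>x. u x t * (x * cos (freq n * x)))) has_vector_derivative
        weak_flux a u F (\<lambda>x. x * cos (freq n * x)) ?w1 ?w2 0 t) (at t within {0..T})"
    proof (rule weak[OF _ _ _ t])
      show "continuous_on {0..1} ?w2" by (intro continuous_intros)
    qed (auto intro!: derivative_eq_intros
        simp: power2_eq_square algebra_simps simp flip: has_real_derivative_iff_has_vector_derivative)
    moreover have "weak_flux a u F (\<lambda>x. x * cos (freq n * x)) ?w1 ?w2 0 t
        = xcos_coeff (\<lambda>x. F x t) n - 2 * freq n * a t * sine_coeff (\<lambda>x. u x t) n
        - (freq n)\<^sup>2 * a t * xcos_coeff (\<lambda>x. u x t) n"
    proof -
      have i: "(\<lambda>x. u x t * sin (freq n * x)) integrable_on {0..1}"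
        "(\<lambda>x. u x t * (x * cos (freq n * x))) integrable_on {0..1}"
        by (intro integrable_continuous_interval continuous_intros u_slice_continuous t)+
      have "((\<lambda>x. - 2 * freq n * (u x t * sin (freq n * x)) - (freq n)\<^sup>2 * (u x t * (x * cos (freq n * x)))) has_integral
         - 2 * freq n * sine_coeff (\<lambda>x. u x t) n - (freq n)\<^sup>2 * xcos_coeff (\<lambda>x. u x t) n) {0..1}"
        unfolding sine_coeff_def xcos_coeff_def
        by (intro has_integral_diff has_integral_mult_right integrable_integral i)
      then have "integral {0..1} (\<lambda>x. u x t * ?w2 x)
          = - 2 * freq n * sine_coeff (\<lambda>x. u x t) n - (freq n)\<^sup>2 * xcos_coeff (\<lambda>x. u x t) n"
        by (intro integral_unique) (simp add: algebra_simps)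
      then show ?thesis
        unfolding weak_flux_at_0 using u_boundary[OF t]
        by (simp add: sin_freq cos_freq xcos_coeff_def[of "\<lambda>x. F x t"] right_diff_distrib)
    qed
    ultimately show ?thesis by (simp add: xcos_coeff_def)
  qed
  from duhamel_unique[OF a_continuous xcos_source_continuous this t]
  show ?thesis unfolding A_def[abs_def] using u_initial by (simp add: xcos_coeff_def)
qed

lemma x_moment_formula:
  assumes t: "t \<in> {0..T}"
  shows "x_moment (\<lambda>x. u x t) = x_moment \<phi> + integral {0..t} (\<lambda>s. x_moment (\<lambda>x. F x s))"
proof -
  have "((\<lambda>s. x_moment (\<lambda>x. F x s)) has_integral x_moment (\<lambda>x. u x t) - x_moment (\<lambda>x. u x 0)) {0..t}"
  proof (rule fundamental_theorem_of_calculus)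
    fix s assume s: "s \<in> {0..t}"
    then have sT: "s \<in> {0..T}" using t by auto
    have "((\<lambda>t. integral {0..1} (\<lambda>x. u x t * x)) has_vector_derivative
        weak_flux a u F (\<lambda>x. x) (\<lambda>x. 1) (\<lambda>x. 0) 0 s) (at s within {0..T})"
      by (rule weak[OF _ _ _ sT]) (auto intro!: derivative_eq_intros)
    then have "((\<lambda>t. x_moment (\<lambda>x. u x t)) has_vector_derivative x_moment (\<lambda>x. F x s)) (at s within {0..T})"
      using u_boundary[OF sT] by (simp add: weak_flux_def x_moment_def)
    then show "((\<lambda>t. x_moment (\<lambda>x. u x t)) has_vector_derivative x_moment (\<lambda>x. F x s)) (at s within {0..t})"
      by (rule has_vector_derivative_within_subset) (use t in auto)
  qed (use t in auto)
  moreover have "x_moment (\<lambda>x. u x 0) = x_moment \<phi>" unfolding x_moment_def by (rule u_initial)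
  ultimately show ?thesis by (simp add: integral_unique)
qed

text \<open>The equation integrated over space; the flux at the right end vanishes.  This is the relation that
  determines \<open>a\<close>.\<close>

lemma slope_formula:
  assumes t: "t \<in> {0..T}"
  shows "a t * slope t = integral {0..1} (\<lambda>x. F x t) - nth_deriv_on {0..T} 1 E t"
proof -
  have "((\<lambda>t. integral {0..1} (\<lambda>x. u x t * 1)) has_vector_derivative
      weak_flux a u F (\<lambda>x. 1) (\<lambda>x. 0) (\<lambda>x. 0) 0 t) (at t within {0..T})"
    by (rule weak[OF _ _ _ t]) (auto intro!: derivative_eq_intros)
  then have "((\<lambda>t. integral {0..1} (\<lambda>x. u x t)) has_vector_derivative
      integral {0..1} (\<lambda>x. F x t) - a t * slope t) (at t within {0..T})"
    using u_boundary[OF t] by (simp add: weak_flux_def slope_def)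
  then have "(E has_vector_derivative integral {0..1} (\<lambda>x. F x t) - a t * slope t) (at t within {0..T})"
    using has_vector_derivative_transform[OF t, of E "\<lambda>t. integral {0..1} (\<lambda>x. u x t)"] u_mean by metis
  then have "nth_deriv_on {0..T} 1 E t = integral {0..1} (\<lambda>x. F x t) - a t * slope t"
    using vector_derivative_within_closed_interval[OF T_pos t] by (simp add: nth_deriv_on_Suc)
  then show ?thesis by simp
qed

lemma sine_coeff_nonneg:
  assumes t: "t \<in> {0..T}"
  shows "0 \<le> sine_coeff (\<lambda>x. u x t) n"
  unfolding sine_coeff_formula[OF t]
  by (rule duhamel_nonneg[OF _ _ A_continuous admissible_coeffs_continuous(1)[OF admissible]])
     (use admissible_nonneg[OF admissible] t in auto)

lemma sine_coeff_bound: "\<bar>sine_coeff (\<lambda>x. u x t) n\<bar> \<le> (1 + T) * K / freq n ^ 4" if t: "t \<in> {0..T}"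
proof -
  have "\<bar>sine_coeff (\<lambda>x. u x t) n\<bar> \<le> K / freq n ^ 4 + T * (K / freq n ^ 4)"
    unfolding sine_coeff_formula[OF t]
    by (rule duhamel_bound[OF A_continuous admissible_coeffs_continuous(1)[OF admissible] t A_mono A_0 _ phi_bounds(1) F_bounds(1)]) auto
  then show ?thesis by (simp add: distrib_right add_divide_distrib)
qed

lemma sine_coeff_summable:
  assumes t: "t \<in> {0..T}"
  shows "summable (\<lambda>n. \<bar>sine_coeff (\<lambda>x. u x t) n\<bar>)" "summable (\<lambda>n. freq n * \<bar>sine_coeff (\<lambda>x. u x t) n\<bar>)"
proof -
  show "summable (\<lambda>n. \<bar>sine_coeff (\<lambda>x. u x t) n\<bar>)"
    by (rule summable_comparison_test[OF _ summable_inverse_freq_power[of 4 "(1 + T) * K"]])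
       (use sine_coeff_bound[OF t] in auto)
  have "freq n * \<bar>sine_coeff (\<lambda>x. u x t) n\<bar> \<le> (1 + T) * K / freq n ^ 3" for n
  proof -
    have "freq n * \<bar>sine_coeff (\<lambda>x. u x t) n\<bar> \<le> freq n * ((1 + T) * K / freq n ^ 4)"
      using freq_pos[of n] by (intro mult_left_mono sine_coeff_bound t) auto
    also have "\<dots> = (1 + T) * K / freq n ^ 3" using freq_pos[of n] by (simp add: numeral_eq_Suc)
    finally show ?thesis .
  qed
  then show "summable (\<lambda>n. freq n * \<bar>sine_coeff (\<lambda>x. u x t) n\<bar>)"
    by (intro summable_comparison_test[OF _ summable_inverse_freq_power[of 3 "(1 + T) * K"]])
       (use freq_pos in \<open>auto simp: abs_mult less_imp_le\<close>)
qed

lemma slope_series: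
  assumes t: "t \<in> {0..T}"
  shows "(\<lambda>n. 4 * freq n * sine_coeff (\<lambda>x. u x t) n) sums slope t"
proof -
  have "(\<lambda>n. 4 * freq n * sine_coeff (\<lambda>x. u x t) n) sums (x_deriv {0..1} 1 u 0 t + x_deriv {0..1} 1 u 1 t)"
    by (rule boundary_slope_series[of "\<lambda>x. u x t" "\<lambda>x. x_deriv {0..1} 1 u x t"])
       (fact classical_solution_regularity(3)[OF T_pos solution t] u_boundary(1)[OF t] sine_coeff_summable(2)[OF t])+
  then show ?thesis unfolding slope_def u_boundary(2)[OF t] by simp
qed

lemma mean_series:
  assumes t: "t \<in> {0..T}"
  shows "(\<lambda>n. 4 / freq n * sine_coeff (\<lambda>x. u x t) n) sums (E t - 2 * x_moment (\<lambda>x. u x t))"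
  unfolding u_mean[OF t, symmetric]
  by (rule mean_minus_moment_series[of "\<lambda>x. u x t"])
     (fact u_slice_continuous[OF t] u_boundary(1)[OF t] sine_coeff_summable(1)[OF t])+

text \<open>Since the coefficients are nonnegative and \<open>1/\<mu> \<le> \<mu>\<close>, the series for the slope dominates the one
  for \<open>E - 2 \<integral> x u\<close>, which is at least \<open>margin\<close>.\<close>

lemma slope_lower_bound:
  assumes t: "t \<in> {0..T}"
  shows "\<kappa> \<le> slope t"
proof -
  have "margin T \<phi> F E \<le> E t - 2 * x_moment (\<lambda>x. u x t)"
  proof -
    have "E T \<le> E t" using admissible_mass_antimono[OF admissible] t by auto
    moreover have "integral {0..t} (\<lambda>s. x_moment (\<lambda>x. F x s)) \<le> integral {0..T} (\<lambda>s. x_moment (\<lambda>x. F x s))"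
      using t admissible_nonneg(3)[OF admissible]
      by (intro integral_subset_le integrable_continuous_interval
          continuous_on_subset[OF admissible_coeffs_continuous(3)[OF admissible]]) auto
    ultimately show ?thesis unfolding margin_def x_moment_formula[OF t] by simp
  qed
  moreover have "E t - 2 * x_moment (\<lambda>x. u x t) \<le> slope t"
  proof (rule sums_le[OF _ mean_series[OF t] slope_series[OF t]])
    fix n
    have "1 / freq n \<le> 1" using freq_ge_1[of n] by simp
    then have "1 / freq n \<le> freq n" using freq_ge_1[of n] by linarith
    then show "4 / freq n * sine_coeff (\<lambda>x. u x t) n \<le> 4 * freq n * sine_coeff (\<lambda>x. u x t) n"
      using sine_coeff_nonneg[OF t] by (intro mult_right_mono) auto
  qed
  ultimately show ?thesis using margin_bound by linarith
qed

end

section \<open>Bounds for one solution and the distance of two elapsed diffusivities\<close>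

context data_class
begin

definition inv_freq_square_sum :: real where "inv_freq_square_sum = (\<Sum>n. 1 / freq n ^ 2)"

definition a_max :: real where "a_max = 2 * K / \<kappa>"

text \<open>Lipschitz constant of the elapsed diffusivity; the exponential compensates the largest possible
  damping of the distinguished coefficient.\<close>

definition C_path :: real where
  "C_path = (3 + 2 * T + 4 * (1 + T) * inv_freq_square_sum) * exp ((freq k)\<^sup>2 * (a_max * T)) / (4 * freq k * \<kappa>)"

definition C_sine :: real where
  "C_sine = (1 + T) * (1 + K * sqrt (2 * C_path))"

definition C_a :: real where
  "C_a = (2 + a_max * (4 * C_sine * inv_freq_square_sum)) / \<kappa>"

definition source_max :: real where
  "source_max = (4 + 2 * a_max * (1 + T)) * K"

definition C_xcos :: real where
  "C_xcos = (4 * K + T * source_max) * sqrt (2 * C_path)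
     + (4 + T * (4 + 2 * C_a * (1 + T) * K + 2 * a_max * C_sine))"

definition C_u :: real where
  "C_u = 2 * (1 + T) + 4 * (C_xcos + C_sine) * inv_freq_square_sum"

lemma inv_freq_square_sum_sums: "(\<lambda>n. c / freq n ^ 2) sums (c * inv_freq_square_sum)"
  using sums_mult[OF summable_sums[OF summable_inverse_freq_power[of 2 1]], of c] by (simp add: inv_freq_square_sum_def)

lemma inv_freq_square_sum_nonneg: "0 \<le> inv_freq_square_sum"
  unfolding inv_freq_square_sum_def by (intro suminf_nonneg summable_inverse_freq_power) auto

lemma a_max_nonneg: "0 \<le> a_max"
  using K_nonneg kappa_pos by (simp add: a_max_def)

lemma source_max_nonneg: "0 \<le> source_max"
  using K_nonneg T_pos a_max_nonneg by (simp add: source_max_def)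

lemma C_path_nonneg: "0 \<le> C_path"
  using inv_freq_square_sum_nonneg T_pos kappa_pos freq_pos[of k] by (simp add: C_path_def)

lemma C_sine_nonneg: "0 \<le> C_sine"
  using K_nonneg C_path_nonneg T_pos by (simp add: C_sine_def)

lemma C_a_nonneg: "0 \<le> C_a"
  using kappa_pos a_max_nonneg C_sine_nonneg inv_freq_square_sum_nonneg by (simp add: C_a_def)

lemma C_xcos_nonneg: "0 \<le> C_xcos"
  using K_nonneg source_max_nonneg C_path_nonneg T_pos C_a_nonneg a_max_nonneg C_sine_nonneg by (simp add: C_xcos_def)

end

lemma divide_freq_power_mono:
  assumes "0 \<le> c" "i \<le> j"
  shows "c / freq n ^ j \<le> c / freq n ^ i"
  using assms power_increasing[OF assms(2) freq_ge_1[of n]] freq_pos[of n]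
  by (intro divide_left_mono) auto

context bounded_solution
begin

lemma a_le: 
  assumes t: "t \<in> {0..T}"
  shows "a t \<le> a_max"
proof -
  have "a t * \<kappa> \<le> a t * slope t"
    using slope_lower_bound[OF t] a_pos[OF t] by (intro mult_left_mono) auto
  also have "\<dots> \<le> 2 * K"
    unfolding slope_formula[OF t] using F_bounds(3)[OF t] E_bound[OF t] by linarith
  finally show ?thesis using kappa_pos by (simp add: a_max_def pos_le_divide_eq)
qed

lemma A_le:
  assumes t: "t \<in> {0..T}"
  shows "A t \<le> a_max * T"
proof -
  have "\<bar>integral {0..t} a\<bar> \<le> T * a_max"
    by (rule integral_le_length_times_bound)
       (use t a_le a_pos in \<open>auto intro!: integrable_continuous_interval continuous_on_subset[OF a_continuous] simp: abs_of_pos\<close>)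
  then show ?thesis by (simp add: A_def mult.commute)
qed

lemma xcos_source_bound:
  assumes t: "t \<in> {0..T}"
  shows "\<bar>xcos_coeff (\<lambda>x. F x t) n - 2 * freq n * a t * sine_coeff (\<lambda>x. u x t) n\<bar> \<le> source_max / freq n ^ 3"
proof -
  have "\<bar>2 * freq n * a t * sine_coeff (\<lambda>x. u x t) n\<bar> = (2 * freq n * a t) * \<bar>sine_coeff (\<lambda>x. u x t) n\<bar>"
    using freq_pos[of n] a_pos[OF t] by (simp add: abs_mult)
  also have "\<dots> \<le> (2 * freq n * a_max) * ((1 + T) * K / freq n ^ 4)"
    using freq_pos[of n] a_pos[OF t] a_le[OF t] sine_coeff_bound[OF t] a_max_nonneg
    by (intro mult_mono) auto
  also have "\<dots> = 2 * a_max * (1 + T) * K / freq n ^ 3"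
    using freq_pos[of n] by (simp add: numeral_eq_Suc)
  finally have "\<bar>2 * freq n * a t * sine_coeff (\<lambda>x. u x t) n\<bar> \<le> 2 * a_max * (1 + T) * K / freq n ^ 3" .
  moreover have "\<bar>xcos_coeff (\<lambda>x. F x t) n\<bar> \<le> 4 * K / freq n ^ 3" by (rule F_bounds(2)[OF t])
  moreover have "source_max / freq n ^ 3 = 4 * K / freq n ^ 3 + 2 * a_max * (1 + T) * K / freq n ^ 3"
    by (simp add: source_max_def distrib_right add_divide_distrib)
  ultimately show ?thesis by linarith
qed

lemma xcos_coeff_summable:
  assumes t: "t \<in> {0..T}"
  shows "summable (\<lambda>n. \<bar>xcos_coeff (\<lambda>x. u x t) n\<bar>)"
proof (rule summable_comparison_test[OF _ summable_inverse_freq_power[of 3 "4 * K + T * source_max"]])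
  have "\<bar>xcos_coeff (\<lambda>x. u x t) n\<bar> \<le> 4 * K / freq n ^ 3 + T * (source_max / freq n ^ 3)" for n
    unfolding xcos_coeff_formula[OF t]
    by (rule duhamel_bound[OF A_continuous xcos_source_continuous t A_mono A_0 _ phi_bounds(2) xcos_source_bound]) auto
  then show "\<exists>N. \<forall>n\<ge>N. norm \<bar>xcos_coeff (\<lambda>x. u x t) n\<bar> \<le> (4 * K + T * source_max) / freq n ^ 3"
    by (simp add: add_divide_distrib)
qed simp

lemma u_series:
  assumes t: "t \<in> {0..T}" and x: "x \<in> {0..1}"
  shows "(\<lambda>n. 4 * xcos_coeff (\<lambda>x. u x t) n * cos (freq n * x)
      + 4 * (1 - x) * sine_coeff (\<lambda>x. u x t) n * sin (freq n * x)) sums (u x t - 2 * x_moment (\<lambda>x. u x t))"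
  by (rule ionkin_series[of "\<lambda>x. u x t"])
     (fact u_slice_continuous[OF t] u_boundary(1)[OF t] sine_coeff_summable(1)[OF t] xcos_coeff_summable[OF t] x)+

end

text \<open>The distance \<open>\<delta>\<close> of the data is measured by exactly those quantities that enter the estimates.\<close>

locale two_solutions =
  S: bounded_solution T K \<kappa> k \<phi> F E a u + S': bounded_solution T K \<kappa> k \<phi>' F' E' a' u'
  for T K \<kappa> :: real and k :: nat and \<phi> F E a u \<phi>' F' E' a' u' +
  fixes \<delta> :: real
  assumes delta: "0 \<le> \<delta>" "\<delta> \<le> 1"
    and phi_close: "\<And>n. \<bar>sine_coeff \<phi> n - sine_coeff \<phi>' n\<bar> \<le> \<delta> / freq n ^ 4"
      "\<And>n. \<bar>xcos_coeff \<phi> n - xcos_coeff \<phi>' n\<bar> \<le> 4 * \<delta> / freq n ^ 3"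
      "\<bar>x_moment \<phi> - x_moment \<phi>'\<bar> \<le> \<delta>"
    and F_close: "\<And>n t. t \<in> {0..T} \<Longrightarrow> \<bar>sine_coeff (\<lambda>x. F x t) n - sine_coeff (\<lambda>x. F' x t) n\<bar> \<le> \<delta> / freq n ^ 4"
      "\<And>n t. t \<in> {0..T} \<Longrightarrow> \<bar>xcos_coeff (\<lambda>x. F x t) n - xcos_coeff (\<lambda>x. F' x t) n\<bar> \<le> 4 * \<delta> / freq n ^ 3"
      "\<And>t. t \<in> {0..T} \<Longrightarrow> \<bar>x_moment (\<lambda>x. F x t) - x_moment (\<lambda>x. F' x t)\<bar> \<le> \<delta>"
      "\<And>t. t \<in> {0..T} \<Longrightarrow> \<bar>integral {0..1} (\<lambda>x. F x t) - integral {0..1} (\<lambda>x. F' x t)\<bar> \<le> \<delta>"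
    and E_close: "\<And>t. t \<in> {0..T} \<Longrightarrow> \<bar>E t - E' t\<bar> \<le> \<delta>"
      "\<And>t. t \<in> {0..T} \<Longrightarrow> \<bar>nth_deriv_on {0..T} 1 E t - nth_deriv_on {0..T} 1 E' t\<bar> \<le> \<delta>"
begin

abbreviation "s n t \<equiv> sine_coeff (\<lambda>x. u x t) n"
abbreviation "s' n t \<equiv> sine_coeff (\<lambda>x. u' x t) n"
abbreviation "Fs n t \<equiv> sine_coeff (\<lambda>x. F x t) n"
abbreviation "Fs' n t \<equiv> sine_coeff (\<lambda>x. F' x t) n"

lemmas Fs_continuous = admissible_coeffs_continuous(1)[OF S.admissible]
lemmas Fs'_continuous = admissible_coeffs_continuous(1)[OF S'.admissible]

text \<open>One-sided estimates become two-sided by exchanging the roles of the solutions.\<close>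

lemma swapped: "two_solutions T K \<kappa> k \<phi>' F' E' a' u' \<phi> F E a u \<delta>"
  by unfold_locales (use delta phi_close F_close E_close in \<open>simp_all add: abs_minus_commute\<close>)

lemma moment_gap:
  assumes t: "t \<in> {0..T}"
  shows "\<bar>x_moment (\<lambda>x. u x t) - x_moment (\<lambda>x. u' x t)\<bar> \<le> (1 + T) * \<delta>"
proof -
  have i: "(\<lambda>s. x_moment (\<lambda>x. F x s)) integrable_on {0..t}" "(\<lambda>s. x_moment (\<lambda>x. F' x s)) integrable_on {0..t}"
    using t by (auto intro!: integrable_continuous_interval
        continuous_on_subset[OF admissible_coeffs_continuous(3)[OF S.admissible]]
        continuous_on_subset[OF admissible_coeffs_continuous(3)[OF S'.admissible]])
  have "\<bar>integral {0..t} (\<lambda>s. x_moment (\<lambda>x. F x s) - x_moment (\<lambda>x. F' x s))\<bar> \<le> T * \<delta>"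
    by (rule integral_le_length_times_bound[OF integrable_diff[OF i]]) (use t F_close(3) in auto)
  then show ?thesis
    unfolding S.x_moment_formula[OF t] S'.x_moment_formula[OF t] integral_diff[OF i]
    using phi_close(3) by (simp add: distrib_right)
qed

text \<open>The hybrid coefficient, with the initial value and source of the first data and the diffusivity of
  the second solution, separates the effect of the data from that of the diffusivity.\<close>

lemma duhamel_data_gap:
  assumes t: "t \<in> {0..T}"
  shows "\<bar>duhamel ((freq n)\<^sup>2) S'.A (sine_coeff \<phi> n) (Fs n) t - s' n t\<bar> \<le> (1 + T) * \<delta> / freq n ^ 4"
proof -
  have "\<bar>duhamel ((freq n)\<^sup>2) S'.A (sine_coeff \<phi> n - sine_coeff \<phi>' n) (\<lambda>s. Fs n s - Fs' n s) t\<bar>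
      \<le> \<delta> / freq n ^ 4 + T * (\<delta> / freq n ^ 4)"
    by (rule duhamel_bound[OF S'.A_continuous _ t S'.A_mono S'.A_0 _ phi_close(1) F_close(1)])
       (auto intro!: continuous_intros Fs_continuous Fs'_continuous)
  then show ?thesis
    unfolding S'.sine_coeff_formula[OF t] duhamel_diff_data[OF S'.A_continuous Fs_continuous Fs'_continuous t]
    by (simp add: distrib_right add_divide_distrib)
qed

text \<open>At a maximum of \<open>A - A'\<close> the hybrid coefficients are all at least those of the first solution, and
  the distinguished one exceeds it by an amount proportional to the maximum.  Summed with weights
  \<open>4/\<mu>\<close>, the coefficients give a quantity known from the data, so this excess is of the order of \<open>\<delta>\<close>.\<close>

lemma path_gap_upper:
  assumes t: "t \<in> {0..T}"
  shows "S.A t - S'.A t \<le> S.C_path * \<delta>"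
proof -
  have "continuous_on {0..T} (\<lambda>t. S.A t - S'.A t)"
    by (intro continuous_intros S.A_continuous S'.A_continuous)
  then obtain t1 where t1: "t1 \<in> {0..T}" and max: "\<And>r. r \<in> {0..T} \<Longrightarrow> S.A r - S'.A r \<le> S.A t1 - S'.A t1"
    using continuous_attains_sup[of "{0..T}" "\<lambda>t. S.A t - S'.A t"] S.T_pos by fastforce
  \<comment> \<open>Both paths start at \<open>0\<close>, so the maximum is nonnegative.\<close>
  define \<beta> where "\<beta> = S.A t1 - S'.A t1"
  have \<beta>: "0 \<le> \<beta>" using max[of 0] S.A_0 S'.A_0 S.T_pos by (simp add: \<beta>_def)
  define gain where "gain = (\<lambda>n. exp (- (freq n)\<^sup>2 * S'.A t1) - exp (- (freq n)\<^sup>2 * S.A t1))"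
  have gain: "0 \<le> gain n" for n
    using \<beta> by (simp add: gain_def \<beta>_def mult_left_mono)
  have diff: "sine_coeff \<phi> n * gain n - (1 + T) * \<delta> / freq n ^ 4 \<le> s' n t1 - s n t1" for n
  proof -
    have "sine_coeff \<phi> n * gain n
        \<le> duhamel ((freq n)\<^sup>2) S'.A (sine_coeff \<phi> n) (Fs n) t1 - duhamel ((freq n)\<^sup>2) S.A (sine_coeff \<phi> n) (Fs n) t1"
      unfolding gain_def
      by (rule duhamel_antimono_path[OF S.A_continuous S'.A_continuous Fs_continuous t1])
         (use max t1 admissible_nonneg(2)[OF S.admissible] in auto)
    then show ?thesis
      using duhamel_data_gap[OF t1, of n] unfolding S.sine_coeff_formula[OF t1] by linarith
  qed
  have termwise: "(if n = k then 4 / freq k * (\<kappa> * gain k) else 0)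
      \<le> (4 / freq n * s' n t1 - 4 / freq n * s n t1) + 4 * (1 + T) * \<delta> / freq n ^ 2" for n
  proof -
    have "4 / freq n * ((1 + T) * \<delta> / freq n ^ 4) = 4 * (1 + T) * \<delta> / freq n ^ 5"
      using freq_pos[of n] by (simp add: numeral_eq_Suc)
    also have "\<dots> \<le> 4 * (1 + T) * \<delta> / freq n ^ 2"
      using delta S.T_pos by (intro divide_freq_power_mono) auto
    finally have "4 / freq n * ((1 + T) * \<delta> / freq n ^ 4) \<le> 4 * (1 + T) * \<delta> / freq n ^ 2" .
    moreover have "4 / freq n * (sine_coeff \<phi> n * gain n - (1 + T) * \<delta> / freq n ^ 4)
        \<le> 4 / freq n * (s' n t1 - s n t1)"
      using freq_pos[of n] by (intro mult_left_mono diff) auto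
    moreover have "(if n = k then 4 / freq k * (\<kappa> * gain k) else 0) \<le> 4 / freq n * (sine_coeff \<phi> n * gain n)"
    proof (cases "n = k")
      case True
      have "\<kappa> * gain k \<le> sine_coeff \<phi> k * gain k" by (intro mult_right_mono S.phi_coeff_bound gain)
      then show ?thesis using True freq_pos[of k] by (simp add: mult_left_mono divide_right_mono)
    next
      case False
      then show ?thesis using freq_pos[of n] gain[of n] admissible_nonneg(1)[OF S.admissible] by simp
    qed
    ultimately show ?thesis by (simp add: right_diff_distrib)
  qed
  have "4 / freq k * (\<kappa> * gain k)
      \<le> ((E' t1 - 2 * x_moment (\<lambda>x. u' x t1)) - (E t1 - 2 * x_moment (\<lambda>x. u x t1))) + 4 * (1 + T) * \<delta> * S.inv_freq_square_sum"
    by (rule sums_le[OF termwise sums_single sums_add[OF sums_diff[OF S'.mean_series[OF t1] S.mean_series[OF t1]] S.inv_freq_square_sum_sums]])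
  also have "\<dots> \<le> (3 + 2 * T) * \<delta> + 4 * (1 + T) * \<delta> * S.inv_freq_square_sum"
    using moment_gap[OF t1] E_close(1)[OF t1] by (simp add: distrib_right)
  finally have le: "4 / freq k * (\<kappa> * gain k) \<le> (3 + 2 * T + 4 * (1 + T) * S.inv_freq_square_sum) * \<delta>"
    by (simp add: algebra_simps)
  \<comment> \<open>The excess is \<open>exp (-\<mu>\<^sup>2 A) (exp (\<mu>\<^sup>2 \<beta>) - 1)\<close>; the upper bound for \<open>A\<close> limits the damping.\<close>
  let ?e = "exp ((freq k)\<^sup>2 * (S.a_max * T))"
  have "(freq k)\<^sup>2 * \<beta> \<le> gain k * ?e"
  proof -
    have "(freq k)\<^sup>2 * \<beta> \<le> exp ((freq k)\<^sup>2 * \<beta>) - 1" using exp_ge_add_one_self[of "(freq k)\<^sup>2 * \<beta>"] by linarith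
    also have "\<dots> = gain k * exp ((freq k)\<^sup>2 * S.A t1)"
      by (simp add: gain_def \<beta>_def left_diff_distrib right_diff_distrib exp_diff exp_minus field_simps)
    also have "\<dots> \<le> gain k * ?e"
      by (intro mult_left_mono gain) (use S.A_le[OF t1] in \<open>simp add: mult_left_mono\<close>)
    finally show ?thesis .
  qed
  then have "4 / freq k * \<kappa> * ((freq k)\<^sup>2 * \<beta>) \<le> 4 / freq k * \<kappa> * (gain k * ?e)"
    using freq_pos[of k] S.kappa_pos by (intro mult_left_mono) auto
  also have "\<dots> = (4 / freq k * (\<kappa> * gain k)) * ?e" by simp
  also have "\<dots> \<le> ((3 + 2 * T + 4 * (1 + T) * S.inv_freq_square_sum) * \<delta>) * ?e" by (intro mult_right_mono le) simp
  finally have "4 * freq k * \<kappa> * \<beta> \<le> (3 + 2 * T + 4 * (1 + T) * S.inv_freq_square_sum) * ?e * \<delta>"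
    using freq_pos[of k] by (simp add: power2_eq_square mult_ac)
  then have "\<beta> \<le> S.C_path * \<delta>"
    using freq_pos[of k] S.kappa_pos by (simp add: S.C_path_def pos_le_divide_eq mult_ac)
  then show ?thesis using max[OF t] by (simp add: \<beta>_def)
qed

end

section \<open>Distance of two solutions\<close>

lemma abs_sums_le:
  fixes f g :: "nat \<Rightarrow> real"
  assumes "\<And>n. \<bar>f n\<bar> \<le> g n" "f sums a" "g sums b"
  shows "\<bar>a\<bar> \<le> b"
proof -
  have "a \<le> b" using assms(1) by (intro sums_le[OF _ assms(2,3)]) (simp add: abs_le_iff)
  moreover have "- a \<le> b" using assms(1) by (intro sums_le[OF _ sums_minus[OF assms(2)] assms(3)]) (simp add: abs_le_iff)
  ultimately show ?thesis by simp
qed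

context two_solutions
begin

abbreviation "c n t \<equiv> xcos_coeff (\<lambda>x. u x t) n"
abbreviation "c' n t \<equiv> xcos_coeff (\<lambda>x. u' x t) n"

lemma path_gap:
  assumes t: "t \<in> {0..T}"
  shows "\<bar>S.A t - S'.A t\<bar> \<le> S.C_path * \<delta>"
proof -
  interpret swap: two_solutions T K \<kappa> k \<phi>' F' E' a' u' \<phi> F E a u \<delta>
    by (rule swapped)
  show ?thesis using path_gap_upper[OF t] swap.path_gap_upper[OF t] by linarith
qed

lemma delta_le_sqrt: "\<delta> \<le> sqrt \<delta>"
proof -
  have "\<delta> * \<delta> \<le> 1 * \<delta>" using delta by (intro mult_right_mono) auto
  then show ?thesis by (intro real_le_rsqrt) (simp add: power2_eq_square)
qed

lemma sqrt_path_gap: "sqrt (2 * (freq n)\<^sup>2 * (S.C_path * \<delta>)) = freq n * (sqrt (2 * S.C_path) * sqrt \<delta>)"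
  using freq_pos[of n] by (simp add: real_sqrt_mult)

text \<open>The two terms are the effect of the diffusivity and that of the data; multiplied by
  \<open>\<mu>\<close>, as in the slope series, the bound still has the convergent sum of \<open>1/\<mu>\<^sup>2\<close>.\<close>

lemma sine_gap:
  assumes t: "t \<in> {0..T}"
  shows "\<bar>s n t - s' n t\<bar> \<le> S.C_sine * sqrt \<delta> / freq n ^ 3"
proof -
  have "\<bar>s n t - duhamel ((freq n)\<^sup>2) S'.A (sine_coeff \<phi> n) (Fs n) t\<bar>
      \<le> (K / freq n ^ 4 + T * (K / freq n ^ 4)) * sqrt (2 * (freq n)\<^sup>2 * (S.C_path * \<delta>))"
    unfolding S.sine_coeff_formula[OF t]
    by (rule duhamel_diff_path[OF S.A_continuous S'.A_continuous Fs_continuous t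
          S.A_mono S.A_0 S'.A_mono S'.A_0 _ S.phi_bounds(1) S.F_bounds(1) path_gap]) auto
  also have "\<dots> = (1 + T) * (K * sqrt (2 * S.C_path)) * sqrt \<delta> / freq n ^ 3"
    unfolding sqrt_path_gap using freq_pos[of n] by (simp add: numeral_eq_Suc field_simps)
  finally have 1: "\<bar>s n t - duhamel ((freq n)\<^sup>2) S'.A (sine_coeff \<phi> n) (Fs n) t\<bar>
      \<le> (1 + T) * (K * sqrt (2 * S.C_path)) * sqrt \<delta> / freq n ^ 3" .
  have "(1 + T) * \<delta> / freq n ^ 4 \<le> (1 + T) * \<delta> / freq n ^ 3"
    using delta S.T_pos by (intro divide_freq_power_mono) auto
  also have "\<dots> \<le> (1 + T) * sqrt \<delta> / freq n ^ 3"
    using delta_le_sqrt S.T_pos freq_pos[of n] by (intro divide_right_mono mult_left_mono) auto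
  finally have "\<bar>duhamel ((freq n)\<^sup>2) S'.A (sine_coeff \<phi> n) (Fs n) t - s' n t\<bar> \<le> (1 + T) * sqrt \<delta> / freq n ^ 3"
    using duhamel_data_gap[OF t, of n] by linarith
  moreover have "S.C_sine * sqrt \<delta> / freq n ^ 3
      = (1 + T) * (K * sqrt (2 * S.C_path)) * sqrt \<delta> / freq n ^ 3 + (1 + T) * sqrt \<delta> / freq n ^ 3"
    by (simp add: S.C_sine_def distrib_left distrib_right add_divide_distrib)
  ultimately show ?thesis using 1 by linarith
qed

lemma slope_gap:
  assumes t: "t \<in> {0..T}"
  shows "\<bar>S.slope t - S'.slope t\<bar> \<le> 4 * S.C_sine * S.inv_freq_square_sum * sqrt \<delta>"
proof -
  have "\<bar>4 * freq n * s n t - 4 * freq n * s' n t\<bar> \<le> 4 * S.C_sine * sqrt \<delta> / freq n ^ 2" for n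
  proof -
    have "\<bar>4 * freq n * s n t - 4 * freq n * s' n t\<bar> = 4 * freq n * \<bar>s n t - s' n t\<bar>"
      using freq_pos[of n] by (simp add: abs_mult flip: right_diff_distrib)
    also have "\<dots> \<le> 4 * freq n * (S.C_sine * sqrt \<delta> / freq n ^ 3)"
      using freq_pos[of n] by (intro mult_left_mono sine_gap t) auto
    also have "\<dots> = 4 * S.C_sine * sqrt \<delta> / freq n ^ 2"
      using freq_pos[of n] by (simp add: numeral_eq_Suc)
    finally show ?thesis .
  qed
  then have "\<bar>S.slope t - S'.slope t\<bar> \<le> 4 * S.C_sine * sqrt \<delta> * S.inv_freq_square_sum"
    by (rule abs_sums_le[OF _ sums_diff[OF S.slope_series[OF t] S'.slope_series[OF t]] S.inv_freq_square_sum_sums])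
  then show ?thesis by (simp add: mult_ac)
qed

text \<open>Both diffusivities are quotients with denominators bounded below, and
  \<open>(a - a') u\<^sub>x = (N - N') - a' (u\<^sub>x - u'\<^sub>x)\<close> at \<open>x = 0\<close>, with numerators \<open>N\<close>, \<open>N'\<close>.\<close>

lemma a_gap:
  assumes t: "t \<in> {0..T}"
  shows "\<bar>a t - a' t\<bar> \<le> S.C_a * sqrt \<delta>"
proof -
  have eq: "(a t - a' t) * S.slope t
      = (integral {0..1} (\<lambda>x. F x t) - integral {0..1} (\<lambda>x. F' x t))
        - (nth_deriv_on {0..T} 1 E t - nth_deriv_on {0..T} 1 E' t)
        - a' t * (S.slope t - S'.slope t)"
    using S.slope_formula[OF t] S'.slope_formula[OF t] by (simp add: algebra_simps)
  have "\<bar>a' t * (S.slope t - S'.slope t)\<bar> \<le> S.a_max * (4 * S.C_sine * S.inv_freq_square_sum * sqrt \<delta>)"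
    unfolding abs_mult using S'.a_pos[OF t] S'.a_le[OF t] S.a_max_nonneg
    by (intro mult_mono slope_gap[OF t]) auto
  then have "\<bar>(a t - a' t) * S.slope t\<bar> \<le> 2 * sqrt \<delta> + S.a_max * (4 * S.C_sine * S.inv_freq_square_sum * sqrt \<delta>)"
    unfolding eq using F_close(4)[OF t] E_close(2)[OF t] delta_le_sqrt by linarith
  moreover have "\<bar>a t - a' t\<bar> * \<kappa> \<le> \<bar>(a t - a' t) * S.slope t\<bar>"
    unfolding abs_mult using S.slope_lower_bound[OF t] by (intro mult_left_mono) auto
  ultimately have "\<bar>a t - a' t\<bar> * \<kappa> \<le> (2 + S.a_max * (4 * S.C_sine * S.inv_freq_square_sum)) * sqrt \<delta>"
    by (simp add: algebra_simps)
  then show ?thesis using S.kappa_pos by (simp add: S.C_a_def pos_le_divide_eq)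
qed

text \<open>The coupling term contributes a factor \<open>\<mu>\<close>, so one power of decay is lost against the sine
  coefficients.\<close>

lemma xcos_source_gap:
  assumes t: "t \<in> {0..T}"
  shows "\<bar>(xcos_coeff (\<lambda>x. F x t) n - 2 * freq n * a t * s n t) - (xcos_coeff (\<lambda>x. F' x t) n - 2 * freq n * a' t * s' n t)\<bar>
    \<le> (4 + 2 * S.C_a * (1 + T) * K + 2 * S.a_max * S.C_sine) * sqrt \<delta> / freq n ^ 2"
proof -
  have "\<bar>(a t - a' t) * s n t\<bar> \<le> (S.C_a * sqrt \<delta>) * ((1 + T) * K / freq n ^ 4)"
    unfolding abs_mult using S.C_a_nonneg delta
    by (intro mult_mono a_gap[OF t] S.sine_coeff_bound[OF t]) auto
  also have "\<dots> = (S.C_a * sqrt \<delta>) * ((1 + T) * K) / freq n ^ 4" by simp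
  also have "\<dots> \<le> (S.C_a * sqrt \<delta>) * ((1 + T) * K) / freq n ^ 3"
    using S.C_a_nonneg delta S.T_pos S.K_nonneg by (intro divide_freq_power_mono) auto
  finally have 1: "\<bar>(a t - a' t) * s n t\<bar> \<le> S.C_a * (1 + T) * K * sqrt \<delta> / freq n ^ 3"
    by (simp add: mult_ac)
  have "\<bar>a' t * (s n t - s' n t)\<bar> \<le> S.a_max * (S.C_sine * sqrt \<delta> / freq n ^ 3)"
    unfolding abs_mult using S'.a_pos[OF t] S'.a_le[OF t] S.a_max_nonneg
    by (intro mult_mono sine_gap[OF t]) auto
  then have "\<bar>(a t - a' t) * s n t + a' t * (s n t - s' n t)\<bar>
      \<le> (S.C_a * (1 + T) * K + S.a_max * S.C_sine) * sqrt \<delta> / freq n ^ 3"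
    using 1 by (simp add: distrib_right add_divide_distrib)
  then have "2 * freq n * \<bar>(a t - a' t) * s n t + a' t * (s n t - s' n t)\<bar>
      \<le> 2 * freq n * ((S.C_a * (1 + T) * K + S.a_max * S.C_sine) * sqrt \<delta> / freq n ^ 3)"
    using freq_pos[of n] by (intro mult_left_mono) auto
  also have "\<dots> = (2 * S.C_a * (1 + T) * K + 2 * S.a_max * S.C_sine) * sqrt \<delta> / freq n ^ 2"
    using freq_pos[of n] by (simp add: numeral_eq_Suc field_simps)
  also have "2 * freq n * \<bar>(a t - a' t) * s n t + a' t * (s n t - s' n t)\<bar>
      = \<bar>2 * freq n * a t * s n t - 2 * freq n * a' t * s' n t\<bar>"
  proof -
    have "2 * freq n * a t * s n t - 2 * freq n * a' t * s' n t
        = 2 * freq n * ((a t - a' t) * s n t + a' t * (s n t - s' n t))"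
      by (simp add: algebra_simps)
    then show ?thesis using freq_pos[of n] by (simp add: abs_mult)
  qed
  finally have 2: "\<bar>2 * freq n * a t * s n t - 2 * freq n * a' t * s' n t\<bar>
      \<le> (2 * S.C_a * (1 + T) * K + 2 * S.a_max * S.C_sine) * sqrt \<delta> / freq n ^ 2" .
  have "4 * \<delta> / freq n ^ 3 \<le> 4 * \<delta> / freq n ^ 2"
    using delta by (intro divide_freq_power_mono) auto
  also have "\<dots> \<le> 4 * sqrt \<delta> / freq n ^ 2"
    using delta_le_sqrt freq_pos[of n] by (intro divide_right_mono mult_left_mono) auto
  finally have "\<bar>xcos_coeff (\<lambda>x. F x t) n - xcos_coeff (\<lambda>x. F' x t) n\<bar> \<le> 4 * sqrt \<delta> / freq n ^ 2"
    using F_close(2)[OF t, of n] by linarith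
  moreover have "(4 + 2 * S.C_a * (1 + T) * K + 2 * S.a_max * S.C_sine) * sqrt \<delta> / freq n ^ 2
      = 4 * sqrt \<delta> / freq n ^ 2 + (2 * S.C_a * (1 + T) * K + 2 * S.a_max * S.C_sine) * sqrt \<delta> / freq n ^ 2"
    by (simp add: distrib_right add_divide_distrib)
  ultimately show ?thesis using 2 by linarith
qed

lemma xcos_gap:
  assumes t: "t \<in> {0..T}"
  shows "\<bar>c n t - c' n t\<bar> \<le> S.C_xcos * sqrt \<delta> / freq n ^ 2"
proof -
  let ?g = "\<lambda>s. xcos_coeff (\<lambda>x. F x s) n - 2 * freq n * a s * sine_coeff (\<lambda>x. u x s) n"
  let ?g' = "\<lambda>s. xcos_coeff (\<lambda>x. F' x s) n - 2 * freq n * a' s * sine_coeff (\<lambda>x. u' x s) n"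
  let ?q = "4 + 2 * S.C_a * (1 + T) * K + 2 * S.a_max * S.C_sine"
  let ?mid = "duhamel ((freq n)\<^sup>2) S'.A (xcos_coeff \<phi> n) ?g t"
  have "\<bar>c n t - ?mid\<bar>
      \<le> (4 * K / freq n ^ 3 + T * (S.source_max / freq n ^ 3)) * sqrt (2 * (freq n)\<^sup>2 * (S.C_path * \<delta>))"
    unfolding S.xcos_coeff_formula[OF t]
    by (rule duhamel_diff_path[OF S.A_continuous S'.A_continuous S.xcos_source_continuous t
          S.A_mono S.A_0 S'.A_mono S'.A_0 _ S.phi_bounds(2) S.xcos_source_bound path_gap]) auto
  also have "\<dots> = (4 * K + T * S.source_max) * sqrt (2 * S.C_path) * sqrt \<delta> / freq n ^ 2"
    unfolding sqrt_path_gap using freq_pos[of n] by (simp add: numeral_eq_Suc field_simps)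
  finally have 1: "\<bar>c n t - ?mid\<bar> \<le> (4 * K + T * S.source_max) * sqrt (2 * S.C_path) * sqrt \<delta> / freq n ^ 2" .
  have "?mid - c' n t = duhamel ((freq n)\<^sup>2) S'.A (xcos_coeff \<phi> n - xcos_coeff \<phi>' n) (\<lambda>s. ?g s - ?g' s) t"
    unfolding S'.xcos_coeff_formula[OF t]
    by (rule duhamel_diff_data[OF S'.A_continuous S.xcos_source_continuous S'.xcos_source_continuous t])
  moreover have "\<bar>duhamel ((freq n)\<^sup>2) S'.A (xcos_coeff \<phi> n - xcos_coeff \<phi>' n) (\<lambda>s. ?g s - ?g' s) t\<bar>
      \<le> 4 * \<delta> / freq n ^ 3 + T * (?q * sqrt \<delta> / freq n ^ 2)"
    by (rule duhamel_bound[OF S'.A_continuous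
          continuous_on_diff[OF S.xcos_source_continuous S'.xcos_source_continuous] t
          S'.A_mono S'.A_0 _ phi_close(2) xcos_source_gap]) auto
  ultimately have 2: "\<bar>?mid - c' n t\<bar> \<le> 4 * \<delta> / freq n ^ 3 + T * (?q * sqrt \<delta> / freq n ^ 2)" by simp
  have "4 * \<delta> / freq n ^ 3 \<le> 4 * \<delta> / freq n ^ 2"
    using delta by (intro divide_freq_power_mono) auto
  also have "\<dots> \<le> 4 * sqrt \<delta> / freq n ^ 2"
    using delta_le_sqrt freq_pos[of n] by (intro divide_right_mono mult_left_mono) auto
  finally have 3: "4 * \<delta> / freq n ^ 3 \<le> 4 * sqrt \<delta> / freq n ^ 2" .
  have "S.C_xcos * sqrt \<delta> / freq n ^ 2 = (4 * K + T * S.source_max) * sqrt (2 * S.C_path) * sqrt \<delta> / freq n ^ 2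
      + (4 * sqrt \<delta> / freq n ^ 2 + T * (?q * sqrt \<delta> / freq n ^ 2))"
  proof -
    have "(p + (4 + T * q)) * e / d = p * e / d + (4 * e / d + T * (q * e / d))" for p q e d :: real
      by (simp add: algebra_simps add_divide_distrib)
    then show ?thesis unfolding S.C_xcos_def .
  qed
  then show ?thesis using 1 2 3 by linarith
qed

lemma u_gap:
  assumes t: "t \<in> {0..T}" and x: "x \<in> {0..1}"
  shows "\<bar>u x t - u' x t\<bar> \<le> S.C_u * sqrt \<delta>"
proof -
  let ?summand = "\<lambda>c s n. 4 * c n t * cos (freq n * x) + 4 * (1 - x) * s n t * sin (freq n * x)"
  have "\<bar>?summand c s n - ?summand c' s' n\<bar> \<le> 4 * (S.C_xcos + S.C_sine) * sqrt \<delta> / freq n ^ 2" for n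
  proof -
    have "\<bar>(c n t - c' n t) * cos (freq n * x)\<bar> \<le> (S.C_xcos * sqrt \<delta> / freq n ^ 2) * 1"
      unfolding abs_mult using S.C_xcos_nonneg delta by (intro mult_mono xcos_gap[OF t]) auto
    moreover have "\<bar>(s n t - s' n t) * ((1 - x) * sin (freq n * x))\<bar> \<le> (S.C_sine * sqrt \<delta> / freq n ^ 2) * (1 * 1)"
    proof -
      have "S.C_sine * sqrt \<delta> / freq n ^ 3 \<le> S.C_sine * sqrt \<delta> / freq n ^ 2"
        using S.C_sine_nonneg delta by (intro divide_freq_power_mono) auto
      then have "\<bar>s n t - s' n t\<bar> \<le> S.C_sine * sqrt \<delta> / freq n ^ 2" using sine_gap[OF t, of n] by linarith
      then show ?thesis
        unfolding abs_mult using x S.C_sine_nonneg delta by (intro mult_mono) auto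
    qed
    moreover have "?summand c s n - ?summand c' s' n
        = 4 * ((c n t - c' n t) * cos (freq n * x)) + 4 * ((s n t - s' n t) * ((1 - x) * sin (freq n * x)))"
      by (simp add: algebra_simps)
    moreover have "4 * (S.C_xcos + S.C_sine) * sqrt \<delta> / freq n ^ 2
        = 4 * (S.C_xcos * sqrt \<delta> / freq n ^ 2) + 4 * (S.C_sine * sqrt \<delta> / freq n ^ 2)"
      by (simp add: distrib_left distrib_right add_divide_distrib)
    ultimately show ?thesis by linarith
  qed
  then have "\<bar>(u x t - 2 * x_moment (\<lambda>x. u x t)) - (u' x t - 2 * x_moment (\<lambda>x. u' x t))\<bar>
      \<le> 4 * (S.C_xcos + S.C_sine) * sqrt \<delta> * S.inv_freq_square_sum"
    by (rule abs_sums_le[OF _ sums_diff[OF S.u_series[OF t x] S'.u_series[OF t x]] S.inv_freq_square_sum_sums])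
  moreover have "(1 + T) * \<delta> \<le> (1 + T) * sqrt \<delta>"
    using delta_le_sqrt S.T_pos by (intro mult_left_mono) auto
  moreover have "S.C_u * sqrt \<delta> = 2 * ((1 + T) * sqrt \<delta>) + 4 * (S.C_xcos + S.C_sine) * sqrt \<delta> * S.inv_freq_square_sum"
    unfolding S.C_u_def by (simp add: algebra_simps)
  ultimately show ?thesis using moment_gap[OF t] by linarith
qed

end

section \<open>Continuous dependence\<close>

text \<open>The pointwise content of a bound on the norm of the data: all later estimates use the values of the
  derivatives and not their suprema.\<close>

definition data_bounded :: "real \<Rightarrow> real \<Rightarrow> (real \<Rightarrow> real) \<Rightarrow> (real \<Rightarrow> real \<Rightarrow> real) \<Rightarrow> (real \<Rightarrow> real) \<Rightarrow> bool" where
  "data_bounded T K \<phi> F E \<longleftrightarrow>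
     (\<forall>j\<le>4. \<forall>x\<in>{0..1}. \<bar>nth_deriv_on {0..1} j \<phi> x\<bar> \<le> K)
   \<and> (\<forall>j\<le>4. \<forall>x\<in>{0..1}. \<forall>t\<in>{0..T}. \<bar>nth_deriv_on {0..1} j (\<lambda>x. F x t) x\<bar> \<le> K)
   \<and> (\<forall>j\<le>1. \<forall>t\<in>{0..T}. \<bar>nth_deriv_on {0..T} j E t\<bar> \<le> K)"

lemma data_bounded_data_norm:
  assumes "0 < T" "finite_norm T \<phi> F E"
  shows "data_bounded T (data_norm T \<phi> F E) \<phi> F E"
  using data_norm_bounds[OF assms] unfolding data_bounded_def by blast

lemma data_bounded_mono: "data_bounded T K \<phi> F E \<Longrightarrow> K \<le> K' \<Longrightarrow> data_bounded T K' \<phi> F E"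
  unfolding data_bounded_def by (meson order_trans)

lemma data_bounded_of_difference:
  assumes T: "0 < T" and fin: "finite_norm T \<phi> F E" "finite_norm T \<phi>' F' E'"
    and K: "data_bounded T K \<phi> F E"
    and d: "data_bounded T \<delta> (\<lambda>x. \<phi> x - \<phi>' x) (\<lambda>x t. F x t - F' x t) (\<lambda>t. E t - E' t)"
  shows "data_bounded T (K + \<delta>) \<phi>' F' E'"
proof -
  have tri: "\<bar>q\<bar> \<le> K + \<delta>" if "\<bar>p\<bar> \<le> K" "\<bar>p - q\<bar> \<le> \<delta>" for p q :: real using that by linarith
  have td: "times_differentiable_on 4 {0..1} \<phi>" "times_differentiable_on 4 {0..1} \<phi>'"
    "times_differentiable_on 1 {0..T} E" "times_differentiable_on 1 {0..T} E'"
    using fin unfolding finite_norm_def Ck_on_def by auto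
  have tdF: "times_differentiable_on 4 {0..1} (\<lambda>x. F x t)" "times_differentiable_on 4 {0..1} (\<lambda>x. F' x t)"
    if "t \<in> {0..T}" for t
    using fin that unfolding finite_norm_def Ck0_def by auto
  show ?thesis
    unfolding data_bounded_def
  proof (intro conjI allI impI ballI)
    show "\<bar>nth_deriv_on {0..1} j \<phi>' x\<bar> \<le> K + \<delta>" if "j \<le> 4" "x \<in> {0..1}" for j x
    proof (rule tri)
      show "\<bar>nth_deriv_on {0..1} j \<phi> x\<bar> \<le> K" using K that unfolding data_bounded_def by blast
      show "\<bar>nth_deriv_on {0..1} j \<phi> x - nth_deriv_on {0..1} j \<phi>' x\<bar> \<le> \<delta>"
        unfolding nth_deriv_on_diff(1)[OF zero_less_one td(1,2) that, symmetric]
        using d that unfolding data_bounded_def by blast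
    qed
    show "\<bar>nth_deriv_on {0..1} j (\<lambda>x. F' x t) x\<bar> \<le> K + \<delta>" if "j \<le> 4" "x \<in> {0..1}" "t \<in> {0..T}" for j x t
    proof (rule tri)
      show "\<bar>nth_deriv_on {0..1} j (\<lambda>x. F x t) x\<bar> \<le> K" using K that unfolding data_bounded_def by blast
      show "\<bar>nth_deriv_on {0..1} j (\<lambda>x. F x t) x - nth_deriv_on {0..1} j (\<lambda>x. F' x t) x\<bar> \<le> \<delta>"
        unfolding nth_deriv_on_diff(1)[OF zero_less_one tdF[OF that(3)] that(1,2), symmetric]
        using d that unfolding data_bounded_def by blast
    qed
    show "\<bar>nth_deriv_on {0..T} j E' t\<bar> \<le> K + \<delta>" if "j \<le> 1" "t \<in> {0..T}" for j t
    proof (rule tri)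
      show "\<bar>nth_deriv_on {0..T} j E t\<bar> \<le> K" using K that unfolding data_bounded_def by blast
      show "\<bar>nth_deriv_on {0..T} j E t - nth_deriv_on {0..T} j E' t\<bar> \<le> \<delta>"
        unfolding nth_deriv_on_diff(1)[OF T td(3,4) that, symmetric]
        using d that unfolding data_bounded_def by blast
    qed
  qed
qed

lemma bounded_solutionI:
  assumes T: "0 < T" and K: "0 \<le> K" and \<kappa>: "0 < \<kappa>" and adm: "admissible_data T \<phi> F E"
    and sol: "classical_solution T \<phi> F E a u" and b: "data_bounded T K \<phi> F E"
    and lower: "\<kappa> \<le> margin T \<phi> F E" "\<kappa> \<le> sine_coeff \<phi> k"
  shows "bounded_solution T K \<kappa> k \<phi> F E a u"
proof -
  note P = profile_coeff_bounds[OF admissible_profiles(1)[OF adm], of K]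
  note Q = profile_coeff_bounds[OF admissible_profiles(2)[OF adm], of _ K]
  show ?thesis
    by unfold_locales
       (use T K \<kappa> adm sol lower b P Q in \<open>auto simp: data_bounded_def\<close>)
qed

lemma two_solutionsI:
  assumes S: "bounded_solution T K \<kappa> k \<phi> F E a u" "bounded_solution T K \<kappa> k \<phi>' F' E' a' u'"
    and d: "data_bounded T \<delta> (\<lambda>x. \<phi> x - \<phi>' x) (\<lambda>x t. F x t - F' x t) (\<lambda>t. E t - E' t)"
    and \<delta>: "\<delta> \<le> 1"
  shows "two_solutions T K \<kappa> k \<phi> F E a u \<phi>' F' E' a' u' \<delta>"
proof -
  interpret S: bounded_solution T K \<kappa> k \<phi> F E a u by fact
  interpret S': bounded_solution T K \<kappa> k \<phi>' F' E' a' u' by fact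
  have p: "compatible_profile \<phi>" "compatible_profile \<phi>'"
    by (rule admissible_profiles[OF S.admissible] admissible_profiles[OF S'.admissible])+
  have q: "compatible_profile (\<lambda>x. F x t)" "compatible_profile (\<lambda>x. F' x t)" if "t \<in> {0..T}" for t
    using admissible_profiles(2)[OF S.admissible that] admissible_profiles(2)[OF S'.admissible that] by auto
  note P = profile_coeff_bounds[OF compatible_profile_diff[OF p], of \<delta>,
      unfolded coeff_diff[OF compatible_profile_continuous[OF p(1)] compatible_profile_continuous[OF p(2)]]]
  have Q: "\<bar>sine_coeff (\<lambda>x. F x t) n - sine_coeff (\<lambda>x. F' x t) n\<bar> \<le> \<delta> / freq n ^ 4"
    "\<bar>xcos_coeff (\<lambda>x. F x t) n - xcos_coeff (\<lambda>x. F' x t) n\<bar> \<le> 4 * \<delta> / freq n ^ 3"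
    "\<bar>x_moment (\<lambda>x. F x t) - x_moment (\<lambda>x. F' x t)\<bar> \<le> \<delta>"
    "\<bar>integral {0..1} (\<lambda>x. F x t) - integral {0..1} (\<lambda>x. F' x t)\<bar> \<le> \<delta>" if t: "t \<in> {0..T}" for n t
    using profile_coeff_bounds[OF compatible_profile_diff[OF q[OF t]], of \<delta>,
      unfolded coeff_diff[OF compatible_profile_continuous[OF q(1)[OF t]] compatible_profile_continuous[OF q(2)[OF t]]]]
      d t unfolding data_bounded_def by blast+
  have E: "\<bar>nth_deriv_on {0..T} j E t - nth_deriv_on {0..T} j E' t\<bar> \<le> \<delta>" if "j \<le> 1" "t \<in> {0..T}" for j t
  proof -
    have "times_differentiable_on 1 {0..T} E" "times_differentiable_on 1 {0..T} E'"
      using S.admissible S'.admissible unfolding admissible_data_def assm_A1_def Ck_on_def by auto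
    then show ?thesis
      unfolding nth_deriv_on_diff(1)[OF S.T_pos _ _ that, symmetric]
      using d that nth_deriv_on_diff(1)[OF S.T_pos _ _ that, of E E'] unfolding data_bounded_def by metis
  qed
  have "0 \<le> \<delta>" using E[of 0 0] S.T_pos by auto
  then show ?thesis
    by unfold_locales
       (use \<delta> d P Q E[of 0] E[of 1] in \<open>auto simp: data_bounded_def\<close>)
qed

text \<open>The two positive quantities that control the constants depend continuously on the data, so one
  choice of \<open>\<kappa>\<close> and of the distinguished coefficient serves all data nearby.\<close>

lemma margin_stable:
  assumes T: "0 < T" and adm: "admissible_data T \<phi> F E" "admissible_data T \<phi>' F' E'"
    and d: "data_bounded T \<delta> (\<lambda>x. \<phi> x - \<phi>' x) (\<lambda>x t. F x t - F' x t) (\<lambda>t. E t - E' t)"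
  shows "\<bar>margin T \<phi> F E - margin T \<phi>' F' E'\<bar> \<le> (3 + 2 * T) * \<delta>"
    and "\<bar>sine_coeff \<phi> k - sine_coeff \<phi>' k\<bar> \<le> \<delta>"
proof -
  have p: "compatible_profile \<phi>" "compatible_profile \<phi>'"
    by (rule admissible_profiles[OF adm(1)] admissible_profiles[OF adm(2)])+
  have q: "compatible_profile (\<lambda>x. F x t)" "compatible_profile (\<lambda>x. F' x t)" if "t \<in> {0..T}" for t
    using admissible_profiles(2)[OF adm(1) that] admissible_profiles(2)[OF adm(2) that] by auto
  note P = profile_coeff_bounds[OF compatible_profile_diff[OF p], of \<delta>,
      unfolded coeff_diff[OF compatible_profile_continuous[OF p(1)] compatible_profile_continuous[OF p(2)]]]
  have "\<bar>sine_coeff \<phi> k - sine_coeff \<phi>' k\<bar> \<le> \<delta> / freq k ^ 4"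
    using P(1)[of k] d unfolding data_bounded_def by blast
  moreover have \<delta>: "0 \<le> \<delta>" using d unfolding data_bounded_def by (meson abs_ge_zero atLeastAtMost_iff order_refl order_trans zero_le zero_le_one)
  ultimately show "\<bar>sine_coeff \<phi> k - sine_coeff \<phi>' k\<bar> \<le> \<delta>"
    using divide_freq_power_mono[of \<delta> 0 4 k] by simp
  have Q: "\<bar>x_moment (\<lambda>x. F x t) - x_moment (\<lambda>x. F' x t)\<bar> \<le> \<delta>" if t: "t \<in> {0..T}" for t
    using profile_coeff_bounds(3)[OF compatible_profile_diff[OF q[OF t]], of \<delta>,
      unfolded coeff_diff[OF compatible_profile_continuous[OF q(1)[OF t]] compatible_profile_continuous[OF q(2)[OF t]]]]
      d t unfolding data_bounded_def by blast
  have i: "(\<lambda>s. x_moment (\<lambda>x. F x s)) integrable_on {0..T}" "(\<lambda>s. x_moment (\<lambda>x. F' x s)) integrable_on {0..T}"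
    by (intro integrable_continuous_interval admissible_coeffs_continuous(3)[OF adm(1)]
        admissible_coeffs_continuous(3)[OF adm(2)])+
  have "\<bar>integral {0..T} (\<lambda>s. x_moment (\<lambda>x. F x s) - x_moment (\<lambda>x. F' x s))\<bar> \<le> T * \<delta>"
    by (rule integral_le_length_times_bound[OF integrable_diff[OF i]]) (use T Q in auto)
  moreover have "\<bar>x_moment \<phi> - x_moment \<phi>'\<bar> \<le> \<delta>"
    using P(3) d unfolding data_bounded_def by blast
  moreover have "\<bar>E T - E' T\<bar> \<le> \<delta>"
    using d T unfolding data_bounded_def by (auto dest!: spec[of _ 0])
  ultimately show "\<bar>margin T \<phi> F E - margin T \<phi>' F' E'\<bar> \<le> (3 + 2 * T) * \<delta>"
    unfolding margin_def integral_diff[OF i] by (simp add: distrib_right)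
qed

lemma stability_estimate:
  assumes T: "0 < T" and adm: "admissible_data T \<phi> F E"
  shows "\<exists>C \<delta>\<^sub>0. 0 \<le> C \<and> 0 < \<delta>\<^sub>0 \<and>
    (\<forall>\<phi>' F' E' a u a' u' \<delta>. admissible_data T \<phi>' F' E'
       \<longrightarrow> data_bounded T \<delta> (\<lambda>x. \<phi> x - \<phi>' x) (\<lambda>x t. F x t - F' x t) (\<lambda>t. E t - E' t) \<longrightarrow> \<delta> \<le> \<delta>\<^sub>0
       \<longrightarrow> classical_solution T \<phi> F E a u \<longrightarrow> classical_solution T \<phi>' F' E' a' u'
       \<longrightarrow> (\<forall>t\<in>{0..T}. \<bar>a t - a' t\<bar> \<le> C * sqrt \<delta>)
           \<and> (\<forall>x\<in>{0..1}. \<forall>t\<in>{0..T}. \<bar>u x t - u' x t\<bar> \<le> C * sqrt \<delta>))"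
proof -
  obtain k where k: "0 < sine_coeff \<phi> k" using admissible_sine_coeff_pos[OF T adm] by blast
  define K where "K = data_norm T \<phi> F E + 1"
  \<comment> \<open>Half of the values for the given data leaves room for the perturbed data.\<close>
  define \<kappa> where "\<kappa> = min (margin T \<phi> F E) (sine_coeff \<phi> k) / 2"
  define \<delta>\<^sub>0 where "\<delta>\<^sub>0 = min 1 (\<kappa> / (3 + 2 * T))"
  have fin: "finite_norm T \<phi> F E" using adm unfolding admissible_data_def by blast
  have b: "data_bounded T (data_norm T \<phi> F E) \<phi> F E" by (rule data_bounded_data_norm[OF T fin])
  have "\<bar>nth_deriv_on {0..1} 0 \<phi> 0\<bar> \<le> data_norm T \<phi> F E"
    using b unfolding data_bounded_def by (meson atLeastAtMost_iff order_refl zero_le zero_le_one)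
  then have K: "0 \<le> K" by (simp add: K_def)
  have \<kappa>: "0 < \<kappa>" using k admissible_margin_pos[OF T adm] by (simp add: \<kappa>_def)
  have \<delta>0: "0 < \<delta>\<^sub>0" using \<kappa> T by (simp add: \<delta>\<^sub>0_def)
  interpret D: data_class T K \<kappa> k using T K \<kappa> by unfold_locales
  let ?C = "max D.C_a D.C_u"
  show ?thesis
  proof (rule exI[of _ ?C], rule exI[of _ \<delta>\<^sub>0], intro conjI allI impI)
    show "0 \<le> ?C" using D.C_a_nonneg by simp
    show "0 < \<delta>\<^sub>0" by (rule \<delta>0)
    fix \<phi>' F' E' a u a' u' \<delta>
    assume adm': "admissible_data T \<phi>' F' E'"
      and d: "data_bounded T \<delta> (\<lambda>x. \<phi> x - \<phi>' x) (\<lambda>x t. F x t - F' x t) (\<lambda>t. E t - E' t)"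
      and \<delta>: "\<delta> \<le> \<delta>\<^sub>0" and sol: "classical_solution T \<phi> F E a u" and sol': "classical_solution T \<phi>' F' E' a' u'"
    have fin': "finite_norm T \<phi>' F' E'" using adm' unfolding admissible_data_def by blast
    have \<delta>1: "\<delta> \<le> 1" using \<delta> by (simp add: \<delta>\<^sub>0_def)
    have "(3 + 2 * T) * \<delta> \<le> (3 + 2 * T) * (\<kappa> / (3 + 2 * T))"
      using \<delta> T by (intro mult_left_mono) (auto simp: \<delta>\<^sub>0_def)
    then have \<delta>\<kappa>: "(3 + 2 * T) * \<delta> \<le> \<kappa>" using T by simp
    have "\<delta> \<le> \<kappa>"
    proof -
      have "\<kappa> / (3 + 2 * T) \<le> \<kappa>" using \<kappa> T by (simp add: pos_divide_le_eq mult_le_cancel_left1)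
      then show ?thesis using \<delta> by (simp add: \<delta>\<^sub>0_def)
    qed
    then have lower: "\<kappa> \<le> margin T \<phi>' F' E'" "\<kappa> \<le> sine_coeff \<phi>' k"
      using margin_stable(1)[OF T adm adm' d] margin_stable(2)[OF T adm adm' d, of k] \<delta>\<kappa>
      unfolding \<kappa>_def by linarith+
    have "bounded_solution T K \<kappa> k \<phi> F E a u"
      by (rule bounded_solutionI[OF T K \<kappa> adm sol data_bounded_mono[OF b]])
         (use \<kappa> in \<open>auto simp: K_def \<kappa>_def\<close>)
    moreover have "bounded_solution T K \<kappa> k \<phi>' F' E' a' u'"
      by (rule bounded_solutionI[OF T K \<kappa> adm' sol' data_bounded_mono[OF data_bounded_of_difference[OF T fin fin' b d]] lower])
         (use \<delta>1 in \<open>simp add: K_def\<close>)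
    ultimately interpret two_solutions T K \<kappa> k \<phi> F E a u \<phi>' F' E' a' u' \<delta>
      by (rule two_solutionsI[OF _ _ d \<delta>1])
    have max: "D.C_a * sqrt \<delta> \<le> ?C * sqrt \<delta>" "D.C_u * sqrt \<delta> \<le> ?C * sqrt \<delta>"
      using delta by (intro mult_right_mono; simp)+
    show "\<forall>t\<in>{0..T}. \<bar>a t - a' t\<bar> \<le> ?C * sqrt \<delta>"
      using a_gap max(1) by (meson order_trans)
    show "\<forall>x\<in>{0..1}. \<forall>t\<in>{0..T}. \<bar>u x t - u' x t\<bar> \<le> ?C * sqrt \<delta>"
      using u_gap max(2) by (meson order_trans)
  qed
qed

theorem theorem2:
  fixes Tstar :: real
    and \<phi> :: "real \<Rightarrow> real" and F :: "real \<Rightarrow> real \<Rightarrow> real" and E :: "real \<Rightarrow> real"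
  assumes "Tstar > 0"
    and "admissible_data Tstar \<phi> F E"
  shows "\<exists>T1. 0 < T1 \<and> T1 \<le> Tstar \<and>
    (\<forall>T. 0 < T \<and> T \<le> T1 \<longrightarrow>
      (\<forall>\<epsilon>>0. \<exists>\<delta>>0. \<forall>\<phi>' F' E'.
         admissible_data T \<phi>' F' E'
         \<and> data_norm T (\<lambda>x. \<phi> x - \<phi>' x) (\<lambda>x t. F x t - F' x t) (\<lambda>t. E t - E' t) < \<delta> \<longrightarrow>
         (\<forall>a u a' u'.
            classical_solution T \<phi> F E a u \<and> classical_solution T \<phi>' F' E' a' u' \<longrightarrow>
            sup_norm {0..T} (\<lambda>t. a t - a' t) < \<epsilon>
            \<and> sup_norm (QT_closed T) (\<lambda>(x, t). u x t - u' x t) < \<epsilon>)))"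
proof (rule exI[of _ Tstar], intro conjI allI impI)
  fix T \<epsilon> :: real
  assume T: "0 < T \<and> T \<le> Tstar" and \<epsilon>: "0 < \<epsilon>"
  have adm: "admissible_data T \<phi> F E"
    by (rule admissible_data_restrict[OF assms(2)]) (use T in auto)
  obtain C \<delta>\<^sub>0 where C: "0 \<le> C" and \<delta>0: "0 < \<delta>\<^sub>0"
    and est: "\<And>\<phi>' F' E' a u a' u' \<delta>. admissible_data T \<phi>' F' E'
       \<Longrightarrow> data_bounded T \<delta> (\<lambda>x. \<phi> x - \<phi>' x) (\<lambda>x t. F x t - F' x t) (\<lambda>t. E t - E' t) \<Longrightarrow> \<delta> \<le> \<delta>\<^sub>0
       \<Longrightarrow> classical_solution T \<phi> F E a u \<Longrightarrow> classical_solution T \<phi>' F' E' a' u'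
       \<Longrightarrow> (\<forall>t\<in>{0..T}. \<bar>a t - a' t\<bar> \<le> C * sqrt \<delta>)
           \<and> (\<forall>x\<in>{0..1}. \<forall>t\<in>{0..T}. \<bar>u x t - u' x t\<bar> \<le> C * sqrt \<delta>)"
    using stability_estimate[OF _ adm] T by blast
  \<comment> \<open>The sum \<open>C + 1\<close> avoids a division by zero, the factor \<open>2\<close> makes the final inequality strict.\<close>
  define \<delta> where "\<delta> = min \<delta>\<^sub>0 ((\<epsilon> / (2 * (C + 1)))\<^sup>2)"
  have \<delta>: "0 < \<delta>" using \<delta>0 \<epsilon> C by (simp add: \<delta>_def)
  have "C * sqrt \<delta> < \<epsilon>"
  proof -
    have "sqrt \<delta> \<le> \<epsilon> / (2 * (C + 1))"
      using \<epsilon> C by (intro real_le_lsqrt) (auto simp: \<delta>_def)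
    then have "(C + 1) * sqrt \<delta> \<le> \<epsilon> / 2" using C by (simp add: field_simps)
    moreover have "C * sqrt \<delta> \<le> (C + 1) * sqrt \<delta>" using \<delta> by (intro mult_right_mono) auto
    ultimately show ?thesis using \<epsilon> by linarith
  qed
  show "\<exists>\<delta>>0. \<forall>\<phi>' F' E'.
         admissible_data T \<phi>' F' E'
         \<and> data_norm T (\<lambda>x. \<phi> x - \<phi>' x) (\<lambda>x t. F x t - F' x t) (\<lambda>t. E t - E' t) < \<delta> \<longrightarrow>
         (\<forall>a u a' u'.
            classical_solution T \<phi> F E a u \<and> classical_solution T \<phi>' F' E' a' u' \<longrightarrow>
            sup_norm {0..T} (\<lambda>t. a t - a' t) < \<epsilon>
            \<and> sup_norm (QT_closed T) (\<lambda>(x, t). u x t - u' x t) < \<epsilon>)"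
  proof (intro exI[of _ \<delta>] conjI allI impI \<delta>)
    fix \<phi>' F' E' a u a' u'
    assume d: "admissible_data T \<phi>' F' E'
         \<and> data_norm T (\<lambda>x. \<phi> x - \<phi>' x) (\<lambda>x t. F x t - F' x t) (\<lambda>t. E t - E' t) < \<delta>"
      and sol: "classical_solution T \<phi> F E a u \<and> classical_solution T \<phi>' F' E' a' u'"
    have "finite_norm T (\<lambda>x. \<phi> x - \<phi>' x) (\<lambda>x t. F x t - F' x t) (\<lambda>t. E t - E' t)"
      by (rule finite_norm_diff) (use T adm d in \<open>auto simp: admissible_data_def\<close>)
    from data_bounded_mono[OF data_bounded_data_norm[OF _ this], of \<delta>]
    have "data_bounded T \<delta> (\<lambda>x. \<phi> x - \<phi>' x) (\<lambda>x t. F x t - F' x t) (\<lambda>t. E t - E' t)"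
      using d T by simp
    then have gap: "(\<forall>t\<in>{0..T}. \<bar>a t - a' t\<bar> \<le> C * sqrt \<delta>)
        \<and> (\<forall>x\<in>{0..1}. \<forall>t\<in>{0..T}. \<bar>u x t - u' x t\<bar> \<le> C * sqrt \<delta>)"
      using d sol by (intro est) (auto simp: \<delta>_def)
    have "sup_norm {0..T} (\<lambda>t. a t - a' t) \<le> C * sqrt \<delta>"
      by (rule sup_norm_le) (use gap T in auto)
    then show "sup_norm {0..T} (\<lambda>t. a t - a' t) < \<epsilon>" using \<open>C * sqrt \<delta> < \<epsilon>\<close> by linarith
    have "sup_norm (QT_closed T) (\<lambda>(x, t). u x t - u' x t) \<le> C * sqrt \<delta>"
      by (rule sup_norm_le) (use gap T in \<open>auto simp: QT_closed_def\<close>)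
    then show "sup_norm (QT_closed T) (\<lambda>(x, t). u x t - u' x t) < \<epsilon>"
      using \<open>C * sqrt \<delta> < \<epsilon>\<close> by linarith
  qed
qed (use assms(1) in auto)

end
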